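(* Let $\tau$ be a trace on a separable C*-algebra $A$ and let $\omega$ be a non-trivial ultrafilter on $\mathbb N$. (MF version) The following are equivalent: (i) $\tau$ is an MF trace; (ii) there exist $m_n\in\mathbb N$ and a $*$-homomorphism $f:A\to\prod M_{m_n}/\oplus_{2,\omega}M_{m_n}$ such that $\tau=tr\circ f$ and $f$ lifts to a discrete asymptotic homomorphism from $A$ to $\prod M_{m_n}$; (iii) there exist $m_n\in\mathbb N$ and a discrete asymptotic homomorphism $f^k:A\to\prod M_{m_n}/\oplus_{2,\omega}M_{m_n}$, $k\in\mathbb N$, such that $\tau(a)=\lim_{k\to\infty}tr\,f^k(a)$ for any $a\in A$, and $(f^k)$ lifts asymptotically to a discrete asymptotic homomorphism from $A$ to $\prod M_{m_n}$. (Quasidiagonal version) The following are equivalent: (i) $\tau$ is a quasidiagonal trace; (ii) there exist $m_n\in\mathbb N$ and a $*$-homomorphism $f:A\to\prod M_{m_n}/\oplus_{2,\omega}M_{m_n}$ such that $\tau=tr\circ f$ and $f$ lifts to a cp discrete asymptotic homomorphism from $A$ to $\prod M_{m_n}$; (iii) there exist $m_n\in\mathbb N$ and a discrete asymptotic homomorphism $f^k:A\to\prod M_{m_n}/\oplus_{2,\omega}M_{m_n}$, $k\in\mathbb N$, such that $\tau(a)=\lim_{k\to\infty}tr\,f^k(a)$ for any $a\in A$, and $(f^k)$ lifts asymptotically to a cp discrete asymptotic homomorphism from $A$ to $\prod M_{m_n}$.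
   Context: A trace on $A$ is a positive linear functional $\tau$ with $\|\tau\|\le1$ and $\tau(ab)=\tau(ba)$. On matrices, $tr$ (or $tr_m$) is the normalized trace on $M_m$ and $\|T\|_2=tr(T^*T)^{1/2}$. cp/ccp means (contractive) completely positive and linear. A trace $\tau$ is MF if there are maps $\phi_n:A\to M_{k_n}$, $n\in\mathbb N$, such that for all $a,b\in A$, $\lambda,\mu\in\mathbb C$: $\|\phi_n(ab)-\phi_n(a)\phi_n(b)\|\to0$, $\|\phi_n(\lambda a+\mu b)-\lambda\phi_n(a)-\mu\phi_n(b)\|\to0$, $\|\phi_n(a^* )-\phi_n(a)^*\|\to0$ (operator norm), $\sup_n\|\phi_n(a)\|<\infty$ and $|\tau(a)-tr\,\phi_n(a)|\to0$. It is quasidiagonal if there are ccp maps $\phi_n:A\to M_{k_n}$ with $\|\phi_n(ab)-\phi_n(a)\phi_n(b)\|\to0$ and $|\tau(a)-tr\,\phi_n(a)|\to0$ for all $a,b\in A$. $\prod M_{m_n}$ is the C*-algebra of bounded sequences, $\oplus_{2,\omega}M_{m_n}=\{(T_n)\in\prod M_{m_n}\mid\lim_{n\to\omega}\|T_n\|_2=0\}$, $q$ is the quotient map $\prod M_{m_n}\to\prod M_{m_n}/\oplus_{2,\omega}M_{m_n}$, and the quotient carries the trace $tr([(T_n)])=\lim_{n\to\omega}tr\,T_n$. A discrete asymptotic homomorphism from $A$ to a C*-algebra $E$ is a sequence of maps $f^k:A\to E$, $k\in\mathbb N$, with $\sup_k\|f^k(a)\|<\infty$, $\|f^k(a^* )-f^k(a)^*\|\to0$,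 $\|f^k(\mu_1a+\mu_2b)-\mu_1f^k(a)-\mu_2f^k(b)\|\to0$, $\|f^k(ab)-f^k(a)f^k(b)\|\to0$ for all $a,b\in A$, $\mu_1,\mu_2\in\mathbb C$; it is cp if each $f^k$ is cp. A $*$-homomorphism $f:A\to\prod M_{m_n}/\oplus_{2,\omega}M_{m_n}$ lifts to $(\psi^k)$, $\psi^k:A\to\prod M_{m_n}$, if $q\circ\psi^k=f$ for every $k$. A discrete asymptotic homomorphism $(f^k)$ into the quotient lifts asymptotically to $(\psi^k)$ if $\lim_{k\to\infty}\|q(\psi^k(a))-f^k(a)\|=0$ for every $a\in A$. *)

theory Defs
  imports
    "HOL-Analysis.L2_Norm"
    "HOL-Analysis.Abstract_Metric_Spaces"
    "Jordan_Normal_Form.Schur_Decomposition"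
begin

section \<open>C*-algebras\<close>

text \<open>
  C*-algebras are not assumed to be unital. They are carrier-based because the algebras
  \<open>prod_mat m\<close> and \<open>tracial_quotient m \<omega>\<close> below depend on a sequence \<open>m\<close> of matrix sizes.
\<close>

record 'a star_alg = "'a partial_object" +
  czero :: 'a
  cplus :: "'a \<Rightarrow> 'a \<Rightarrow> 'a" (infixl "\<boxplus>\<index>" 65)
  ctimes :: "'a \<Rightarrow> 'a \<Rightarrow> 'a" (infixl "\<boxdot>\<index>" 70)
  cscale :: "complex \<Rightarrow> 'a \<Rightarrow> 'a" (infixr "\<triangleright>\<index>" 75)
  cstar :: "'a \<Rightarrow> 'a"
  cnorm :: "'a \<Rightarrow> real"

definition cminus :: "'a star_alg \<Rightarrow> 'a \<Rightarrow> 'a \<Rightarrow> 'a" where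
  "cminus E x y = x \<boxplus>\<^bsub>E\<^esub> ((-1) \<triangleright>\<^bsub>E\<^esub> y)"

text \<open>
  The value outside the carrier is irrelevant; it is \<open>0\<close> because the locale
  \<open>Metric_space\<close> requires nonnegativity and symmetry of the distance on the whole type.
\<close>

definition cdist :: "'a star_alg \<Rightarrow> 'a \<Rightarrow> 'a \<Rightarrow> real" where
  "cdist E x y = (if x \<in> carrier E \<and> y \<in> carrier E then cnorm E (cminus E x y) else 0)"

locale cstar_algebra =
  fixes A :: "'a star_alg" (structure)
  assumes zero_closed: "czero A \<in> carrier A"
    and plus_closed: "\<lbrakk>x \<in> carrier A; y \<in> carrier A\<rbrakk> \<Longrightarrow> x \<boxplus> y \<in> carrier A"
    and times_closed: "\<lbrakk>x \<in> carrier A; y \<in> carrier A\<rbrakk> \<Longrightarrow> x \<boxdot> y \<in> carrier A"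
    and scale_closed: "x \<in> carrier A \<Longrightarrow> c \<triangleright> x \<in> carrier A"
    and star_closed: "x \<in> carrier A \<Longrightarrow> cstar A x \<in> carrier A"
    and plus_assoc: "\<lbrakk>x \<in> carrier A; y \<in> carrier A; z \<in> carrier A\<rbrakk>
      \<Longrightarrow> (x \<boxplus> y) \<boxplus> z = x \<boxplus> (y \<boxplus> z)"
    and plus_commute: "\<lbrakk>x \<in> carrier A; y \<in> carrier A\<rbrakk> \<Longrightarrow> x \<boxplus> y = y \<boxplus> x"
    and plus_zero: "x \<in> carrier A \<Longrightarrow> x \<boxplus> czero A = x"
    and plus_inverse: "x \<in> carrier A \<Longrightarrow> x \<boxplus> ((-1) \<triangleright> x) = czero A"
    and scale_plus: "\<lbrakk>x \<in> carrier A; y \<in> carrier A\<rbrakk> \<Longrightarrow> c \<triangleright> (x \<boxplus> y) = (c \<triangleright> x) \<boxplus> (c \<triangleright> y)"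
    and plus_scale: "x \<in> carrier A \<Longrightarrow> (c + d) \<triangleright> x = (c \<triangleright> x) \<boxplus> (d \<triangleright> x)"
    and scale_scale: "x \<in> carrier A \<Longrightarrow> c \<triangleright> (d \<triangleright> x) = (c * d) \<triangleright> x"
    and scale_one: "x \<in> carrier A \<Longrightarrow> 1 \<triangleright> x = x"
    and times_assoc: "\<lbrakk>x \<in> carrier A; y \<in> carrier A; z \<in> carrier A\<rbrakk>
      \<Longrightarrow> (x \<boxdot> y) \<boxdot> z = x \<boxdot> (y \<boxdot> z)"
    and times_plus: "\<lbrakk>x \<in> carrier A; y \<in> carrier A; z \<in> carrier A\<rbrakk>
      \<Longrightarrow> x \<boxdot> (y \<boxplus> z) = (x \<boxdot> y) \<boxplus> (x \<boxdot> z)"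
    and plus_times: "\<lbrakk>x \<in> carrier A; y \<in> carrier A; z \<in> carrier A\<rbrakk>
      \<Longrightarrow> (x \<boxplus> y) \<boxdot> z = (x \<boxdot> z) \<boxplus> (y \<boxdot> z)"
    and scale_times: "\<lbrakk>x \<in> carrier A; y \<in> carrier A\<rbrakk> \<Longrightarrow> (c \<triangleright> x) \<boxdot> y = c \<triangleright> (x \<boxdot> y)"
    and times_scale: "\<lbrakk>x \<in> carrier A; y \<in> carrier A\<rbrakk> \<Longrightarrow> x \<boxdot> (c \<triangleright> y) = c \<triangleright> (x \<boxdot> y)"
    and star_star: "x \<in> carrier A \<Longrightarrow> cstar A (cstar A x) = x"
    and star_plus: "\<lbrakk>x \<in> carrier A; y \<in> carrier A\<rbrakk> \<Longrightarrow> cstar A (x \<boxplus> y) = cstar A x \<boxplus> cstar A y"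
    and star_scale: "x \<in> carrier A \<Longrightarrow> cstar A (c \<triangleright> x) = cnj c \<triangleright> cstar A x"
    and star_times: "\<lbrakk>x \<in> carrier A; y \<in> carrier A\<rbrakk> \<Longrightarrow> cstar A (x \<boxdot> y) = cstar A y \<boxdot> cstar A x"
    and norm_nonneg: "x \<in> carrier A \<Longrightarrow> 0 \<le> cnorm A x"
    and norm_eq_zero: "x \<in> carrier A \<Longrightarrow> cnorm A x = 0 \<longleftrightarrow> x = czero A"
    and norm_triangle: "\<lbrakk>x \<in> carrier A; y \<in> carrier A\<rbrakk> \<Longrightarrow> cnorm A (x \<boxplus> y) \<le> cnorm A x + cnorm A y"
    and norm_scale: "x \<in> carrier A \<Longrightarrow> cnorm A (c \<triangleright> x) = cmod c * cnorm A x"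
    and norm_times: "\<lbrakk>x \<in> carrier A; y \<in> carrier A\<rbrakk> \<Longrightarrow> cnorm A (x \<boxdot> y) \<le> cnorm A x * cnorm A y"
    and cstar_identity: "x \<in> carrier A \<Longrightarrow> cnorm A (cstar A x \<boxdot> x) = (cnorm A x)\<^sup>2"
    and complete: "Metric_space.mcomplete (carrier A) (cdist A)"

lemma (in cstar_algebra) metric_space: "Metric_space (carrier A) (cdist A)"
proof
  have closed: "cminus A x y \<in> carrier A" if "x \<in> carrier A" "y \<in> carrier A" for x y
    using that by (simp add: cminus_def plus_closed scale_closed)
  have chain: "cminus A x z = cminus A x y \<boxplus> cminus A y z"
    if xyz: "x \<in> carrier A" "y \<in> carrier A" "z \<in> carrier A" for x y z
  proof -
    let ?y = "(-1) \<triangleright> y" and ?z = "(-1) \<triangleright> z"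
    have yz: "?y \<in> carrier A" "?z \<in> carrier A"
      using xyz by (simp_all add: scale_closed)
    have "(x \<boxplus> ?y) \<boxplus> (y \<boxplus> ?z) = x \<boxplus> ((?y \<boxplus> y) \<boxplus> ?z)"
      using xyz yz by (simp add: plus_assoc plus_closed)
    also have "?y \<boxplus> y = czero A"
      using xyz yz plus_commute plus_inverse by simp
    also have "czero A \<boxplus> ?z = ?z"
      using yz plus_commute plus_zero zero_closed by metis
    finally show ?thesis by (simp add: cminus_def)
  qed
  have swap: "cminus A y x = (-1) \<triangleright> cminus A x y" if "x \<in> carrier A" "y \<in> carrier A" for x y
    using that by (simp add: cminus_def scale_plus scale_closed scale_scale scale_one plus_commute)
  show "0 \<le> cdist A x y" for x y
    by (simp add: cdist_def norm_nonneg closed)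
  show "cdist A x y = cdist A y x" for x y
    by (auto simp: cdist_def swap[of x y] norm_scale closed)
  show "cdist A x y = 0 \<longleftrightarrow> x = y" if xy: "x \<in> carrier A" "y \<in> carrier A" for x y
  proof -
    have "x = y" if "cminus A x y = czero A"
    proof -
      have "x = x \<boxplus> ((-1) \<triangleright> y \<boxplus> y)"
        using xy plus_inverse plus_commute plus_zero scale_closed by metis
      also have "\<dots> = cminus A x y \<boxplus> y"
        using xy by (simp add: cminus_def plus_assoc scale_closed)
      finally show ?thesis
        using that xy plus_commute plus_zero zero_closed by metis
    qed
    then show ?thesis
      using xy by (auto simp: cdist_def norm_eq_zero closed) (simp add: cminus_def plus_inverse)
  qed
  show "cdist A x z \<le> cdist A x y + cdist A y z"
    if "x \<in> carrier A" "y \<in> carrier A" "z \<in> carrier A" for x y z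
    using that by (simp add: cdist_def chain[of x y z] norm_triangle closed)
qed

definition separable_cstar :: "'a star_alg \<Rightarrow> bool" where
  "separable_cstar A \<longleftrightarrow> separable_space (Metric_space.mtopology (carrier A) (cdist A))"

definition cpositive :: "'a star_alg \<Rightarrow> 'a \<Rightarrow> bool" where
  "cpositive A x \<longleftrightarrow> (\<exists>y\<in>carrier A. x = cstar A y \<boxdot>\<^bsub>A\<^esub> y)"

definition is_trace :: "'a star_alg \<Rightarrow> ('a \<Rightarrow> complex) \<Rightarrow> bool" where
  "is_trace A \<tau> \<longleftrightarrow>
     (\<forall>a\<in>carrier A. \<forall>b\<in>carrier A. \<tau> (a \<boxplus>\<^bsub>A\<^esub> b) = \<tau> a + \<tau> b) \<and>
     (\<forall>c. \<forall>a\<in>carrier A. \<tau> (c \<triangleright>\<^bsub>A\<^esub> a) = c * \<tau> a) \<and>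
     (\<forall>a\<in>carrier A. cpositive A a \<longrightarrow> \<tau> a \<in> \<real> \<and> 0 \<le> Re (\<tau> a)) \<and>
     (\<forall>a\<in>carrier A. cmod (\<tau> a) \<le> cnorm A a) \<and>
     (\<forall>a\<in>carrier A. \<forall>b\<in>carrier A. \<tau> (a \<boxdot>\<^bsub>A\<^esub> b) = \<tau> (b \<boxdot>\<^bsub>A\<^esub> a))"

section \<open>Maps between C*-algebras\<close>

definition clinear_map :: "'a star_alg \<Rightarrow> 'b star_alg \<Rightarrow> ('a \<Rightarrow> 'b) \<Rightarrow> bool" where
  "clinear_map A E f \<longleftrightarrow>
     f \<in> carrier A \<rightarrow> carrier E \<and>
     (\<forall>a\<in>carrier A. \<forall>b\<in>carrier A. f (a \<boxplus>\<^bsub>A\<^esub> b) = f a \<boxplus>\<^bsub>E\<^esub> f b) \<and>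
     (\<forall>c. \<forall>a\<in>carrier A. f (c \<triangleright>\<^bsub>A\<^esub> a) = c \<triangleright>\<^bsub>E\<^esub> f a)"

definition star_hom :: "'a star_alg \<Rightarrow> 'b star_alg \<Rightarrow> ('a \<Rightarrow> 'b) \<Rightarrow> bool" where
  "star_hom A E f \<longleftrightarrow>
     clinear_map A E f \<and>
     (\<forall>a\<in>carrier A. \<forall>b\<in>carrier A. f (a \<boxdot>\<^bsub>A\<^esub> b) = f a \<boxdot>\<^bsub>E\<^esub> f b) \<and>
     (\<forall>a\<in>carrier A. f (cstar A a) = cstar E (f a))"

primrec csum :: "'a star_alg \<Rightarrow> (nat \<Rightarrow> 'a) \<Rightarrow> nat \<Rightarrow> 'a" where
  "csum E g 0 = czero E"
| "csum E g (Suc n) = csum E g n \<boxplus>\<^bsub>E\<^esub> g n"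

text \<open>
  An element of \<open>M\<^sub>n(E)\<close> is a function of two indices, of which only the entries with
  indices below \<open>n\<close> matter. It is positive iff it has the form \<open>Y\<^sup>* Y\<close> with \<open>Y\<close> in \<open>M\<^sub>n(E)\<close>.
\<close>

definition mat_cpositive :: "'a star_alg \<Rightarrow> nat \<Rightarrow> (nat \<Rightarrow> nat \<Rightarrow> 'a) \<Rightarrow> bool" where
  "mat_cpositive E n X \<longleftrightarrow>
     (\<exists>Y. (\<forall>i<n. \<forall>j<n. Y i j \<in> carrier E) \<and>
          (\<forall>i<n. \<forall>j<n. X i j = csum E (\<lambda>k. cstar E (Y k i) \<boxdot>\<^bsub>E\<^esub> Y k j) n))"

definition cp_map :: "'a star_alg \<Rightarrow> 'b star_alg \<Rightarrow> ('a \<Rightarrow> 'b) \<Rightarrow> bool" where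
  "cp_map A E f \<longleftrightarrow>
     clinear_map A E f \<and>
     (\<forall>n X. mat_cpositive A n X \<longrightarrow> mat_cpositive E n (\<lambda>i j. f (X i j)))"

definition ccp_map :: "'a star_alg \<Rightarrow> 'b star_alg \<Rightarrow> ('a \<Rightarrow> 'b) \<Rightarrow> bool" where
  "ccp_map A E f \<longleftrightarrow> cp_map A E f \<and> (\<forall>a\<in>carrier A. cnorm E (f a) \<le> cnorm A a)"

definition asymptotically_multiplicative ::
    "'a star_alg \<Rightarrow> (nat \<Rightarrow> 'b star_alg) \<Rightarrow> (nat \<Rightarrow> 'a \<Rightarrow> 'b) \<Rightarrow> bool" where
  "asymptotically_multiplicative A E f \<longleftrightarrow>
     (\<forall>a\<in>carrier A. \<forall>b\<in>carrier A.
        (\<lambda>k. cnorm (E k) (cminus (E k) (f k (a \<boxdot>\<^bsub>A\<^esub> b)) (f k a \<boxdot>\<^bsub>E k\<^esub> f k b)))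
          \<longlonglongrightarrow> 0)"

text \<open>
  The target is allowed to vary with the index, so that the same conditions serve for
  MF traces (matrix algebras of varying size) and for discrete asymptotic homomorphisms
  (constant target).
\<close>

definition asymptotic_hom ::
    "'a star_alg \<Rightarrow> (nat \<Rightarrow> 'b star_alg) \<Rightarrow> (nat \<Rightarrow> 'a \<Rightarrow> 'b) \<Rightarrow> bool" where
  "asymptotic_hom A E f \<longleftrightarrow>
     (\<forall>k. f k \<in> carrier A \<rightarrow> carrier (E k)) \<and>
     (\<forall>a\<in>carrier A. bdd_above (range (\<lambda>k. cnorm (E k) (f k a)))) \<and>
     (\<forall>a\<in>carrier A.
        (\<lambda>k. cnorm (E k) (cminus (E k) (f k (cstar A a)) (cstar (E k) (f k a)))) \<longlonglongrightarrow> 0) \<and>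
     (\<forall>a\<in>carrier A. \<forall>b\<in>carrier A. \<forall>c d.
        (\<lambda>k. cnorm (E k) (cminus (E k)
               (f k ((c \<triangleright>\<^bsub>A\<^esub> a) \<boxplus>\<^bsub>A\<^esub> (d \<triangleright>\<^bsub>A\<^esub> b)))
               ((c \<triangleright>\<^bsub>E k\<^esub> f k a) \<boxplus>\<^bsub>E k\<^esub> (d \<triangleright>\<^bsub>E k\<^esub> f k b)))) \<longlonglongrightarrow> 0) \<and>
     asymptotically_multiplicative A E f"

definition discrete_asymptotic_hom ::
    "'a star_alg \<Rightarrow> 'b star_alg \<Rightarrow> (nat \<Rightarrow> 'a \<Rightarrow> 'b) \<Rightarrow> bool" where
  "discrete_asymptotic_hom A E f \<longleftrightarrow> asymptotic_hom A (\<lambda>_. E) f"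

definition cp_discrete_asymptotic_hom ::
    "'a star_alg \<Rightarrow> 'b star_alg \<Rightarrow> (nat \<Rightarrow> 'a \<Rightarrow> 'b) \<Rightarrow> bool" where
  "cp_discrete_asymptotic_hom A E f \<longleftrightarrow>
     discrete_asymptotic_hom A E f \<and> (\<forall>k. cp_map A E (f k))"

section \<open>Matrix algebras\<close>

definition op_norm :: "complex mat \<Rightarrow> real" where
  "op_norm T = (SUP v\<in>{v \<in> carrier_vec (dim_col T). L2_set (\<lambda>i. cmod (v $ i)) {..<dim_vec v} \<le> 1}.
                  L2_set (\<lambda>i. cmod ((T *\<^sub>v v) $ i)) {..<dim_row T})"

definition ntr :: "complex mat \<Rightarrow> complex" where
  "ntr T = (\<Sum>i<dim_row T. T $$ (i, i)) / of_nat (dim_row T)"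

definition norm2 :: "complex mat \<Rightarrow> real" where
  "norm2 T = sqrt (Re (ntr (mat_adjoint T * T)))"

definition matrix_algebra :: "nat \<Rightarrow> complex mat star_alg" where
  "matrix_algebra n =
     \<lparr>carrier = carrier_mat n n,
      czero = 0\<^sub>m n n,
      cplus = (+),
      ctimes = (*),
      cscale = (\<lambda>c T. c \<cdot>\<^sub>m T),
      cstar = mat_adjoint,
      cnorm = op_norm\<rparr>"

definition MF_trace :: "'a star_alg \<Rightarrow> ('a \<Rightarrow> complex) \<Rightarrow> bool" where
  "MF_trace A \<tau> \<longleftrightarrow>
     is_trace A \<tau> \<and>
     (\<exists>(k :: nat \<Rightarrow> nat) \<phi>. (\<forall>n. 0 < k n) \<and>
        asymptotic_hom A (\<lambda>n. matrix_algebra (k n)) \<phi> \<and>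
        (\<forall>a\<in>carrier A. (\<lambda>n. cmod (\<tau> a - ntr (\<phi> n a))) \<longlonglongrightarrow> 0))"

definition quasidiagonal_trace :: "'a star_alg \<Rightarrow> ('a \<Rightarrow> complex) \<Rightarrow> bool" where
  "quasidiagonal_trace A \<tau> \<longleftrightarrow>
     is_trace A \<tau> \<and>
     (\<exists>(k :: nat \<Rightarrow> nat) \<phi>. (\<forall>n. 0 < k n) \<and>
        (\<forall>n. ccp_map A (matrix_algebra (k n)) (\<phi> n)) \<and>
        asymptotically_multiplicative A (\<lambda>n. matrix_algebra (k n)) \<phi> \<and>
        (\<forall>a\<in>carrier A. (\<lambda>n. cmod (\<tau> a - ntr (\<phi> n a))) \<longlonglongrightarrow> 0))"

section \<open>The product of matrix algebras and its tracial ultraproduct quotient\<close>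

definition nontrivial_ultrafilter :: "nat filter \<Rightarrow> bool" where
  "nontrivial_ultrafilter \<omega> \<longleftrightarrow>
     \<omega> \<noteq> bot \<and>
     (\<forall>P. eventually P \<omega> \<or> eventually (\<lambda>n. \<not> P n) \<omega>) \<and>
     (\<forall>n. \<omega> \<noteq> principal {n})"

definition prod_mat :: "(nat \<Rightarrow> nat) \<Rightarrow> (nat \<Rightarrow> complex mat) star_alg" where
  "prod_mat m =
     \<lparr>carrier = {T. (\<forall>n. T n \<in> carrier_mat (m n) (m n)) \<and> bdd_above (range (\<lambda>n. op_norm (T n)))},
      czero = (\<lambda>n. 0\<^sub>m (m n) (m n)),
      cplus = (\<lambda>S T n. S n + T n),
      ctimes = (\<lambda>S T n. S n * T n),
      cscale = (\<lambda>c T n. c \<cdot>\<^sub>m T n),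
      cstar = (\<lambda>T n. mat_adjoint (T n)),
      cnorm = (\<lambda>T. SUP n. op_norm (T n))\<rparr>"

definition tracial_ideal :: "(nat \<Rightarrow> nat) \<Rightarrow> nat filter \<Rightarrow> (nat \<Rightarrow> complex mat) set" where
  "tracial_ideal m \<omega> = {T \<in> carrier (prod_mat m). ((\<lambda>n. norm2 (T n)) \<longlongrightarrow> 0) \<omega>}"

definition ccoset :: "'a star_alg \<Rightarrow> 'a set \<Rightarrow> 'a \<Rightarrow> 'a set" where
  "ccoset E I x = (\<lambda>y. x \<boxplus>\<^bsub>E\<^esub> y) ` I"

text \<open>
  The operations are given by unions over all choices of representatives; as they respect
  cosets of the ideal \<open>I\<close>, each union is a single coset. The norm of a coset is the infimum
  of the norms of its elements, which is the quotient norm.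
\<close>

definition quotient_algebra :: "'a star_alg \<Rightarrow> 'a set \<Rightarrow> 'a set star_alg" where
  "quotient_algebra E I =
     \<lparr>carrier = ccoset E I ` carrier E,
      czero = ccoset E I (czero E),
      cplus = (\<lambda>X Y. \<Union>x\<in>X. \<Union>y\<in>Y. ccoset E I (x \<boxplus>\<^bsub>E\<^esub> y)),
      ctimes = (\<lambda>X Y. \<Union>x\<in>X. \<Union>y\<in>Y. ccoset E I (x \<boxdot>\<^bsub>E\<^esub> y)),
      cscale = (\<lambda>c X. \<Union>x\<in>X. ccoset E I (c \<triangleright>\<^bsub>E\<^esub> x)),
      cstar = (\<lambda>X. \<Union>x\<in>X. ccoset E I (cstar E x)),
      cnorm = (\<lambda>X. INF x\<in>X. cnorm E x)\<rparr>"

definition tracial_quotient :: "(nat \<Rightarrow> nat) \<Rightarrow> nat filter \<Rightarrow> (nat \<Rightarrow> complex mat) set star_alg" where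
  "tracial_quotient m \<omega> = quotient_algebra (prod_mat m) (tracial_ideal m \<omega>)"

definition quot_map ::
    "(nat \<Rightarrow> nat) \<Rightarrow> nat filter \<Rightarrow> (nat \<Rightarrow> complex mat) \<Rightarrow> (nat \<Rightarrow> complex mat) set" where
  "quot_map m \<omega> = ccoset (prod_mat m) (tracial_ideal m \<omega>)"

text \<open>
  The limit exists because \<open>ntr\<close> is bounded by the operator norm, and it does not depend on
  the representative because \<open>cmod (ntr T) \<le> norm2 T\<close>.
\<close>

definition quot_trace :: "nat filter \<Rightarrow> (nat \<Rightarrow> complex mat) set \<Rightarrow> complex" where
  "quot_trace \<omega> X = (THE c. \<forall>T\<in>X. ((\<lambda>n. ntr (T n)) \<longlongrightarrow> c) \<omega>)"

definition lifts_to ::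
    "'a star_alg \<Rightarrow> (nat \<Rightarrow> nat) \<Rightarrow> nat filter \<Rightarrow> ('a \<Rightarrow> (nat \<Rightarrow> complex mat) set) \<Rightarrow>
      (nat \<Rightarrow> 'a \<Rightarrow> nat \<Rightarrow> complex mat) \<Rightarrow> bool" where
  "lifts_to A m \<omega> f \<psi> \<longleftrightarrow> (\<forall>k. \<forall>a\<in>carrier A. quot_map m \<omega> (\<psi> k a) = f a)"

definition lifts_asymptotically_to ::
    "'a star_alg \<Rightarrow> (nat \<Rightarrow> nat) \<Rightarrow> nat filter \<Rightarrow> (nat \<Rightarrow> 'a \<Rightarrow> (nat \<Rightarrow> complex mat) set) \<Rightarrow>
      (nat \<Rightarrow> 'a \<Rightarrow> nat \<Rightarrow> complex mat) \<Rightarrow> bool" where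
  "lifts_asymptotically_to A m \<omega> f \<psi> \<longleftrightarrow>
     (\<forall>a\<in>carrier A.
        (\<lambda>k. cnorm (tracial_quotient m \<omega>)
               (cminus (tracial_quotient m \<omega>) (quot_map m \<omega> (\<psi> k a)) (f k a))) \<longlonglongrightarrow> 0)"

end

theory Submission
  imports Defs
begin

text \<open>
  Write \<open>\<Q>\<close> for the tracial quotient of the product of the algebras of matrices of size \<open>m n\<close>.

  From matrices to \<open>\<Q>\<close>. Approximating maps \<open>\<phi>\<^sub>n\<close> of an MF trace form a homomorphism into the product,
  up to sequences whose operator norms tend to \<open>0\<close>. As \<open>\<omega>\<close> is free and the 2-norm is dominated by
  the operator norm, such sequences vanish in \<open>\<Q>\<close>; so the class of \<open>(\<phi>\<^sub>n(a))\<close> defines a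
  \<open>*\<close>-homomorphism \<open>f\<close>, and \<open>\<tau>\<close> is the trace of \<open>\<Q>\<close> composed with \<open>f\<close>. Replacing the first \<open>k\<close>
  coordinates of \<open>(\<phi>\<^sub>n(a))\<close> by \<open>0\<close> does not change the class, and the defects of multiplicativity
  and linearity become uniformly small as \<open>k\<close> grows: these truncations are the lift
  (\<open>truncated_discrete_asymptotic_hom\<close>, \<open>truncation_lifts\<close>). A \<open>*\<close>-homomorphism into \<open>\<Q>\<close>, repeated
  constantly, is an asymptotic homomorphism.

  From \<open>\<Q>\<close> to matrices. If \<open>(\<psi>\<^sup>k)\<close> asymptotically lifts \<open>(f\<^sup>k)\<close>, then the defects of \<open>\<psi>\<^sup>k\<close> are small in all
  coordinates simultaneously, so for every choice of \<open>n\<^sub>k\<close> the coordinates \<open>\<psi>\<^sup>k(\<cdot>)\<close> at \<open>n\<^sub>k\<close> form an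
  asymptotic homomorphism into matrix algebras. Since traces converge along \<open>\<omega>\<close>, the index \<open>n\<^sub>k\<close>
  can be chosen to get the trace right on the first \<open>k\<close> members of a dense sequence
  (\<open>slice_traces\<close>). To pass from the dense sequence to all of \<open>A\<close> one needs that asymptotic
  homomorphisms into matrix algebras are asymptotically contractive (\<open>hom_contractive\<close>). This
  follows from an algebraic identity in \<open>A\<close>: if \<open>\<parallel>a\<parallel> < 1\<close>, then \<open>1 - a\<^sup>*a\<close> has a self-adjoint square
  root \<open>1 - s\<close>, where \<open>s\<close> lies in \<open>A\<close> and \<open>s + s = a\<^sup>*a + ss\<close> (\<open>quasi_square_root\<close>, a fixed point
  argument). An asymptotic homomorphism preserves this identity up to small errors, and among
  matrices it forces the image of \<open>a\<^sup>*a\<close> to be at most about \<open>1\<close>.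

  The quasidiagonal case needs two additions. First, the maps \<open>\<psi>\<^sup>k\<close> are completely positive but
  need not be contractive. They are replaced by \<open>a \<mapsto> \<psi>(e\<^sup>*ae)\<close>, suitably normalized: by 2-positivity
  this map has norm at most \<open>\<parallel>\<psi>(e\<^sup>*e)\<parallel>\<close> (\<open>cp_map_compression_bound\<close>). The element \<open>e = 1 - (1 - h)\<^sup>N\<close>,
  a polynomial without constant term in \<open>h = c\<Sum>y\<^sub>i\<^sup>*y\<^sub>i\<close>, has an image of norm at most about \<open>1\<close> that
  acts almost as a unit on the images of the \<open>y\<^sub>i\<close> (\<open>approximate_compression\<close>). The order
  estimates behind this choice concern the images, which are matrices, and do not diagonalize them.
  A diagonal sequence gives contractive completely positive maps asymptotic to \<open>\<psi>\<^sup>k\<close> on a dense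
  set, hence everywhere (\<open>ccp_approximation\<close>). Secondly, in the other direction the given maps
  \<open>\<phi>\<^sub>n\<close> must be shown to respect adjoints (\<open>ccp_map_star\<close>). For products this is 2-positivity. A
  self-adjoint \<open>a\<close> is, modulo products, \<open>1 / (\<i>Nt)\<close> times \<open>(1 + \<i>ta)\<^sup>N - 1\<close>; the latter is bounded
  when \<open>t = 1 / \<surd>N\<close>, so \<open>a\<close> is a limit of sums of products.
\<close>

section \<open>Arithmetic in C*-algebras\<close>

context cstar_algebra begin

lemmas closed = zero_closed plus_closed times_closed scale_closed star_closed

lemma minus_closed: "x \<in> carrier A \<Longrightarrow> y \<in> carrier A \<Longrightarrow> cminus A x y \<in> carrier A"
  by (simp add: cminus_def closed)

lemma plus_left_commute: "\<lbrakk>x \<in> carrier A; y \<in> carrier A; z \<in> carrier A\<rbrakk>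
      \<Longrightarrow> x \<boxplus> (y \<boxplus> z) = y \<boxplus> (x \<boxplus> z)"
  by (metis plus_assoc plus_commute)

lemma zero_plus: "x \<in> carrier A \<Longrightarrow> czero A \<boxplus> x = x"
  using plus_commute plus_zero zero_closed by simp

lemma minus_self: "x \<in> carrier A \<Longrightarrow> cminus A x x = czero A"
  by (simp add: cminus_def plus_inverse)

lemma plus_minus_cancel:
  assumes "x \<in> carrier A" "y \<in> carrier A" shows "cminus A x y \<boxplus> y = x"
proof -
  have "((-1) \<triangleright> y) \<boxplus> y = czero A"
    using assms by (metis plus_commute plus_inverse scale_closed)
  then show ?thesis
    using assms by (simp add: cminus_def plus_assoc closed plus_zero)
qed

lemma minus_plus_cancel:
  assumes "x \<in> carrier A" "y \<in> carrier A" shows "cminus A (x \<boxplus> y) y = x"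
  using assms by (simp add: cminus_def plus_assoc closed plus_zero plus_inverse)

lemma zero_scale: "x \<in> carrier A \<Longrightarrow> 0 \<triangleright> x = czero A"
  using plus_scale[of x 1 "-1"] plus_inverse[of x] by (simp add: scale_one)

lemma scale_zero: "c \<triangleright> czero A = czero A"
  using zero_scale[OF zero_closed] scale_scale[OF zero_closed, of c 0] by simp

lemma times_zero: "x \<in> carrier A \<Longrightarrow> x \<boxdot> czero A = czero A"
  by (metis scale_zero times_scale zero_closed zero_scale times_closed)

lemma zero_times: "x \<in> carrier A \<Longrightarrow> czero A \<boxdot> x = czero A"
  by (metis scale_zero scale_times zero_closed zero_scale times_closed)

lemma star_zero: "cstar A (czero A) = czero A"
  by (metis star_scale zero_closed zero_scale star_closed complex_cnj_zero)

lemma norm_zero: "cnorm A (czero A) = 0"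
  using norm_eq_zero zero_closed by simp

lemma eq_iff_minus: "\<lbrakk>x \<in> carrier A; y \<in> carrier A\<rbrakk> \<Longrightarrow> x = y \<longleftrightarrow> cnorm A (cminus A x y) = 0"
  using minus_closed[of x y] minus_self[of x] norm_eq_zero[of "cminus A x y"]
    plus_minus_cancel[of x y] zero_plus[of y] by auto

lemma minus_swap: "\<lbrakk>x \<in> carrier A; y \<in> carrier A\<rbrakk> \<Longrightarrow> cminus A y x = (-1) \<triangleright> cminus A x y"
  by (simp add: cminus_def scale_plus scale_closed scale_scale scale_one plus_commute)

lemma norm_minus_commute:
  "\<lbrakk>x \<in> carrier A; y \<in> carrier A\<rbrakk> \<Longrightarrow> cnorm A (cminus A x y) = cnorm A (cminus A y x)"
  by (simp add: minus_swap[of x y] norm_scale minus_closed)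

lemma minus_chain:
  assumes xyz: "x \<in> carrier A" "y \<in> carrier A" "z \<in> carrier A"
  shows "cminus A x z = cminus A x y \<boxplus> cminus A y z"
proof -
  have "cminus A x y \<boxplus> cminus A y z = (cminus A x y \<boxplus> y) \<boxplus> ((-1) \<triangleright> z)"
    using xyz by (simp add: plus_assoc closed minus_closed cminus_def)
  then show ?thesis
    using plus_minus_cancel xyz by (simp add: cminus_def)
qed

lemma norm_minus_triangle:
  "\<lbrakk>x \<in> carrier A; y \<in> carrier A; z \<in> carrier A\<rbrakk>
    \<Longrightarrow> cnorm A (cminus A x z) \<le> cnorm A (cminus A x y) + cnorm A (cminus A y z)"
  using minus_chain[of x y z] norm_triangle minus_closed by simp

lemma norm_minus_le:
  "\<lbrakk>x \<in> carrier A; y \<in> carrier A\<rbrakk> \<Longrightarrow> cnorm A (cminus A x y) \<le> cnorm A x + cnorm A y"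
  using norm_triangle[of x "(-1) \<triangleright> y"] norm_scale[of y "-1"] by (simp add: cminus_def closed)

lemma norm_star: assumes "x \<in> carrier A" shows "cnorm A (cstar A x) = cnorm A x"
proof -
  have le: "cnorm A y \<le> cnorm A (cstar A y)" if "y \<in> carrier A" for y
  proof (cases "cnorm A y = 0")
    case False
    then have pos: "cnorm A y > 0" using norm_nonneg[OF that] by simp
    have "cnorm A y * cnorm A y \<le> cnorm A (cstar A y) * cnorm A y"
      using cstar_identity[OF that] norm_times[of "cstar A y" y] that
      by (simp add: power2_eq_square closed)
    then show ?thesis using pos by simp
  qed (use that norm_nonneg closed in auto)
  show ?thesis using le[OF assms] le[of "cstar A x"] assms by (simp add: closed star_star)
qed

lemma star_minus:
  "\<lbrakk>x \<in> carrier A; y \<in> carrier A\<rbrakk> \<Longrightarrow> cstar A (cminus A x y) = cminus A (cstar A x) (cstar A y)"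
  by (simp add: cminus_def star_plus star_scale closed)

lemma squares_minus:
  assumes "s \<in> carrier A" "t \<in> carrier A"
  shows "cminus A (s \<boxdot> s) (t \<boxdot> t) = s \<boxdot> cminus A s t \<boxplus> cminus A s t \<boxdot> t"
proof -
  have "s \<boxdot> cminus A s t \<boxplus> cminus A s t \<boxdot> t =
     s \<boxdot> s \<boxplus> ((-1) \<triangleright> (s \<boxdot> t) \<boxplus> (s \<boxdot> t) \<boxplus> (-1) \<triangleright> (t \<boxdot> t))"
    using assms by (simp add: cminus_def times_plus plus_times scale_times times_scale plus_assoc closed)
  moreover have "(-1) \<triangleright> (s \<boxdot> t) \<boxplus> (s \<boxdot> t) = czero A"
    using assms plus_commute plus_inverse closed by metis
  ultimately show ?thesis using assms by (simp add: cminus_def zero_plus closed)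
qed

lemma norm_squares_minus:
  assumes "s \<in> carrier A" "t \<in> carrier A"
  shows "cnorm A (cminus A (s \<boxdot> s) (t \<boxdot> t)) \<le> (cnorm A s + cnorm A t) * cnorm A (cminus A s t)"
proof -
  have "cnorm A (cminus A (s \<boxdot> s) (t \<boxdot> t))
    \<le> cnorm A (s \<boxdot> cminus A s t) + cnorm A (cminus A s t \<boxdot> t)"
    using assms by (simp add: squares_minus norm_triangle minus_closed closed)
  also have "\<dots> \<le> cnorm A s * cnorm A (cminus A s t) + cnorm A (cminus A s t) * cnorm A t"
    using assms by (intro add_mono norm_times minus_closed)
  finally show ?thesis by (simp add: algebra_simps)
qed

text \<open>
  The element \<open>1 - s\<close> is a square root of \<open>1 - x\<close>; the unit is cancelled from the equation because
  \<open>A\<close> need not have one. The map \<open>s \<mapsto> (x + ss) / 2\<close> contracts a ball of radius less than \<open>1\<close>, and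
  completeness gives its fixed point. Self-adjointness passes from the iterates to the limit.
\<close>

theorem quasi_square_root:
  assumes x: "x \<in> carrier A" and sa: "cstar A x = x" and small: "cnorm A x < 1"
  obtains s where "s \<in> carrier A" "cstar A s = s" "s \<boxplus> s = x \<boxplus> s \<boxdot> s"
proof -
  \<comment> \<open>the fixed points of \<open>T\<close> are the solutions of \<open>s + s = x + ss\<close>\<close>
  define T where "T s = (1/2) \<triangleright> (x \<boxplus> s \<boxdot> s)" for s
  define S where "S n = (T ^^ n) (czero A)" for n
  \<comment> \<open>the smaller root of \<open>(\<parallel>x\<parallel> + r\<^sup>2) / 2 = r\<close>, so that \<open>T\<close> maps the ball of radius \<open>r\<close> to itself\<close>
  define r where "r = 1 - sqrt (1 - cnorm A x)"
  have r: "0 \<le> r" "r < 1" "(cnorm A x + r\<^sup>2) / 2 = r"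
    using small norm_nonneg[OF x] by (auto simp: r_def power2_diff)
  have S_Suc: "S (Suc n) = T (S n)" for n by (simp add: S_def)
  have T_closed: "T s \<in> carrier A" if "s \<in> carrier A" for s
    using that x by (simp add: T_def closed)
  have T_sa: "cstar A (T s) = T s" if "s \<in> carrier A" "cstar A s = s" for s
    using that x sa by (simp add: T_def star_scale star_plus star_times closed)
  have T_norm: "cnorm A (T s) \<le> r" if "s \<in> carrier A" "cnorm A s \<le> r" for s
  proof -
    have "cnorm A (x \<boxplus> s \<boxdot> s) \<le> cnorm A x + cnorm A s * cnorm A s"
      by (meson add_left_mono norm_times norm_triangle order_trans that(1) times_closed x)
    also have "\<dots> \<le> cnorm A x + r * r"
      using that norm_nonneg[OF that(1)] by (intro add_left_mono mult_mono) auto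
    finally show ?thesis
      using that x r(3) by (simp add: T_def norm_scale closed power2_eq_square)
  qed
  have T_contr: "cnorm A (cminus A (T s) (T t)) \<le> r * cnorm A (cminus A s t)"
    if s: "s \<in> carrier A" "cnorm A s \<le> r" and t: "t \<in> carrier A" "cnorm A t \<le> r" for s t
  proof -
    have "cminus A (T s) (T t) = (1/2) \<triangleright> cminus A (x \<boxplus> s \<boxdot> s) (x \<boxplus> t \<boxdot> t)"
      using s t x by (simp add: T_def cminus_def scale_plus scale_scale closed)
    also have "cminus A (x \<boxplus> s \<boxdot> s) (x \<boxplus> t \<boxdot> t)
        = cminus A x x \<boxplus> cminus A (s \<boxdot> s) (t \<boxdot> t)"
      using s t x by (simp add: cminus_def scale_plus plus_assoc plus_left_commute closed)
    also have "\<dots> = cminus A (s \<boxdot> s) (t \<boxdot> t)"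
      using s t x by (simp add: minus_self zero_plus minus_closed closed)
    finally have "cnorm A (cminus A (T s) (T t)) \<le> (1/2) * ((cnorm A s + cnorm A t) * cnorm A (cminus A s t))"
      using s t norm_squares_minus[of s t] by (simp add: norm_scale minus_closed closed)
    also have "\<dots> \<le> (1/2) * ((r + r) * cnorm A (cminus A s t))"
      using s t by (intro mult_left_mono mult_right_mono add_mono norm_nonneg minus_closed) auto
    finally show ?thesis by simp
  qed
  have S: "S n \<in> carrier A \<and> cnorm A (S n) \<le> r \<and> cstar A (S n) = S n" for n
    by (induction n)
      (auto simp: S_Suc T_closed T_norm T_sa, auto simp: S_def zero_closed norm_zero r star_zero)
  have step: "cnorm A (cminus A (S n) (S (Suc n))) \<le> r ^ n" for n
  proof (induction n)
    case 0
    have "cnorm A (cminus A (S 0) (S (Suc 0))) \<le> cnorm A (S 0) + cnorm A (S (Suc 0))"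
      using S by (intro norm_minus_le) auto
    then show ?case using S[of "Suc 0"] r by (simp add: S_def norm_zero)
  next
    case (Suc n)
    have "cnorm A (cminus A (S (Suc n)) (S (Suc (Suc n)))) \<le> r * cnorm A (cminus A (S n) (S (Suc n)))"
      using T_contr[of "S n" "S (Suc n)"] S[of n] S[of "Suc n"] by (simp add: S_Suc)
    also have "\<dots> \<le> r * r ^ n" using Suc r by (intro mult_left_mono)
    finally show ?case by simp
  qed
  have far: "cnorm A (cminus A (S n) (S (n + p))) * (1 - r) \<le> r ^ n * (1 - r ^ p)" for n p
  proof (induction p)
    case 0
    then show ?case using S by (simp add: minus_self norm_zero)
  next
    case (Suc p)
    have "cnorm A (cminus A (S n) (S (n + Suc p)))
       \<le> cnorm A (cminus A (S n) (S (n + p))) + cnorm A (cminus A (S (n + p)) (S (Suc (n + p))))"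
      using S norm_minus_triangle by simp
    then have "cnorm A (cminus A (S n) (S (n + Suc p))) * (1 - r)
       \<le> (cnorm A (cminus A (S n) (S (n + p))) + r ^ (n + p)) * (1 - r)"
      using step[of "n + p"] r by (intro mult_right_mono) auto
    also have "\<dots> \<le> r ^ n * (1 - r ^ p) + r ^ (n + p) * (1 - r)"
      using Suc by (simp add: algebra_simps)
    also have "\<dots> = r ^ n * (1 - r ^ Suc p)" by (simp add: algebra_simps power_add)
    finally show ?case .
  qed
  interpret M: Metric_space "carrier A" "cdist A" by (rule metric_space)
  have dist_le: "cdist A (S n) (S (n + p)) \<le> r ^ n / (1 - r)" for n p
  proof -
    have "r ^ n * (1 - r ^ p) \<le> r ^ n" using r by (simp add: mult_left_le)
    with far[of n p] have "cnorm A (cminus A (S n) (S (n + p))) * (1 - r) \<le> r ^ n" by linarith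
    then show ?thesis using r S by (simp add: cdist_def pos_le_divide_eq)
  qed
  have "(\<lambda>n. r ^ n / (1 - r)) \<longlonglongrightarrow> 0 / (1 - r)"
    using r by (intro tendsto_intros LIMSEQ_power_zero) auto
  then have tail: "\<exists>N. \<forall>n\<ge>N. r ^ n / (1 - r) < \<epsilon>" if "\<epsilon> > 0" for \<epsilon>
    using that order_tendstoD(2)[of _ 0 sequentially \<epsilon>] by (auto simp: eventually_sequentially)
  have "M.MCauchy S"
    unfolding M.MCauchy_def
  proof (intro conjI allI impI)
    show "range S \<subseteq> carrier A" using S by auto
    fix \<epsilon> :: real assume "\<epsilon> > 0"
    then obtain N where N: "\<And>n. n \<ge> N \<Longrightarrow> r ^ n / (1 - r) < \<epsilon>" using tail by blast
    show "\<exists>N. \<forall>n n'. N \<le> n \<longrightarrow> N \<le> n' \<longrightarrow> cdist A (S n) (S n') < \<epsilon>"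
    proof (intro exI[of _ N] allI impI)
      fix n n' assume nn: "N \<le> n" "N \<le> n'"
      show "cdist A (S n) (S n') < \<epsilon>"
      proof (cases "n \<le> n'")
        case True then show ?thesis
          using dist_le[of n "n' - n"] N[OF nn(1)] by simp
      next
        case False then show ?thesis
          using dist_le[of n' "n - n'"] N[OF nn(2)] M.commute[of "S n" "S n'"] by simp
      qed
    qed
  qed
  then obtain l where l: "limitin M.mtopology S l sequentially"
    using complete M.mcomplete_def by blast
  then have lA: "l \<in> carrier A" using M.limitin_mspace by blast
  from l have lim: "(\<lambda>n. cdist A (S n) l) \<longlonglongrightarrow> 0"
    using M.limitin_metric_dist_null by blast
  then have lim: "(\<lambda>n. cnorm A (cminus A (S n) l)) \<longlonglongrightarrow> 0"
    using S lA by (simp add: cdist_def)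
  have l_norm: "cnorm A l \<le> r"
  proof (rule LIMSEQ_le_const)
    show "(\<lambda>n. r + cnorm A (cminus A (S n) l)) \<longlonglongrightarrow> r" using lim tendsto_add[OF tendsto_const lim, of r] by simp
    show "\<exists>N. \<forall>n\<ge>N. cnorm A l \<le> r + cnorm A (cminus A (S n) l)"
    proof (intro exI allI impI)
      fix n
      have "cnorm A l = cnorm A (cminus A l (S n) \<boxplus> S n)"
        using lA S plus_minus_cancel by simp
      also have "\<dots> \<le> cnorm A (cminus A l (S n)) + cnorm A (S n)"
        using lA S by (intro norm_triangle minus_closed) auto
      finally show "cnorm A l \<le> r + cnorm A (cminus A (S n) l)"
        using S[of n] norm_minus_commute[of l "S n"] lA by simp
    qed
  qed
  have star_l: "cstar A l = l"
  proof -
    have "cnorm A (cminus A (cstar A l) l) \<le> 2 * cnorm A (cminus A (S n) l)" for n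
    proof -
      have "cnorm A (cminus A (cstar A l) (S n)) = cnorm A (cminus A (S n) l)"
        using S lA norm_star[of "cminus A l (S n)"]
        by (metis minus_closed norm_minus_commute star_minus)
      then show ?thesis
        using norm_minus_triangle[of "cstar A l" "S n" l] S lA by (simp add: closed)
    qed
    then have "cnorm A (cminus A (cstar A l) l) \<le> 2 * 0"
      by (intro LIMSEQ_le_const[OF tendsto_mult_left[OF lim, of 2]]) auto
    then show ?thesis
      using eq_iff_minus[of "cstar A l" l] lA norm_nonneg[OF minus_closed, of "cstar A l" l]
      by (simp add: closed)
  qed
  have "T l = l"
  proof -
    have "cnorm A (cminus A (T l) l) \<le> r * cnorm A (cminus A (S n) l) + cnorm A (cminus A (S (Suc n)) l)" for n
      using norm_minus_triangle[of "T l" "S (Suc n)" l] T_contr[of l "S n"] S lA l_norm T_closed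
        norm_minus_commute[of l "S n"] by (simp add: S_Suc)
    moreover have "(\<lambda>n. r * cnorm A (cminus A (S n) l) + cnorm A (cminus A (S (Suc n)) l)) \<longlonglongrightarrow> r * 0 + 0"
      by (intro tendsto_intros lim LIMSEQ_Suc)
    ultimately have "cnorm A (cminus A (T l) l) \<le> r * 0 + 0"
      by (intro LIMSEQ_le_const[where X = "\<lambda>n. r * cnorm A (cminus A (S n) l) + cnorm A (cminus A (S (Suc n)) l)"]) auto
    then show ?thesis
      using eq_iff_minus[of "T l" l] lA norm_nonneg[OF minus_closed, of "T l" l] T_closed
      by simp
  qed
  then have "l \<boxplus> l = T l \<boxplus> T l" by simp
  also have "\<dots> = (1/2 + 1/2) \<triangleright> (x \<boxplus> l \<boxdot> l)"
    unfolding T_def using lA x by (subst plus_scale) (auto simp: closed)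
  also have "\<dots> = x \<boxplus> l \<boxdot> l" using lA x by (simp add: scale_one closed)
  finally show thesis using that lA star_l by blast
qed

end

section \<open>Vectors\<close>

text \<open>
  Below, \<open>$\<close> selects the entries of vectors whose dimension is not part of their type.
\<close>

unbundle no vec_syntax

definition vnorm :: "complex vec \<Rightarrow> real" where
  "vnorm v = L2_set (\<lambda>i. cmod (v $ i)) {..<dim_vec v}"

definition cinner :: "complex vec \<Rightarrow> complex vec \<Rightarrow> complex" where
  "cinner v w = (\<Sum>i<dim_vec v. v $ i * cnj (w $ i))"

lemma vnorm_nonneg [simp]: "0 \<le> vnorm v"
  by (simp add: vnorm_def)

lemma vnorm_zero [simp]: "vnorm (0\<^sub>v n) = 0"
  by (simp add: vnorm_def L2_set_def)

lemma vnorm_eq_0: "v \<in> carrier_vec n \<Longrightarrow> vnorm v = 0 \<Longrightarrow> v = 0\<^sub>v n"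
  by (auto simp: vnorm_def L2_set_eq_0_iff intro!: eq_vecI)

lemma vnorm_add:
  assumes "v \<in> carrier_vec n" "w \<in> carrier_vec n" shows "vnorm (v + w) \<le> vnorm v + vnorm w"
proof -
  have "vnorm (v + w) = L2_set (\<lambda>i. cmod (v $ i + w $ i)) {..<n}"
    unfolding vnorm_def using assms by (intro L2_set_cong) auto
  also have "\<dots> \<le> L2_set (\<lambda>i. cmod (v $ i) + cmod (w $ i)) {..<n}"
    by (intro L2_set_mono norm_triangle_ineq) auto
  also have "\<dots> \<le> L2_set (\<lambda>i. cmod (v $ i)) {..<n} + L2_set (\<lambda>i. cmod (w $ i)) {..<n}"
    by (rule L2_set_triangle_ineq)
  finally show ?thesis using assms by (simp add: vnorm_def)
qed

lemma vnorm_smult: "vnorm (c \<cdot>\<^sub>v v) = cmod c * vnorm v"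
proof -
  have "vnorm (c \<cdot>\<^sub>v v) = L2_set (\<lambda>i. cmod c * cmod (v $ i)) {..<dim_vec v}"
    unfolding vnorm_def by (intro L2_set_cong) (auto simp: norm_mult)
  then show ?thesis by (simp add: vnorm_def L2_set_right_distrib)
qed

lemma cinner_Cauchy_Schwarz:
  assumes "v \<in> carrier_vec n" "w \<in> carrier_vec n" shows "cmod (cinner v w) \<le> vnorm v * vnorm w"
proof -
  have "cmod (cinner v w) \<le> (\<Sum>i<n. cmod (v $ i) * cmod (w $ i))"
    unfolding cinner_def using assms by (auto intro!: order_trans[OF norm_sum] simp: norm_mult)
  also have "\<dots> \<le> vnorm v * vnorm w"
    using L2_set_mult_ineq[of "\<lambda>i. cmod (v $ i)" "\<lambda>i. cmod (w $ i)" "{..<n}"] assms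
    by (simp add: vnorm_def)
  finally show ?thesis .
qed

lemma cinner_self: "cinner v v = complex_of_real ((vnorm v)\<^sup>2)"
  by (simp add: cinner_def vnorm_def L2_set_def sum_nonneg flip: complex_norm_square)

lemma Re_cinner_self: "Re (cinner v v) = (vnorm v)\<^sup>2"
  by (simp add: cinner_self)

lemma cinner_add_left:
  "\<lbrakk>u \<in> carrier_vec n; v \<in> carrier_vec n\<rbrakk> \<Longrightarrow> cinner (u + v) w = cinner u w + cinner v w"
  by (simp add: cinner_def sum.distrib algebra_simps)

lemma cinner_add_right:
  "\<lbrakk>u \<in> carrier_vec n; v \<in> carrier_vec n; w \<in> carrier_vec n\<rbrakk>
    \<Longrightarrow> cinner u (v + w) = cinner u v + cinner u w"
  by (simp add: cinner_def sum.distrib algebra_simps)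

lemma cinner_diff_left:
  "\<lbrakk>u \<in> carrier_vec n; v \<in> carrier_vec n\<rbrakk> \<Longrightarrow> cinner (u - v) w = cinner u w - cinner v w"
  by (simp add: cinner_def sum_subtractf algebra_simps)

lemma cinner_diff_right:
  "\<lbrakk>u \<in> carrier_vec n; v \<in> carrier_vec n; w \<in> carrier_vec n\<rbrakk>
    \<Longrightarrow> cinner u (v - w) = cinner u v - cinner u w"
  by (simp add: cinner_def sum_subtractf algebra_simps)

lemma cinner_smult_left: "cinner (c \<cdot>\<^sub>v v) w = c * cinner v w"
  by (simp add: cinner_def sum_distrib_left mult.assoc)

lemma cinner_smult_right:
  "\<lbrakk>v \<in> carrier_vec n; w \<in> carrier_vec n\<rbrakk> \<Longrightarrow> cinner v (c \<cdot>\<^sub>v w) = cnj c * cinner v w"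
  by (simp add: cinner_def sum_distrib_left algebra_simps)

lemma cinner_commute:
  "\<lbrakk>v \<in> carrier_vec n; w \<in> carrier_vec n\<rbrakk> \<Longrightarrow> cinner w v = cnj (cinner v w)"
  by (simp add: cinner_def mult.commute)

lemma vnorm_diff_sq:
  assumes "v \<in> carrier_vec n" "w \<in> carrier_vec n"
  shows "(vnorm (v - w))\<^sup>2 = (vnorm v)\<^sup>2 - 2 * Re (cinner v w) + (vnorm w)\<^sup>2"
  unfolding Re_cinner_self[symmetric]
  using assms arg_cong[OF cinner_commute[OF assms], of Re] by (simp add: cinner_diff_left cinner_diff_right)

lemma vnorm_add_sq:
  assumes "v \<in> carrier_vec n" "w \<in> carrier_vec n"
  shows "(vnorm (v + w))\<^sup>2 = (vnorm v)\<^sup>2 + 2 * Re (cinner v w) + (vnorm w)\<^sup>2"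
  unfolding Re_cinner_self[symmetric]
  using assms arg_cong[OF cinner_commute[OF assms], of Re] by (simp add: cinner_add_left cinner_add_right)

section \<open>Matrices and their adjoints\<close>

lemma adjoint_dim [simp]: "dim_row (mat_adjoint T) = dim_col T" "dim_col (mat_adjoint T) = dim_row T"
  by (simp_all add: mat_adjoint_def)

lemma adjoint_carrier [simp]: "T \<in> carrier_mat n m \<Longrightarrow> mat_adjoint T \<in> carrier_mat m n"
  by (intro carrier_matI) auto

lemma adjoint_index [simp]:
  "\<lbrakk>i < dim_col T; j < dim_row T\<rbrakk> \<Longrightarrow> mat_adjoint T $$ (i, j) = cnj (T $$ (j, i))"
  by (simp add: mat_adjoint_def mat_of_rows_def)

lemma adjoint_adjoint [simp]: "mat_adjoint (mat_adjoint T) = (T :: complex mat)"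
  by (intro eq_matI) auto

lemma adjoint_add:
  "\<lbrakk>S \<in> carrier_mat n m; T \<in> carrier_mat n m\<rbrakk>
    \<Longrightarrow> mat_adjoint (S + T) = mat_adjoint S + (mat_adjoint T :: complex mat)"
  by (intro eq_matI) auto

lemma adjoint_minus:
  "\<lbrakk>S \<in> carrier_mat n m; T \<in> carrier_mat n m\<rbrakk>
    \<Longrightarrow> mat_adjoint (S - T) = mat_adjoint S - (mat_adjoint T :: complex mat)"
  by (intro eq_matI) auto

lemma adjoint_smult: "mat_adjoint (c \<cdot>\<^sub>m T) = cnj c \<cdot>\<^sub>m mat_adjoint T"
  by (intro eq_matI) auto

lemma adjoint_zero [simp]: "mat_adjoint (0\<^sub>m n m) = (0\<^sub>m m n :: complex mat)"
  by (intro eq_matI) auto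

lemma adjoint_mult:
  "\<lbrakk>S \<in> carrier_mat n m; T \<in> carrier_mat m k\<rbrakk>
    \<Longrightarrow> mat_adjoint (S * T) = mat_adjoint T * (mat_adjoint S :: complex mat)"
  by (intro eq_matI) (auto simp: scalar_prod_def mult.commute intro!: sum.cong)

lemma cinner_adjoint:
  assumes T: "T \<in> carrier_mat n m" and v: "v \<in> carrier_vec m" and w: "w \<in> carrier_vec n"
  shows "cinner (T *\<^sub>v v) w = cinner v (mat_adjoint T *\<^sub>v w)"
proof -
  have "cinner (T *\<^sub>v v) w = (\<Sum>i<n. \<Sum>j<m. T $$ (i, j) * v $ j * cnj (w $ i))"
    using T v w by (simp add: cinner_def scalar_prod_def sum_distrib_right atLeast0LessThan)
  also have "\<dots> = (\<Sum>j<m. \<Sum>i<n. T $$ (i, j) * v $ j * cnj (w $ i))"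
    by (rule sum.swap)
  also have "\<dots> = cinner v (mat_adjoint T *\<^sub>v w)"
    using T v w by (simp add: cinner_def scalar_prod_def sum_distrib_left atLeast0LessThan algebra_simps)
  finally show ?thesis .
qed

lemma cinner_adjoint':
  assumes T: "T \<in> carrier_mat n m" and v: "v \<in> carrier_vec m" and w: "w \<in> carrier_vec n"
  shows "cinner (mat_adjoint T *\<^sub>v w) v = cinner w (T *\<^sub>v v)"
  using cinner_adjoint[of "mat_adjoint T" m n w v] assms by simp

lemma smult_mat_vec: "T \<in> carrier_mat n m \<Longrightarrow> v \<in> carrier_vec m \<Longrightarrow> (c \<cdot>\<^sub>m T) *\<^sub>v v = c \<cdot>\<^sub>v (T *\<^sub>v (v :: complex vec))"
  by (intro eq_vecI) auto

text \<open>
  The distributive laws are guarded by equations between dimensions, which the simplifier can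
  verify for compound matrices; a guard of the form \<open>T \<in> carrier_mat n m\<close> would leave it to guess
  \<open>n\<close> and \<open>m\<close>.
\<close>

lemma mat_vec_simps:
  fixes S T :: "complex mat" and v w :: "complex vec"
  shows "\<lbrakk>dim_row S = dim_row T; dim_col S = dim_col T; dim_vec v = dim_col T\<rbrakk>
      \<Longrightarrow> (S + T) *\<^sub>v v = S *\<^sub>v v + T *\<^sub>v v"
    and "\<lbrakk>dim_row S = dim_row T; dim_col S = dim_col T; dim_vec v = dim_col T\<rbrakk>
      \<Longrightarrow> (S - T) *\<^sub>v v = S *\<^sub>v v - T *\<^sub>v v"
    and "\<lbrakk>dim_col S = dim_row T; dim_vec v = dim_col T\<rbrakk> \<Longrightarrow> (S * T) *\<^sub>v v = S *\<^sub>v (T *\<^sub>v v)"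
    and "\<lbrakk>dim_vec v = dim_col T\<rbrakk> \<Longrightarrow> (c \<cdot>\<^sub>m T) *\<^sub>v v = c \<cdot>\<^sub>v (T *\<^sub>v v)"
    and "\<lbrakk>dim_vec v = dim_col T; dim_vec w = dim_col T\<rbrakk> \<Longrightarrow> T *\<^sub>v (v + w) = T *\<^sub>v v + T *\<^sub>v w"
    and "\<lbrakk>dim_vec v = dim_col T; dim_vec w = dim_col T\<rbrakk> \<Longrightarrow> T *\<^sub>v (v - w) = T *\<^sub>v v - T *\<^sub>v w"
    and "\<lbrakk>dim_vec v = dim_col T\<rbrakk> \<Longrightarrow> T *\<^sub>v (c \<cdot>\<^sub>v v) = c \<cdot>\<^sub>v (T *\<^sub>v v)"
  by (rule add_mult_distrib_mat_vec[of _ "dim_row T" "dim_col T"]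
      minus_mult_distrib_mat_vec[of _ "dim_row T" "dim_col T"]
      assoc_mult_mat_vec[of _ "dim_row S" "dim_row T" _ "dim_col T"]
      smult_mat_vec[of _ "dim_row T" "dim_col T"]
      mult_add_distrib_mat_vec[of _ "dim_row T" "dim_col T"]
      mult_minus_distrib_mat_vec[of _ "dim_row T" "dim_col T"]
      mult_mat_vec[of _ "dim_row T" "dim_col T"];
      auto intro!: carrier_matI carrier_vecI)+

lemma cinner_simps:
  shows "dim_vec u = dim_vec v \<Longrightarrow> cinner (u + v) w = cinner u w + cinner v w"
    and "dim_vec u = dim_vec v \<Longrightarrow> cinner (u - v) w = cinner u w - cinner v w"
    and "\<lbrakk>dim_vec v = dim_vec u; dim_vec w = dim_vec u\<rbrakk> \<Longrightarrow> cinner u (v + w) = cinner u v + cinner u w"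
    and "\<lbrakk>dim_vec v = dim_vec u; dim_vec w = dim_vec u\<rbrakk> \<Longrightarrow> cinner u (v - w) = cinner u v - cinner u w"
    and "cinner (c \<cdot>\<^sub>v v) w = c * cinner v w"
    and "dim_vec v = dim_vec w \<Longrightarrow> cinner v (c \<cdot>\<^sub>v w) = cnj c * cinner v w"
  by (rule cinner_add_left[of _ "dim_vec v"] cinner_diff_left[of _ "dim_vec v"]
      cinner_add_right[of _ "dim_vec u"] cinner_diff_right[of _ "dim_vec u"] cinner_smult_left
      cinner_smult_right[of _ "dim_vec w"]; auto intro!: carrier_vecI)+

lemma adjoint_simps:
  fixes S T :: "complex mat"
  shows "\<lbrakk>dim_row S = dim_row T; dim_col S = dim_col T\<rbrakk> \<Longrightarrow> mat_adjoint (S + T) = mat_adjoint S + mat_adjoint T"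
    and "\<lbrakk>dim_row S = dim_row T; dim_col S = dim_col T\<rbrakk> \<Longrightarrow> mat_adjoint (S - T) = mat_adjoint S - mat_adjoint T"
    and "dim_col S = dim_row T \<Longrightarrow> mat_adjoint (S * T) = mat_adjoint T * mat_adjoint S"
  by (rule adjoint_add[of _ "dim_row T" "dim_col T"] adjoint_minus[of _ "dim_row T" "dim_col T"]
      adjoint_mult[of _ "dim_row S" "dim_row T" _ "dim_col T"]; auto intro!: carrier_matI)+

declare minus_carrier_mat [simp] smult_carrier_mat [simp]

lemma mat_minus_eq: "\<lbrakk>S \<in> carrier_mat n n; T \<in> carrier_mat n n\<rbrakk> \<Longrightarrow> S + (-1) \<cdot>\<^sub>m T = S - (T :: complex mat)"
  by (intro eq_matI) auto

lemma mat_minus_chain: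
  "\<lbrakk>R \<in> carrier_mat n n; S \<in> carrier_mat n n; T \<in> carrier_mat n n\<rbrakk>
    \<Longrightarrow> R - T = (R - S) + (S - (T :: complex mat))"
  by (intro eq_matI) auto

lemma mat_minus_smult: "T \<in> carrier_mat n n \<Longrightarrow> T - c \<cdot>\<^sub>m T = (1 - c) \<cdot>\<^sub>m (T :: complex mat)"
  by (intro eq_matI) (auto simp: algebra_simps)

lemma mat_add_minus_add:
  "\<lbrakk>P \<in> carrier_mat n n; Q \<in> carrier_mat n n; R \<in> carrier_mat n n; S \<in> carrier_mat n n\<rbrakk>
    \<Longrightarrow> P + Q - (R + S) = (P - R) + (Q - (S :: complex mat))"
  by (intro eq_matI) auto

lemma mat_smult_smult: "c \<cdot>\<^sub>m (d \<cdot>\<^sub>m T) = (c * d) \<cdot>\<^sub>m (T :: complex mat)"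
  by (intro eq_matI) auto

lemma mat_smult_one: "1 \<cdot>\<^sub>m T = (T :: complex mat)"
  by (intro eq_matI) auto

section \<open>The operator norm\<close>

lemma op_norm_vnorm:
  "op_norm T = (SUP v\<in>{v \<in> carrier_vec (dim_col T). vnorm v \<le> 1}. vnorm (T *\<^sub>v v))"
  by (simp add: op_norm_def vnorm_def)

lemma vnorm_mult_bounded:
  assumes T: "T \<in> carrier_mat n m" and v: "v \<in> carrier_vec m"
  shows "vnorm (T *\<^sub>v v) \<le> (\<Sum>i<n. \<Sum>j<m. cmod (T $$ (i, j))) * vnorm v"
proof -
  have "vnorm (T *\<^sub>v v) \<le> (\<Sum>i<n. cmod ((T *\<^sub>v v) $ i))"
    unfolding vnorm_def using T by (intro order_trans[OF L2_set_le_sum]) auto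
  also have "\<dots> \<le> (\<Sum>i<n. \<Sum>j<m. cmod (T $$ (i, j)) * vnorm v)"
  proof (intro sum_mono)
    fix i assume i: "i \<in> {..<n}"
    have "cmod ((T *\<^sub>v v) $ i) = cmod (\<Sum>j<m. T $$ (i, j) * v $ j)"
      using T v i by (simp add: scalar_prod_def atLeast0LessThan)
    also have "\<dots> \<le> (\<Sum>j<m. cmod (T $$ (i, j)) * cmod (v $ j))"
      by (rule order_trans[OF norm_sum]) (simp add: norm_mult)
    also have "\<dots> \<le> (\<Sum>j<m. cmod (T $$ (i, j)) * vnorm v)"
      using v by (intro sum_mono mult_left_mono) (auto simp: vnorm_def intro!: member_le_L2_set)
    finally show "cmod ((T *\<^sub>v v) $ i) \<le> (\<Sum>j<m. cmod (T $$ (i, j)) * vnorm v)" .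
  qed
  finally show ?thesis by (simp add: sum_distrib_right)
qed

lemma vnorm_mult_le:
  assumes T: "T \<in> carrier_mat n m" and v: "v \<in> carrier_vec m"
  shows "vnorm (T *\<^sub>v v) \<le> op_norm T * vnorm v"
proof (cases "vnorm v = 0")
  case True
  then show ?thesis using vnorm_mult_bounded[OF T v] by simp
next
  case False
  then have pos: "vnorm v > 0" using vnorm_nonneg[of v] by linarith
  let ?c = "complex_of_real (1 / vnorm v)"
  let ?K = "\<Sum>i<n. \<Sum>j<m. cmod (T $$ (i, j))"
  have K: "0 \<le> ?K" by (intro sum_nonneg) auto
  have bdd: "bdd_above ((\<lambda>v. vnorm (T *\<^sub>v v)) ` {v \<in> carrier_vec (dim_col T). vnorm v \<le> 1})"
  proof (rule bdd_aboveI2)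
    fix v assume v': "v \<in> {v \<in> carrier_vec (dim_col T). vnorm v \<le> 1}"
    then have "vnorm (T *\<^sub>v v) \<le> ?K * vnorm v" using T by (intro vnorm_mult_bounded) auto
    also have "\<dots> \<le> ?K * 1" using v' K by (intro mult_left_mono) auto
    finally show "vnorm (T *\<^sub>v v) \<le> ?K" by simp
  qed
  have "vnorm (T *\<^sub>v (?c \<cdot>\<^sub>v v)) \<le> op_norm T"
    unfolding op_norm_vnorm by (rule cSUP_upper[OF _ bdd]) (use T v pos in \<open>auto simp: vnorm_smult norm_divide\<close>)
  also have "T *\<^sub>v (?c \<cdot>\<^sub>v v) = ?c \<cdot>\<^sub>v (T *\<^sub>v v)" using T v by (rule mult_mat_vec)
  finally show ?thesis using pos by (simp add: vnorm_smult field_simps del: of_real_divide)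
qed

lemma op_norm_leI:
  assumes T: "T \<in> carrier_mat n m" and c: "0 \<le> c"
    and le: "\<And>v. v \<in> carrier_vec m \<Longrightarrow> vnorm (T *\<^sub>v v) \<le> c * vnorm v"
  shows "op_norm T \<le> c"
  unfolding op_norm_vnorm
proof (rule cSUP_least)
  show "{v \<in> carrier_vec (dim_col T). vnorm v \<le> 1} \<noteq> {}"
    by (auto intro!: exI[of _ "0\<^sub>v (dim_col T)"])
  fix v assume v: "v \<in> {v \<in> carrier_vec (dim_col T). vnorm v \<le> 1}"
  then have "vnorm (T *\<^sub>v v) \<le> c * vnorm v" using le T by auto
  also have "\<dots> \<le> c * 1" using v c by (intro mult_left_mono) auto
  finally show "vnorm (T *\<^sub>v v) \<le> c" by simp
qed

lemma op_norm_nonneg [simp]: "0 \<le> op_norm T"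
proof (cases "dim_col T = 0")
  case True
  then have eq: "{v \<in> carrier_vec (dim_col T). vnorm v \<le> 1} = {0\<^sub>v 0 :: complex vec}"
    by (auto simp: vnorm_def L2_set_def)
  show ?thesis unfolding op_norm_vnorm eq by simp
next
  case False
  \<comment> \<open>a vector of norm \<open>1\<close>; it exists since there is at least one column\<close>
  let ?v = "unit_vec (dim_col T) 0 :: complex vec"
  have "vnorm ?v = 1"
  proof -
    have "(vnorm ?v)\<^sup>2 = (\<Sum>i<dim_col T. (cmod (if i = 0 then 1 else 0))\<^sup>2)"
      using False by (auto simp: vnorm_def L2_set_def sum_nonneg intro!: sum.cong)
    also have "\<dots> = (\<Sum>i<dim_col T. if i = 0 then 1 else 0)"
      by (intro sum.cong) auto
    also have "\<dots> = 1" using False by simp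
    finally show ?thesis using vnorm_nonneg[of ?v] by (simp add: power2_eq_1_iff)
  qed
  then show ?thesis
    using order_trans[OF vnorm_nonneg vnorm_mult_le[of T "dim_row T" "dim_col T" ?v]] by auto
qed

lemma op_norm_zero [simp]: "op_norm (0\<^sub>m n m) = 0"
proof (rule antisym)
  have "vnorm (0\<^sub>m n m *\<^sub>v v) \<le> 0 * vnorm v" if "v \<in> carrier_vec m" for v
    using vnorm_mult_bounded[of "0\<^sub>m n m" n m v] that by simp
  then show "op_norm (0\<^sub>m n m) \<le> 0" by (intro op_norm_leI[of _ n m]) auto
qed simp

lemma op_norm_add:
  assumes "S \<in> carrier_mat n m" "T \<in> carrier_mat n m"
  shows "op_norm (S + T) \<le> op_norm S + op_norm T"
proof (rule op_norm_leI[of _ n m])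
  fix v :: "complex vec" assume v: "v \<in> carrier_vec m"
  have "vnorm ((S + T) *\<^sub>v v) \<le> vnorm (S *\<^sub>v v) + vnorm (T *\<^sub>v v)"
    using assms v by (simp add: add_mult_distrib_mat_vec vnorm_add[of _ n])
  also have "\<dots> \<le> (op_norm S + op_norm T) * vnorm v"
    using vnorm_mult_le[OF assms(1) v] vnorm_mult_le[OF assms(2) v] by (simp add: algebra_simps)
  finally show "vnorm ((S + T) *\<^sub>v v) \<le> (op_norm S + op_norm T) * vnorm v" .
qed (use assms in auto)

lemma op_norm_smult_le:
  assumes "T \<in> carrier_mat n m" shows "op_norm (c \<cdot>\<^sub>m T) \<le> cmod c * op_norm T"
proof (rule op_norm_leI[of _ n m])
  fix v :: "complex vec" assume v: "v \<in> carrier_vec m"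
  show "vnorm ((c \<cdot>\<^sub>m T) *\<^sub>v v) \<le> cmod c * op_norm T * vnorm v"
    using vnorm_mult_le[OF assms v] assms v
    by (simp add: smult_mat_vec vnorm_smult mult.assoc mult_left_mono)
qed (use assms in auto)

lemma op_norm_smult:
  assumes T: "T \<in> carrier_mat n m" shows "op_norm (c \<cdot>\<^sub>m T) = cmod c * op_norm T"
proof (cases "c = 0")
  case True
  have "0 \<cdot>\<^sub>m T = 0\<^sub>m n m" using T by (intro eq_matI) auto
  then show ?thesis using True by simp
next
  case False
  have "inverse c \<cdot>\<^sub>m (c \<cdot>\<^sub>m T) = T" using T False by (intro eq_matI) auto
  then have "op_norm T \<le> cmod (inverse c) * op_norm (c \<cdot>\<^sub>m T)"
    using op_norm_smult_le[of "c \<cdot>\<^sub>m T" n m "inverse c"] T by simp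
  then have "cmod c * op_norm T \<le> op_norm (c \<cdot>\<^sub>m T)"
    using False by (simp only: norm_inverse) (simp add: field_simps)
  then show ?thesis using op_norm_smult_le[OF T, of c] by linarith
qed

lemma op_norm_minus:
  assumes "S \<in> carrier_mat n m" "T \<in> carrier_mat n m"
  shows "op_norm (S - T) \<le> op_norm S + op_norm T"
proof -
  have "S - T = S + (-1) \<cdot>\<^sub>m T" using assms by (intro eq_matI) auto
  then show ?thesis
    using op_norm_add[of S n m "(-1) \<cdot>\<^sub>m T"] op_norm_smult[OF assms(2), of "-1"] assms by simp
qed

lemma op_norm_mult:
  assumes "S \<in> carrier_mat n m" "T \<in> carrier_mat m k"
  shows "op_norm (S * T) \<le> op_norm S * op_norm T"
proof (rule op_norm_leI[of _ n k])
  fix v :: "complex vec" assume v: "v \<in> carrier_vec k"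
  have "vnorm (S * T *\<^sub>v v) = vnorm (S *\<^sub>v (T *\<^sub>v v))"
    using assms v by (simp add: assoc_mult_mat_vec)
  also have "\<dots> \<le> op_norm S * vnorm (T *\<^sub>v v)"
    using assms v by (intro vnorm_mult_le[of _ n m]) auto
  also have "\<dots> \<le> op_norm S * (op_norm T * vnorm v)"
    using assms v by (intro mult_left_mono vnorm_mult_le[of _ m k]) auto
  finally show "vnorm (S * T *\<^sub>v v) \<le> op_norm S * op_norm T * vnorm v" by (simp add: mult.assoc)
qed (use assms in auto)

text \<open>
  Testing the form on \<open>u = T v\<close> gives \<open>\<parallel>T v\<parallel>\<^sup>2 \<le> c \<parallel>v\<parallel> \<parallel>T v\<parallel>\<close>.
\<close>

lemma op_norm_form_leI:
  assumes T: "T \<in> carrier_mat n m" and c: "0 \<le> c"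
    and le: "\<And>v u. \<lbrakk>v \<in> carrier_vec m; u \<in> carrier_vec n\<rbrakk>
      \<Longrightarrow> cmod (cinner (T *\<^sub>v v) u) \<le> c * vnorm v * vnorm u"
  shows "op_norm T \<le> c"
proof (rule op_norm_leI[OF T c])
  fix v :: "complex vec" assume v: "v \<in> carrier_vec m"
  let ?w = "T *\<^sub>v v"
  have "vnorm ?w * vnorm ?w \<le> c * vnorm v * vnorm ?w"
    using le[of v ?w] v T by (simp add: cinner_self power2_eq_square norm_mult)
  then show "vnorm ?w \<le> c * vnorm v"
    using vnorm_nonneg[of ?w] c by (cases "vnorm ?w = 0") (auto simp: less_le)
qed

lemma op_norm_adjoint:
  assumes T: "T \<in> carrier_mat n m" shows "op_norm (mat_adjoint T) = op_norm T"
proof -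
  have le: "op_norm (mat_adjoint S) \<le> op_norm S" if S: "S \<in> carrier_mat n m" for S and n m
  proof (rule op_norm_form_leI)
    fix v u :: "complex vec" assume v: "v \<in> carrier_vec n" and u: "u \<in> carrier_vec m"
    have "cmod (cinner (mat_adjoint S *\<^sub>v v) u) = cmod (cinner v (S *\<^sub>v u))"
      using S v u by (simp add: cinner_adjoint')
    also have "\<dots> \<le> vnorm v * vnorm (S *\<^sub>v u)"
      using S v u by (intro cinner_Cauchy_Schwarz[of _ n]) auto
    also have "\<dots> \<le> vnorm v * (op_norm S * vnorm u)"
      using S u by (intro mult_left_mono vnorm_mult_le[of _ n m]) auto
    finally show "cmod (cinner (mat_adjoint S *\<^sub>v v) u) \<le> op_norm S * vnorm v * vnorm u"
      by (simp add: algebra_simps)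
  qed (use S in auto)
  show ?thesis using le[OF T] le[OF adjoint_carrier[OF T]] by simp
qed

lemma vnorm_adjoint_mult:
  assumes T: "T \<in> carrier_mat n m" and v: "v \<in> carrier_vec n"
  shows "vnorm (mat_adjoint T *\<^sub>v v) \<le> op_norm T * vnorm v"
  using vnorm_mult_le[of "mat_adjoint T" m n v] assms by (simp add: op_norm_adjoint)

lemma op_norm_minus_triangle:
  assumes "R \<in> carrier_mat n n" "S \<in> carrier_mat n n" "T \<in> carrier_mat n n"
  shows "op_norm (R - T) \<le> op_norm (R - S) + op_norm (S - T)"
  using op_norm_add[of "R - S" n n "S - T"] mat_minus_chain[OF assms] assms by simp

lemma op_norm_minus_commute:
  assumes "S \<in> carrier_mat n n" "T \<in> carrier_mat n n"
  shows "op_norm (S - T) = op_norm (T - S)"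
proof -
  have "S - T = (-1) \<cdot>\<^sub>m (T - S)" using assms by (intro eq_matI) auto
  then show ?thesis using op_norm_smult[of "T - S" n n "-1"] assms by simp
qed

lemma op_norm_le_add_minus:
  assumes "S \<in> carrier_mat n n" "T \<in> carrier_mat n n"
  shows "op_norm S \<le> op_norm T + op_norm (S - T)"
proof -
  have "S = T + (S - T)" using assms by (intro eq_matI) auto
  then show ?thesis using op_norm_add[of T n n "S - T"] assms by simp
qed

section \<open>The normalized trace and the 2-norm\<close>

lemma norm2_eq:
  assumes T: "T \<in> carrier_mat n n"
  shows "norm2 T = L2_set (\<lambda>(i, j). cmod (T $$ (i, j))) ({..<n} \<times> {..<n}) / sqrt (real n)"
proof -
  have "ntr (mat_adjoint T * T) = (\<Sum>j<n. \<Sum>i<n. cnj (T $$ (i, j)) * T $$ (i, j)) / of_nat n"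
    using T by (simp add: ntr_def scalar_prod_def atLeast0LessThan)
  also have "\<dots> = (\<Sum>j<n. \<Sum>i<n. complex_of_real ((cmod (T $$ (i, j)))\<^sup>2)) / of_nat n"
    by (simp only: complex_norm_square mult.commute)
  also have "\<dots> = (\<Sum>i<n. \<Sum>j<n. complex_of_real ((cmod (T $$ (i, j)))\<^sup>2)) / of_nat n"
    by (subst sum.swap) (rule refl)
  also have "\<dots> = complex_of_real ((\<Sum>i<n. \<Sum>j<n. (cmod (T $$ (i, j)))\<^sup>2) / real n)"
    by simp
  finally have "Re (ntr (mat_adjoint T * T)) = (\<Sum>i<n. \<Sum>j<n. (cmod (T $$ (i, j)))\<^sup>2) / real n"
    by (simp del: of_real_divide of_real_sum)
  then show ?thesis
    by (simp add: norm2_def L2_set_def sum.cartesian_product real_sqrt_divide case_prod_unfold)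
qed

text \<open>
  The triangle inequality, invariance under adjoints and the ideal property of the 2-norm are
  all read off from the Euclidean norm of the entries.
\<close>

lemma norm2_entries:
  assumes T: "T \<in> carrier_mat n n"
  shows "norm2 T = sqrt (\<Sum>i<n. \<Sum>j<n. (cmod (T $$ (i, j)))\<^sup>2) / sqrt (real n)"
  using T by (simp add: norm2_eq L2_set_def case_prod_unfold sum.cartesian_product)

lemma norm2_nonneg: "T \<in> carrier_mat n n \<Longrightarrow> 0 \<le> norm2 T"
  by (simp add: norm2_eq)

lemma norm2_zero: "norm2 (0\<^sub>m n n) = 0"
  proof -
  have "L2_set (\<lambda>(i, j). cmod (0\<^sub>m n n $$ (i, j))) ({..<n} \<times> {..<n}) = 0"
    by (intro L2_set_0') auto
  then show ?thesis by (simp add: norm2_eq[of _ n])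
qed

lemma norm2_add:
  assumes S: "S \<in> carrier_mat n n" and T: "T \<in> carrier_mat n n"
  shows "norm2 (S + T) \<le> norm2 S + norm2 T"
proof -
  let ?I = "{..<n} \<times> {..<n}"
  have "L2_set (\<lambda>(i, j). cmod ((S + T) $$ (i, j))) ?I
      \<le> L2_set (\<lambda>p. (case p of (i, j) \<Rightarrow> cmod (S $$ (i, j))) + (case p of (i, j) \<Rightarrow> cmod (T $$ (i, j)))) ?I"
    using S T by (intro L2_set_mono) (auto intro: norm_triangle_ineq)
  also have "\<dots> \<le> L2_set (\<lambda>(i, j). cmod (S $$ (i, j))) ?I + L2_set (\<lambda>(i, j). cmod (T $$ (i, j))) ?I"
    by (rule L2_set_triangle_ineq)
  finally show ?thesis
    using S T by (simp add: norm2_eq[of _ n] flip: add_divide_distrib)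
      (intro divide_right_mono, auto)
qed

lemma norm2_smult:
  assumes T: "T \<in> carrier_mat n n" shows "norm2 (c \<cdot>\<^sub>m T) = cmod c * norm2 T"
proof -
  have "L2_set (\<lambda>(i, j). cmod ((c \<cdot>\<^sub>m T) $$ (i, j))) ({..<n} \<times> {..<n})
     = L2_set (\<lambda>p. cmod c * (case p of (i, j) \<Rightarrow> cmod (T $$ (i, j)))) ({..<n} \<times> {..<n})"
    using T by (intro L2_set_cong) (auto simp: norm_mult)
  then show ?thesis using T by (simp add: norm2_eq[of _ n] L2_set_right_distrib)
qed

lemma norm2_adjoint:
  assumes T: "T \<in> carrier_mat n n" shows "norm2 (mat_adjoint T) = norm2 T"
proof -
  have "(\<Sum>i<n. \<Sum>j<n. (cmod (mat_adjoint T $$ (i, j)))\<^sup>2) = (\<Sum>i<n. \<Sum>j<n. (cmod (T $$ (j, i)))\<^sup>2)"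
    using T by (intro sum.cong) auto
  also have "\<dots> = (\<Sum>i<n. \<Sum>j<n. (cmod (T $$ (i, j)))\<^sup>2)"
    by (rule sum.swap)
  finally show ?thesis
    using T by (simp add: norm2_entries[of _ n] del: adjoint_index)
qed

lemma norm2_sq_columns:
  assumes T: "T \<in> carrier_mat n n"
  shows "norm2 T = sqrt (\<Sum>j<n. (vnorm (col T j))\<^sup>2) / sqrt (real n)"
proof -
  have "(\<Sum>i<n. \<Sum>j<n. (cmod (T $$ (i, j)))\<^sup>2) = (\<Sum>j<n. \<Sum>i<n. (cmod (T $$ (i, j)))\<^sup>2)"
    by (rule sum.swap)
  also have "\<dots> = (\<Sum>j<n. (vnorm (col T j))\<^sup>2)"
    using T by (intro sum.cong) (auto simp: vnorm_def L2_set_def sum_nonneg)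
  finally show ?thesis
    using T by (simp add: norm2_eq[of _ n] L2_set_def case_prod_unfold sum.cartesian_product)
qed

text \<open>
  Left multiplication acts on each column separately, and the squared 2-norm is the average of
  the squared norms of the columns.
\<close>

lemma norm2_mult_left:
  assumes S: "S \<in> carrier_mat n n" and T: "T \<in> carrier_mat n n"
  shows "norm2 (S * T) \<le> op_norm S * norm2 T"
proof -
  have "(\<Sum>j<n. (vnorm (col (S * T) j))\<^sup>2) \<le> (\<Sum>j<n. (op_norm S * vnorm (col T j))\<^sup>2)"
  proof (intro sum_mono power_mono)
    fix j assume "j \<in> {..<n}"
    then have "col (S * T) j = S *\<^sub>v col T j" using S T by auto
    then show "vnorm (col (S * T) j) \<le> op_norm S * vnorm (col T j)"
      using vnorm_mult_le[OF S, of "col T j"] T by auto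
  qed simp
  also have "\<dots> = (op_norm S)\<^sup>2 * (\<Sum>j<n. (vnorm (col T j))\<^sup>2)"
    by (simp add: power_mult_distrib sum_distrib_left)
  finally have "sqrt (\<Sum>j<n. (vnorm (col (S * T) j))\<^sup>2) \<le> op_norm S * sqrt (\<Sum>j<n. (vnorm (col T j))\<^sup>2)"
    by (metis real_sqrt_le_mono real_sqrt_mult real_sqrt_abs op_norm_nonneg abs_of_nonneg)
  then show ?thesis
    using S T by (simp add: norm2_sq_columns[of _ n] divide_right_mono)
qed

lemma norm2_mult_right:
  assumes S: "S \<in> carrier_mat n n" and T: "T \<in> carrier_mat n n"
  shows "norm2 (S * T) \<le> norm2 S * op_norm T"
  using norm2_mult_left[of "mat_adjoint T" n "mat_adjoint S"] S T norm2_adjoint[of "S * T" n]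
  by (simp add: adjoint_mult op_norm_adjoint norm2_adjoint mult.commute)

lemma norm2_le_op_norm:
  assumes T: "T \<in> carrier_mat n n" shows "norm2 T \<le> op_norm T"
proof -
  have "(\<Sum>i<n. \<Sum>j<n. (cmod (1\<^sub>m n $$ (i, j)))\<^sup>2) = (\<Sum>i<n. \<Sum>j<n. if i = j then 1 else 0)"
    by (intro sum.cong) auto
  then have "norm2 (1\<^sub>m n) \<le> 1" by (simp add: norm2_entries[of _ n] del: index_one_mat)
  then have "op_norm T * norm2 (1\<^sub>m n) \<le> op_norm T * 1" by (intro mult_left_mono) auto
  then show ?thesis using norm2_mult_left[OF T, of "1\<^sub>m n"] T by simp
qed

lemma ntr_le_norm2:
  assumes T: "T \<in> carrier_mat n n" shows "cmod (ntr T) \<le> norm2 T"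
proof -
  let ?d = "\<lambda>i. cmod (T $$ (i, i))"
  have "cmod (ntr T) = cmod (\<Sum>i<n. T $$ (i, i)) / n"
    using T by (simp add: ntr_def norm_divide)
  also have "\<dots> \<le> (\<Sum>i<n. ?d i * 1) / n"
    by (intro divide_right_mono) (auto intro: norm_sum)
  also have "\<dots> \<le> (L2_set ?d {..<n} * L2_set (\<lambda>_. 1) {..<n}) / n"
    using L2_set_mult_ineq[of ?d "\<lambda>_. 1" "{..<n}"] by (intro divide_right_mono) auto
  also have "\<dots> = L2_set ?d {..<n} / sqrt n"
    by (cases "n = 0") (auto simp: L2_set_constant field_simps real_sqrt_divide)
  also have "L2_set ?d {..<n} \<le> L2_set (\<lambda>(i, j). cmod (T $$ (i, j))) ({..<n} \<times> {..<n})"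
  proof -
    have "(\<Sum>i<n. (?d i)\<^sup>2) \<le> (\<Sum>i<n. \<Sum>j<n. (cmod (T $$ (i, j)))\<^sup>2)"
      by (intro sum_mono) (auto intro: member_le_sum)
    then show ?thesis by (simp add: L2_set_def sum.cartesian_product case_prod_unfold)
  qed
  finally show ?thesis using T by (simp add: norm2_eq[of _ n] divide_right_mono)
qed

lemma ntr_minus:
  "\<lbrakk>S \<in> carrier_mat n n; T \<in> carrier_mat n n\<rbrakk> \<Longrightarrow> ntr (S - T) = ntr S - ntr T"
  by (simp add: ntr_def sum_subtractf diff_divide_distrib)

lemma ntr_le_op_norm: "T \<in> carrier_mat n n \<Longrightarrow> cmod (ntr T) \<le> op_norm T"
  using ntr_le_norm2 norm2_le_op_norm by (meson order_trans)

section \<open>Bounded sequences of matrices\<close>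

lemma matrix_algebra_simps [simp]:
  "carrier (matrix_algebra n) = carrier_mat n n"
  "czero (matrix_algebra n) = 0\<^sub>m n n"
  "S \<boxplus>\<^bsub>matrix_algebra n\<^esub> T = S + T"
  "S \<boxdot>\<^bsub>matrix_algebra n\<^esub> T = S * T"
  "c \<triangleright>\<^bsub>matrix_algebra n\<^esub> T = c \<cdot>\<^sub>m T"
  "cstar (matrix_algebra n) T = mat_adjoint T"
  "cnorm (matrix_algebra n) = op_norm"
  by (simp_all add: matrix_algebra_def)

lemma prod_mat_simps [simp]:
  "czero (prod_mat m) = (\<lambda>n. 0\<^sub>m (m n) (m n))"
  "X \<boxplus>\<^bsub>prod_mat m\<^esub> Y = (\<lambda>n. X n + Y n)"
  "X \<boxdot>\<^bsub>prod_mat m\<^esub> Y = (\<lambda>n. X n * Y n)"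
  "c \<triangleright>\<^bsub>prod_mat m\<^esub> X = (\<lambda>n. c \<cdot>\<^sub>m X n)"
  "cstar (prod_mat m) X = (\<lambda>n. mat_adjoint (X n))"
  "cnorm (prod_mat m) X = (SUP n. op_norm (X n))"
  by (simp_all add: prod_mat_def)

lemma matrix_algebra_minus:
  "\<lbrakk>S \<in> carrier_mat n n; T \<in> carrier_mat n n\<rbrakk> \<Longrightarrow> cminus (matrix_algebra n) S T = S - T"
  by (simp add: cminus_def mat_minus_eq)

lemma prod_matI:
  assumes "\<And>n. X n \<in> carrier_mat (m n) (m n)" "\<And>n. op_norm (X n) \<le> C"
  shows "X \<in> carrier (prod_mat m)"
  using assms by (auto simp: prod_mat_def intro!: bdd_aboveI[of _ C])

lemma prod_mat_carrier: "X \<in> carrier (prod_mat m) \<Longrightarrow> X n \<in> carrier_mat (m n) (m n)"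
  by (simp add: prod_mat_def)

lemma prod_mat_bounded:
  assumes "X \<in> carrier (prod_mat m)" obtains C where "0 \<le> C" "\<And>n. op_norm (X n) \<le> C"
proof -
  obtain C where "\<And>n. op_norm (X n) \<le> C" using assms by (auto simp: prod_mat_def bdd_above_def)
  moreover from this[of 0] have "0 \<le> C" using op_norm_nonneg order_trans by blast
  ultimately show thesis using that by blast
qed

lemma op_norm_le_prod_norm: "X \<in> carrier (prod_mat m) \<Longrightarrow> op_norm (X n) \<le> cnorm (prod_mat m) X"
  by (auto simp: prod_mat_def intro!: cSUP_upper)

lemma prod_mat_zero_closed: "(\<lambda>n. 0\<^sub>m (m n) (m n)) \<in> carrier (prod_mat m)"
  by (rule prod_matI[of _ _ 0]) auto

lemma prod_mat_plus_closed:
  assumes X: "X \<in> carrier (prod_mat m)" and Y: "Y \<in> carrier (prod_mat m)"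
  shows "(\<lambda>n. X n + Y n) \<in> carrier (prod_mat m)"
proof -
  obtain C D where "\<And>n. op_norm (X n) \<le> C" "\<And>n. op_norm (Y n) \<le> D"
    using X Y by (meson prod_mat_bounded)
  then show ?thesis using X Y
    by (intro prod_matI[of _ _ "C + D"])
      (auto intro: order_trans[OF op_norm_add] add_mono prod_mat_carrier add_carrier_mat)
qed

lemma prod_mat_minus_closed:
  assumes X: "X \<in> carrier (prod_mat m)" and Y: "Y \<in> carrier (prod_mat m)"
  shows "(\<lambda>n. X n - Y n) \<in> carrier (prod_mat m)"
proof -
  obtain C D where "\<And>n. op_norm (X n) \<le> C" "\<And>n. op_norm (Y n) \<le> D"
    using X Y by (meson prod_mat_bounded)
  then show ?thesis using X Y
    by (intro prod_matI[of _ _ "C + D"])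
      (auto intro: order_trans[OF op_norm_minus] add_mono prod_mat_carrier minus_carrier_mat)
qed

lemma prod_mat_times_closed:
  assumes X: "X \<in> carrier (prod_mat m)" and Y: "Y \<in> carrier (prod_mat m)"
  shows "(\<lambda>n. X n * Y n) \<in> carrier (prod_mat m)"
proof -
  obtain C D where "0 \<le> C" "\<And>n. op_norm (X n) \<le> C" "\<And>n. op_norm (Y n) \<le> D"
    using X Y by (meson prod_mat_bounded)
  then show ?thesis using X Y
    by (intro prod_matI[of _ _ "C * D"])
      (auto intro!: order_trans[OF op_norm_mult[OF prod_mat_carrier prod_mat_carrier]] mult_mono
        intro: prod_mat_carrier mult_carrier_mat)
qed

lemma prod_mat_scale_closed:
  assumes X: "X \<in> carrier (prod_mat m)" shows "(\<lambda>n. c \<cdot>\<^sub>m X n) \<in> carrier (prod_mat m)"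
proof -
  obtain C where "\<And>n. op_norm (X n) \<le> C" using X by (meson prod_mat_bounded)
  then show ?thesis using X
    by (intro prod_matI[of _ _ "cmod c * C"])
      (auto simp: op_norm_smult[OF prod_mat_carrier] intro: mult_left_mono prod_mat_carrier
        smult_carrier_mat)
qed

lemma prod_mat_star_closed:
  assumes X: "X \<in> carrier (prod_mat m)" shows "(\<lambda>n. mat_adjoint (X n)) \<in> carrier (prod_mat m)"
proof -
  obtain C where "\<And>n. op_norm (X n) \<le> C" using X by (meson prod_mat_bounded)
  then show ?thesis using X
    by (intro prod_matI[of _ _ C])
      (auto simp: op_norm_adjoint[OF prod_mat_carrier] intro: prod_mat_carrier adjoint_carrier)
qed

lemmas prod_mat_closed = prod_mat_zero_closed prod_mat_plus_closed prod_mat_minus_closed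
  prod_mat_times_closed prod_mat_scale_closed prod_mat_star_closed

lemma prod_mat_minus:
  "\<lbrakk>X \<in> carrier (prod_mat m); Y \<in> carrier (prod_mat m)\<rbrakk> \<Longrightarrow> cminus (prod_mat m) X Y = (\<lambda>n. X n - Y n)"
  by (simp add: cminus_def mat_minus_eq[OF prod_mat_carrier prod_mat_carrier])

text \<open>
  Equality in the quotient of the product by the sequences that tend to \<open>0\<close> in operator norm.
  Asymptotic homomorphisms become homomorphisms for this relation, which replaces estimates by
  equational reasoning.
\<close>

definition norm_asymp :: "(nat \<Rightarrow> nat) \<Rightarrow> (nat \<Rightarrow> complex mat) \<Rightarrow> (nat \<Rightarrow> complex mat) \<Rightarrow> bool" where
  "norm_asymp m X Y \<longleftrightarrow> X \<in> carrier (prod_mat m) \<and> Y \<in> carrier (prod_mat m) \<and>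
     (\<lambda>k. op_norm (X k - Y k)) \<longlonglongrightarrow> 0"

lemma norm_asympD:
  assumes "norm_asymp m X Y"
  shows "X \<in> carrier (prod_mat m)" "Y \<in> carrier (prod_mat m)" "(\<lambda>k. op_norm (X k - Y k)) \<longlonglongrightarrow> 0"
  using assms by (auto simp: norm_asymp_def)

lemma norm_asympI:
  assumes "X \<in> carrier (prod_mat m)" "Y \<in> carrier (prod_mat m)"
    and "\<And>k. op_norm (X k - Y k) \<le> u k" "u \<longlonglongrightarrow> 0"
  shows "norm_asymp m X Y"
  using assms unfolding norm_asymp_def
  by (auto intro: tendsto_sandwich[OF _ _ tendsto_const assms(4)])

lemma norm_asymp_refl: "X \<in> carrier (prod_mat m) \<Longrightarrow> norm_asymp m X X"
  by (auto simp: norm_asymp_def minus_r_inv_mat[OF prod_mat_carrier])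

lemma norm_asymp_sym: "norm_asymp m X Y \<Longrightarrow> norm_asymp m Y X"
  using op_norm_minus_commute[OF prod_mat_carrier[of X m] prod_mat_carrier[of Y m]]
  by (auto simp: norm_asymp_def)

lemma norm_asymp_trans [trans]:
  assumes XY: "norm_asymp m X Y" and YZ: "norm_asymp m Y Z" shows "norm_asymp m X Z"
proof (rule norm_asympI)
  show "op_norm (X k - Z k) \<le> op_norm (X k - Y k) + op_norm (Y k - Z k)" for k
    using assms by (intro op_norm_minus_triangle) (auto dest: norm_asympD intro: prod_mat_carrier)
  show "(\<lambda>k. op_norm (X k - Y k) + op_norm (Y k - Z k)) \<longlonglongrightarrow> 0"
    using tendsto_add[OF norm_asympD(3)[OF XY] norm_asympD(3)[OF YZ]] by simp
qed (use assms in \<open>auto dest: norm_asympD\<close>)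

lemma norm_asymp_add:
  assumes X: "norm_asymp m X X'" and Y: "norm_asymp m Y Y'"
  shows "norm_asymp m (\<lambda>k. X k + Y k) (\<lambda>k. X' k + Y' k)"
proof (rule norm_asympI)
  note c = norm_asympD(1,2)[OF X] norm_asympD(1,2)[OF Y]
  show "op_norm (X k + Y k - (X' k + Y' k)) \<le> op_norm (X k - X' k) + op_norm (Y k - Y' k)" for k
  proof -
    have "X k + Y k - (X' k + Y' k) = (X k - X' k) + (Y k - Y' k)"
      using c[THEN prod_mat_carrier, of k] by (intro eq_matI) auto
    then show ?thesis
      using op_norm_add[of "X k - X' k" "m k" "m k" "Y k - Y' k"] c[THEN prod_mat_carrier, of k] by simp
  qed
  show "(\<lambda>k. op_norm (X k - X' k) + op_norm (Y k - Y' k)) \<longlonglongrightarrow> 0"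
    using tendsto_add[OF norm_asympD(3)[OF X] norm_asympD(3)[OF Y]] by simp
qed (use assms in \<open>auto dest: norm_asympD intro: prod_mat_closed\<close>)

lemma norm_asymp_minus:
  assumes X: "norm_asymp m X X'" and Y: "norm_asymp m Y Y'"
  shows "norm_asymp m (\<lambda>k. X k - Y k) (\<lambda>k. X' k - Y' k)"
proof (rule norm_asympI)
  note c = norm_asympD(1,2)[OF X] norm_asympD(1,2)[OF Y]
  show "op_norm (X k - Y k - (X' k - Y' k)) \<le> op_norm (X k - X' k) + op_norm (Y k - Y' k)" for k
  proof -
    have "X k - Y k - (X' k - Y' k) = (X k - X' k) - (Y k - Y' k)"
      using c[THEN prod_mat_carrier, of k] by (intro eq_matI) auto
    then show ?thesis
      using op_norm_minus[of "X k - X' k" "m k" "m k" "Y k - Y' k"] c[THEN prod_mat_carrier, of k] by simp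
  qed
  show "(\<lambda>k. op_norm (X k - X' k) + op_norm (Y k - Y' k)) \<longlonglongrightarrow> 0"
    using tendsto_add[OF norm_asympD(3)[OF X] norm_asympD(3)[OF Y]] by simp
qed (use assms in \<open>auto dest: norm_asympD intro: prod_mat_closed\<close>)

lemma norm_asymp_scale:
  assumes X: "norm_asymp m X X'"
  shows "norm_asymp m (\<lambda>k. c \<cdot>\<^sub>m X k) (\<lambda>k. c \<cdot>\<^sub>m X' k)"
proof (rule norm_asympI)
  note c = norm_asympD(1,2)[OF X]
  show "op_norm (c \<cdot>\<^sub>m X k - c \<cdot>\<^sub>m X' k) \<le> cmod c * op_norm (X k - X' k)" for k
  proof -
    have "c \<cdot>\<^sub>m X k - c \<cdot>\<^sub>m X' k = c \<cdot>\<^sub>m (X k - X' k)"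
      using c[THEN prod_mat_carrier, of k] by (intro eq_matI) (auto simp: algebra_simps)
    then show ?thesis
      using op_norm_smult[of "X k - X' k" "m k" "m k" c] c[THEN prod_mat_carrier, of k] by simp
  qed
  show "(\<lambda>k. cmod c * op_norm (X k - X' k)) \<longlonglongrightarrow> 0"
    using tendsto_mult_left[OF norm_asympD(3)[OF X], of "cmod c"] by simp
qed (use assms in \<open>auto dest: norm_asympD intro: prod_mat_closed\<close>)

lemma norm_asymp_star:
  assumes X: "norm_asymp m X X'"
  shows "norm_asymp m (\<lambda>k. mat_adjoint (X k)) (\<lambda>k. mat_adjoint (X' k))"
proof (rule norm_asympI)
  note c = norm_asympD(1,2)[OF X]
  show "op_norm (mat_adjoint (X k) - mat_adjoint (X' k)) \<le> op_norm (X k - X' k)" for k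
    using op_norm_adjoint[of "X k - X' k" "m k" "m k"] c[THEN prod_mat_carrier, of k]
    by (simp add: adjoint_minus)
  show "(\<lambda>k. op_norm (X k - X' k)) \<longlonglongrightarrow> 0" by (rule norm_asympD(3)[OF X])
qed (use assms in \<open>auto dest: norm_asympD intro: prod_mat_closed\<close>)

lemma norm_asymp_mult:
  assumes X: "norm_asymp m X X'" and Y: "norm_asymp m Y Y'"
  shows "norm_asymp m (\<lambda>k. X k * Y k) (\<lambda>k. X' k * Y' k)"
proof -
  note c = norm_asympD(1,2)[OF X] norm_asympD(1,2)[OF Y]
  obtain C where C: "\<And>k. op_norm (X k) \<le> C" using c by (meson prod_mat_bounded)
  obtain D where D: "\<And>k. op_norm (Y' k) \<le> D" using c by (meson prod_mat_bounded)
  show ?thesis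
  proof (rule norm_asympI)
    show "op_norm (X k * Y k - X' k * Y' k) \<le> C * op_norm (Y k - Y' k) + op_norm (X k - X' k) * D" for k
    proof -
      note ck = c[THEN prod_mat_carrier, of k]
      have "X k * Y k - X' k * Y' k = (X k * Y k - X k * Y' k) + (X k * Y' k - X' k * Y' k)"
        using ck by (intro mat_minus_chain[of _ "m k"]) auto
      also have "\<dots> = X k * (Y k - Y' k) + (X k - X' k) * Y' k"
        using ck by (simp add: mult_minus_distrib_mat[of _ "m k" "m k" _ "m k"] minus_mult_distrib_mat[of _ "m k" "m k" _ _ "m k"])
      also have "op_norm \<dots> \<le> op_norm (X k * (Y k - Y' k)) + op_norm ((X k - X' k) * Y' k)"
        using ck by (intro op_norm_add[of _ "m k" "m k"]) auto
      also have "\<dots> \<le> op_norm (X k) * op_norm (Y k - Y' k) + op_norm (X k - X' k) * op_norm (Y' k)"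
        using ck by (intro add_mono op_norm_mult[of _ "m k" "m k" _ "m k"]) auto
      also have "\<dots> \<le> C * op_norm (Y k - Y' k) + op_norm (X k - X' k) * D"
        by (intro add_mono mult_right_mono mult_left_mono C D) auto
      finally show ?thesis .
    qed
    have "(\<lambda>k. C * op_norm (Y k - Y' k) + op_norm (X k - X' k) * D) \<longlonglongrightarrow> C * 0 + 0 * D"
      by (intro tendsto_intros norm_asympD(3)[OF X] norm_asympD(3)[OF Y])
    then show "(\<lambda>k. C * op_norm (Y k - Y' k) + op_norm (X k - X' k) * D) \<longlonglongrightarrow> 0" by simp
  qed (use c in \<open>auto intro: prod_mat_closed\<close>)
qed

lemma norm_asymp_eventually_less:
  assumes XY: "norm_asymp m X Y" and "\<forall>\<^sub>F k in sequentially. op_norm (Y k) \<le> M" and "M < M'"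
  shows "\<forall>\<^sub>F k in sequentially. op_norm (X k) < M'"
proof -
  have "\<forall>\<^sub>F k in sequentially. op_norm (X k - Y k) < M' - M"
    using norm_asympD(3)[OF XY] assms(3) by (intro order_tendstoD(2)) auto
  then show ?thesis using assms(2)
  proof eventually_elim
    case (elim k)
    then show ?case
      using op_norm_le_add_minus[of "X k" "m k" "Y k"] norm_asympD(1,2)[OF XY, THEN prod_mat_carrier, of k]
      by simp
  qed
qed

text \<open>
  Every condition in the definition is a bound or a limit as the index tends to infinity.
\<close>

lemma asymptotic_hom_subseq:
  assumes f: "asymptotic_hom A E f" and \<kappa>: "filterlim \<kappa> sequentially sequentially"
  shows "asymptotic_hom A (\<lambda>j. E (\<kappa> j)) (\<lambda>j. f (\<kappa> j))"
proof -
  have sub: "(\<lambda>j. u (\<kappa> j)) \<longlonglongrightarrow> l" if "u \<longlonglongrightarrow> l" for u :: "nat \<Rightarrow> real" and l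
    using filterlim_compose[OF that \<kappa>] .
  show ?thesis
    unfolding asymptotic_hom_def asymptotically_multiplicative_def
  proof (intro conjI ballI allI)
    fix a assume a: "a \<in> carrier A"
    have "bdd_above (range (\<lambda>k. cnorm (E k) (f k a)))" using f a by (simp add: asymptotic_hom_def)
    then show "bdd_above (range (\<lambda>j. cnorm (E (\<kappa> j)) (f (\<kappa> j) a)))"
      by (rule bdd_above_mono) auto
  qed (use f in \<open>auto intro!: sub[of "\<lambda>k. cnorm (E k) (_ k)"] simp: asymptotic_hom_def asymptotically_multiplicative_def\<close>)
qed

lemma ntr_norm_asymp:
  assumes XY: "norm_asymp m X Y" and Y: "(\<lambda>k. ntr (Y k)) \<longlonglongrightarrow> t"
  shows "(\<lambda>k. ntr (X k)) \<longlonglongrightarrow> t"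
proof -
  have "cmod (ntr (X k) - ntr (Y k)) \<le> op_norm (X k - Y k)" for k
    using ntr_le_op_norm[of "X k - Y k" "m k"] norm_asympD(1,2)[OF XY, THEN prod_mat_carrier, of k]
    by (simp add: ntr_minus)
  then have "(\<lambda>k. ntr (X k) - ntr (Y k)) \<longlonglongrightarrow> 0"
    by (intro Lim_null_comparison[OF always_eventually norm_asympD(3)[OF XY]]) auto
  from tendsto_add[OF this Y] show ?thesis by simp
qed

text \<open>
  If \<open>T\<^sup>*T\<close> equals \<open>S + S\<^sup>* - S\<^sup>*S = 1 - (1 - S)\<^sup>*(1 - S)\<close> then it is at most \<open>1\<close>; the correction
  is the error in this equation.
\<close>

lemma op_norm_sq_le_quasi_root:
  assumes T: "T \<in> carrier_mat n n" and S: "S \<in> carrier_mat n n"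
  shows "(op_norm T)\<^sup>2 \<le> 1 + op_norm (mat_adjoint T * T - (S + mat_adjoint S - mat_adjoint S * S))"
proof -
  define R where "R = mat_adjoint T * T - (S + mat_adjoint S - mat_adjoint S * S)"
  have R: "R \<in> carrier_mat n n" using S T by (auto simp: R_def)
  have "op_norm T \<le> sqrt (1 + op_norm R)"
  proof (rule op_norm_leI[OF T])
    fix v :: "complex vec" assume v: "v \<in> carrier_vec n"
    have "mat_adjoint T * T = R + (S + mat_adjoint S - mat_adjoint S * S)"
      unfolding R_def using S T by (intro eq_matI) auto
    then have "mat_adjoint T *\<^sub>v (T *\<^sub>v v) = (R + (S + mat_adjoint S - mat_adjoint S * S)) *\<^sub>v v"
      using T v by (simp flip: assoc_mult_mat_vec[of _ n n _ n])
    also have "\<dots> = R *\<^sub>v v + (S *\<^sub>v v + mat_adjoint S *\<^sub>v v - mat_adjoint S *\<^sub>v (S *\<^sub>v v))"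
      using R S v by (simp add: mat_vec_simps)
    finally have "cinner (mat_adjoint T *\<^sub>v (T *\<^sub>v v)) v =
        cinner (R *\<^sub>v v) v + (cinner (S *\<^sub>v v) v + cinner (mat_adjoint S *\<^sub>v v) v
          - cinner (mat_adjoint S *\<^sub>v (S *\<^sub>v v)) v)"
      using R S v by (simp add: cinner_simps)
    then have "cinner (T *\<^sub>v v) (T *\<^sub>v v) =
        cinner (R *\<^sub>v v) v + (cinner (S *\<^sub>v v) v + cinner v (S *\<^sub>v v) - cinner (S *\<^sub>v v) (S *\<^sub>v v))"
      using S T v by (simp add: cinner_adjoint'[of _ n n])
    then have "(vnorm (T *\<^sub>v v))\<^sup>2 =
        Re (cinner (R *\<^sub>v v) v) + (2 * Re (cinner (S *\<^sub>v v) v) - (vnorm (S *\<^sub>v v))\<^sup>2)"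
      using cinner_commute[of "S *\<^sub>v v" n v] S v by (simp flip: Re_cinner_self)
    also have "2 * Re (cinner (S *\<^sub>v v) v) - (vnorm (S *\<^sub>v v))\<^sup>2 \<le> (vnorm v)\<^sup>2"
      using vnorm_diff_sq[of "S *\<^sub>v v" n v] S v zero_le_power2[of "vnorm (S *\<^sub>v v - v)"] by simp
    also have "Re (cinner (R *\<^sub>v v) v) \<le> op_norm R * vnorm v * vnorm v"
      using order_trans[OF complex_Re_le_cmod cinner_Cauchy_Schwarz[of "R *\<^sub>v v" n v]] R v
        mult_right_mono[OF vnorm_mult_le[OF R v], of "vnorm v"] by simp
    finally have "(vnorm (T *\<^sub>v v))\<^sup>2 \<le> (1 + op_norm R) * (vnorm v)\<^sup>2"
      by (simp add: algebra_simps power2_eq_square)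
    then have "sqrt ((vnorm (T *\<^sub>v v))\<^sup>2) \<le> sqrt ((1 + op_norm R) * (vnorm v)\<^sup>2)"
      by (rule real_sqrt_le_mono)
    then show "vnorm (T *\<^sub>v v) \<le> sqrt (1 + op_norm R) * vnorm v"
      by (simp add: real_sqrt_mult)
  qed simp
  then have "(op_norm T)\<^sup>2 \<le> (sqrt (1 + op_norm R))\<^sup>2" by (intro power_mono) auto
  then show ?thesis by (simp add: R_def)
qed

section \<open>Asymptotic contractivity\<close>

locale matrix_asymptotic_hom = cstar_algebra A for A :: "'a star_alg" (structure) +
  fixes m :: "nat \<Rightarrow> nat" and \<theta> :: "nat \<Rightarrow> 'a \<Rightarrow> complex mat"
  assumes asymptotic_hom: "asymptotic_hom A (\<lambda>k. matrix_algebra (m k)) \<theta>"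
begin

lemma hom_carrier_mat: "a \<in> carrier A \<Longrightarrow> \<theta> k a \<in> carrier_mat (m k) (m k)"
  using asymptotic_hom by (auto simp: asymptotic_hom_def Pi_iff)

lemma hom_closed: assumes "a \<in> carrier A" shows "(\<lambda>k. \<theta> k a) \<in> carrier (prod_mat m)"
  using asymptotic_hom assms hom_carrier_mat[OF assms] by (auto simp: asymptotic_hom_def prod_mat_def)

lemma hom_star:
  assumes "a \<in> carrier A" shows "norm_asymp m (\<lambda>k. \<theta> k (cstar A a)) (\<lambda>k. mat_adjoint (\<theta> k a))"
  using asymptotic_hom assms hom_closed[of a] hom_closed[of "cstar A a"]
  by (auto simp: asymptotic_hom_def norm_asymp_def prod_mat_closed closed matrix_algebra_minus hom_carrier_mat)

lemma hom_lin:
  assumes "a \<in> carrier A" "b \<in> carrier A"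
  shows "norm_asymp m (\<lambda>k. \<theta> k (c \<triangleright> a \<boxplus> d \<triangleright> b)) (\<lambda>k. c \<cdot>\<^sub>m \<theta> k a + d \<cdot>\<^sub>m \<theta> k b)"
  using asymptotic_hom assms hom_closed[of a] hom_closed[of b] hom_closed[of "c \<triangleright> a \<boxplus> d \<triangleright> b"]
  by (auto simp: asymptotic_hom_def norm_asymp_def prod_mat_closed closed matrix_algebra_minus hom_carrier_mat)

lemma hom_mult:
  assumes "a \<in> carrier A" "b \<in> carrier A"
  shows "norm_asymp m (\<lambda>k. \<theta> k (a \<boxdot> b)) (\<lambda>k. \<theta> k a * \<theta> k b)"
proof -
  have "cminus (matrix_algebra (m k)) (\<theta> k (a \<boxdot> b)) (\<theta> k a * \<theta> k b) = \<theta> k (a \<boxdot> b) - \<theta> k a * \<theta> k b" for k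
    using assms by (intro matrix_algebra_minus mult_carrier_mat[of _ _ "m k"] hom_carrier_mat closed)
  moreover have "(\<lambda>k. cnorm (matrix_algebra (m k)) (cminus (matrix_algebra (m k)) (\<theta> k (a \<boxdot> b))
      (\<theta> k a \<boxdot>\<^bsub>matrix_algebra (m k)\<^esub> \<theta> k b))) \<longlonglongrightarrow> 0"
    using asymptotic_hom assms
    unfolding asymptotic_hom_def asymptotically_multiplicative_def by blast
  ultimately have "(\<lambda>k. op_norm (\<theta> k (a \<boxdot> b) - \<theta> k a * \<theta> k b)) \<longlonglongrightarrow> 0"
    by simp
  then show ?thesis
    unfolding norm_asymp_def using assms by (intro conjI hom_closed prod_mat_times_closed closed)
qed

lemma hom_add:
  assumes "a \<in> carrier A" "b \<in> carrier A"
  shows "norm_asymp m (\<lambda>k. \<theta> k (a \<boxplus> b)) (\<lambda>k. \<theta> k a + \<theta> k b)"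
proof -
  have one: "1 \<cdot>\<^sub>m S = S" for S :: "complex mat" by (intro eq_matI) auto
  show ?thesis using hom_lin[OF assms, of 1 1] assms by (simp add: scale_one one)
qed

lemma hom_minus:
  assumes "a \<in> carrier A" "b \<in> carrier A"
  shows "norm_asymp m (\<lambda>k. \<theta> k (cminus A a b)) (\<lambda>k. \<theta> k a - \<theta> k b)"
proof -
  have one: "1 \<cdot>\<^sub>m S = S" for S :: "complex mat" by (intro eq_matI) auto
  have "\<theta> k a + - 1 \<cdot>\<^sub>m \<theta> k b = \<theta> k a - \<theta> k b" for k
    using assms by (intro mat_minus_eq[of _ "m k"] hom_carrier_mat)
  then show ?thesis using hom_lin[OF assms, of 1 "-1"] assms by (simp add: scale_one one cminus_def)
qed

lemma hom_scale:
  assumes "a \<in> carrier A"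
  shows "norm_asymp m (\<lambda>k. \<theta> k (c \<triangleright> a)) (\<lambda>k. c \<cdot>\<^sub>m \<theta> k a)"
proof -
  have "c \<cdot>\<^sub>m \<theta> k a + 0 \<cdot>\<^sub>m \<theta> k a = c \<cdot>\<^sub>m \<theta> k a" for k
    by (intro eq_matI) auto
  then show ?thesis using hom_lin[OF assms assms, of c 0] assms by (simp add: zero_scale plus_zero closed)
qed

text \<open>
  The identity \<open>s + s = a\<^sup>*a + ss\<close> of \<open>quasi_square_root\<close> is carried to the matrices, where it
  becomes the hypothesis of \<open>op_norm_sq_le_quasi_root\<close> up to a null sequence.
\<close>

lemma hom_contractive_unit:
  assumes a: "a \<in> carrier A" and small: "cnorm A a < 1" and eps: "0 < \<epsilon>"
  shows "\<forall>\<^sub>F k in sequentially. op_norm (\<theta> k a) < 1 + \<epsilon>"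
proof -
  let ?x = "cstar A a \<boxdot> a"
  have x: "?x \<in> carrier A" "cstar A ?x = ?x"
    using a by (auto simp: closed star_times star_star)
  have "cnorm A ?x < 1"
    using small norm_nonneg[OF a] by (simp add: cstar_identity a power_less_one_iff)
  then obtain s where s: "s \<in> carrier A" "cstar A s = s" "s \<boxplus> s = ?x \<boxplus> s \<boxdot> s"
    using quasi_square_root[OF x] by blast
  let ?S = "\<lambda>k. \<theta> k s" and ?T = "\<lambda>k. \<theta> k a"
  have S: "?S \<in> carrier (prod_mat m)" and T: "?T \<in> carrier (prod_mat m)"
    and X: "(\<lambda>k. \<theta> k ?x) \<in> carrier (prod_mat m)"
    using a s x by (blast intro: hom_closed)+
  have Sstar: "norm_asymp m ?S (\<lambda>k. mat_adjoint (\<theta> k s))"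
    using hom_star[OF s(1)] s(2) by simp
  have ?thesis if "norm_asymp m (\<lambda>k. mat_adjoint (\<theta> k a) * \<theta> k a)
       (\<lambda>k. \<theta> k s + mat_adjoint (\<theta> k s) - mat_adjoint (\<theta> k s) * \<theta> k s)"
  proof -
    have "\<forall>\<^sub>F k in sequentially. op_norm (mat_adjoint (\<theta> k a) * \<theta> k a
        - (\<theta> k s + mat_adjoint (\<theta> k s) - mat_adjoint (\<theta> k s) * \<theta> k s)) < \<epsilon>"
      by (intro order_tendstoD(2)[OF norm_asympD(3)[OF that]] eps)
    then show ?thesis
    proof eventually_elim
      case (elim k)
      have "(op_norm (\<theta> k a))\<^sup>2 < 1 + \<epsilon>"
        using op_norm_sq_le_quasi_root[OF hom_carrier_mat[OF a] hom_carrier_mat[OF s(1)], of k] elim by simp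
      also have "\<dots> \<le> (1 + \<epsilon>)\<^sup>2" using eps by (simp add: power2_eq_square algebra_simps)
      finally show ?case using eps by (intro power2_less_imp_less[of _ "1 + \<epsilon>"]) auto
    qed
  qed
  moreover have "norm_asymp m (\<lambda>k. mat_adjoint (\<theta> k a) * \<theta> k a)
       (\<lambda>k. \<theta> k s + mat_adjoint (\<theta> k s) - mat_adjoint (\<theta> k s) * \<theta> k s)"
  proof -
    have "norm_asymp m (\<lambda>k. mat_adjoint (\<theta> k a) * \<theta> k a) (\<lambda>k. \<theta> k (cstar A a) * \<theta> k a)"
      using a by (intro norm_asymp_mult norm_asymp_sym[OF hom_star] norm_asymp_refl T)
    also have "norm_asymp m \<dots> (\<lambda>k. \<theta> k ?x)"
      using a by (intro norm_asymp_sym[OF hom_mult] closed)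
    also have "(\<lambda>k. \<theta> k ?x) = (\<lambda>k. (\<theta> k ?x + \<theta> k s * \<theta> k s) - \<theta> k s * \<theta> k s)"
    proof
      fix k show "\<theta> k ?x = (\<theta> k ?x + \<theta> k s * \<theta> k s) - \<theta> k s * \<theta> k s"
        using hom_carrier_mat[OF x(1), of k] hom_carrier_mat[OF s(1), of k] by (intro eq_matI) auto
    qed
    also have "norm_asymp m \<dots> (\<lambda>k. (\<theta> k s + \<theta> k s) - \<theta> k s * \<theta> k s)"
    proof (intro norm_asymp_minus norm_asymp_refl prod_mat_times_closed S)
      have "norm_asymp m (\<lambda>k. \<theta> k ?x + \<theta> k s * \<theta> k s) (\<lambda>k. \<theta> k ?x + \<theta> k (s \<boxdot> s))"
        using s by (intro norm_asymp_add norm_asymp_refl X norm_asymp_sym[OF hom_mult])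
      also have "norm_asymp m \<dots> (\<lambda>k. \<theta> k (?x \<boxplus> s \<boxdot> s))"
        by (intro norm_asymp_sym[OF hom_add] closed a s(1))
      also have "norm_asymp m \<dots> (\<lambda>k. \<theta> k s + \<theta> k s)"
        unfolding s(3)[symmetric] by (intro hom_add s(1))
      finally show "norm_asymp m (\<lambda>k. \<theta> k ?x + \<theta> k s * \<theta> k s) (\<lambda>k. \<theta> k s + \<theta> k s)" .
    qed
    also have "norm_asymp m \<dots> (\<lambda>k. \<theta> k s + mat_adjoint (\<theta> k s) - mat_adjoint (\<theta> k s) * \<theta> k s)"
      by (intro norm_asymp_minus norm_asymp_add norm_asymp_mult Sstar norm_asymp_refl S)
    finally show ?thesis .
  qed
  ultimately show ?thesis by blast
qed

text \<open>
  The rate of convergence depends on \<open>a\<close>: the single maps may be discontinuous.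
\<close>

theorem hom_contractive:
  assumes a: "a \<in> carrier A" and M: "cnorm A a < M"
  shows "\<forall>\<^sub>F k in sequentially. op_norm (\<theta> k a) < M"
proof -
  obtain N where N: "cnorm A a < N" "N < M" using M dense by blast
  then have Npos: "0 < N" using norm_nonneg[OF a] by linarith
  let ?b = "complex_of_real (1 / N) \<triangleright> a"
  have b: "?b \<in> carrier A" "cnorm A ?b < 1"
    using a N Npos by (auto simp: closed norm_scale norm_divide)
  obtain \<epsilon> where eps: "0 < \<epsilon>" "N * (1 + \<epsilon>) < M"
  proof
    show "0 < (M - N) / (2 * N)" using N Npos by simp
    have "N * (1 + (M - N) / (2 * N)) = (N + M) / 2" using Npos by (simp add: field_simps)
    then show "N * (1 + (M - N) / (2 * N)) < M" using N by simp
  qed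
  have "norm_asymp m (\<lambda>k. \<theta> k a) (\<lambda>k. complex_of_real N \<cdot>\<^sub>m \<theta> k ?b)"
  proof -
    have "complex_of_real N * complex_of_real (1 / N) = 1"
      using Npos by simp
    then have "complex_of_real N \<triangleright> ?b = a" using a by (simp only: scale_scale scale_one)
    then show ?thesis using hom_scale[OF b(1), of N] by (simp only:)
  qed
  moreover have "\<forall>\<^sub>F k in sequentially. op_norm (complex_of_real N \<cdot>\<^sub>m \<theta> k ?b) \<le> N * (1 + \<epsilon>)"
    using hom_contractive_unit[OF b eps(1)]
  proof eventually_elim
    case (elim k)
    have "op_norm (complex_of_real N \<cdot>\<^sub>m \<theta> k ?b) = N * op_norm (\<theta> k ?b)"
      using op_norm_smult[OF hom_carrier_mat[OF b(1)], of "complex_of_real N" k] Npos by simp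
    also have "\<dots> \<le> N * (1 + \<epsilon>)" using elim Npos by (intro mult_left_mono) auto
    finally show ?case .
  qed
  ultimately show ?thesis using eps(2) by (rule norm_asymp_eventually_less)
qed

lemma hom_zero: "norm_asymp m (\<lambda>k. \<theta> k (czero A)) (\<lambda>k. 0\<^sub>m (m k) (m k))"
proof -
  have "0 \<cdot>\<^sub>m \<theta> k (czero A) = 0\<^sub>m (m k) (m k)" for k
    using hom_carrier_mat[OF zero_closed, of k] by (intro eq_matI) auto
  then show ?thesis using hom_scale[OF zero_closed, of 0] by (simp add: scale_zero)
qed

lemma hom_dist:
  assumes a: "a \<in> carrier A" and b: "b \<in> carrier A" and lt: "cnorm A (cminus A a b) < \<delta>"
  shows "\<forall>\<^sub>F k in sequentially. op_norm (\<theta> k a - \<theta> k b) < \<delta>"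
proof -
  obtain \<delta>' where d: "cnorm A (cminus A a b) < \<delta>'" "\<delta>' < \<delta>" using lt dense by blast
  have "\<forall>\<^sub>F k in sequentially. op_norm (\<theta> k (cminus A a b)) \<le> \<delta>'"
    using hom_contractive[OF minus_closed[OF a b] d(1)] by (rule eventually_mono) simp
  from norm_asymp_eventually_less[OF norm_asymp_sym[OF hom_minus[OF a b]] this d(2)] show ?thesis .
qed

end

section \<open>Completely positive maps into matrix algebras\<close>

lemma clinear_mapD:
  assumes "clinear_map A E f" "a \<in> carrier A"
  shows "f a \<in> carrier E" "b \<in> carrier A \<Longrightarrow> f (a \<boxplus>\<^bsub>A\<^esub> b) = f a \<boxplus>\<^bsub>E\<^esub> f b"
    "f (c \<triangleright>\<^bsub>A\<^esub> a) = c \<triangleright>\<^bsub>E\<^esub> f a"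
  using assms by (auto simp: clinear_map_def)

lemma cp_map_linear: "cp_map A E f \<Longrightarrow> clinear_map A E f"
  by (simp add: cp_map_def)

lemma mat_cpositive_matrix_iff:
  "mat_cpositive (matrix_algebra n) N X \<longleftrightarrow> (\<exists>Y. \<forall>i<N. \<forall>j<N. Y i j \<in> carrier_mat n n \<and>
      X i j = csum (matrix_algebra n) (\<lambda>k. mat_adjoint (Y k i) * Y k j) N)"
  unfolding mat_cpositive_def matrix_algebra_simps by (simp add: all_conj_distrib imp_conjR)

lemma csum_cong: "(\<And>k. k < n \<Longrightarrow> f k = g k) \<Longrightarrow> csum E f n = csum E g n"
  by (induction n) auto

lemma csum_matrix_carrier:
  "(\<And>k. k < N \<Longrightarrow> g k \<in> carrier_mat n n) \<Longrightarrow> csum (matrix_algebra n) g N \<in> carrier_mat n n"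
  by (induction N) auto

lemma csum_prod_mat: "csum (prod_mat m) g N n = csum (matrix_algebra (m n)) (\<lambda>k. g k n) N"
  by (induction N) auto

lemma csum_adjoint_mult_form:
  assumes "\<And>k. k < N \<Longrightarrow> Y k \<in> carrier_mat n n" and "v \<in> carrier_vec n"
  shows "Re (cinner (csum (matrix_algebra n) (\<lambda>k. mat_adjoint (Y k) * Y k) N *\<^sub>v v) v) = (\<Sum>k<N. (vnorm (Y k *\<^sub>v v))\<^sup>2)"
  using assms(1)
proof (induction N)
  case 0
  have "0\<^sub>m n n *\<^sub>v v = 0\<^sub>v n" using assms(2) by (intro eq_vecI) auto
  then show ?case by (simp add: cinner_def)
next
  case (Suc N)
  have "csum (matrix_algebra n) (\<lambda>k. mat_adjoint (Y k) * Y k) N \<in> carrier_mat n n"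
    using Suc.prems by (intro csum_matrix_carrier mult_carrier_mat[of _ n n] adjoint_carrier) auto
  then have "dim_row (csum (matrix_algebra n) (\<lambda>k. mat_adjoint (Y k) * Y k) N) = n"
    "dim_col (csum (matrix_algebra n) (\<lambda>k. mat_adjoint (Y k) * Y k) N) = n"
    by auto
  moreover have YN: "Y N \<in> carrier_mat n n" using Suc.prems by simp
  then have "dim_row (Y N) = n" "dim_col (Y N) = n" by auto
  moreover have "cinner (mat_adjoint (Y N) *\<^sub>v (Y N *\<^sub>v v)) v = cinner (Y N *\<^sub>v v) (Y N *\<^sub>v v)"
    using YN assms(2) by (intro cinner_adjoint') auto
  ultimately show ?case
    using Suc assms(2) by (simp add: mat_vec_simps cinner_simps Re_cinner_self)
qed

context cstar_algebra begin

lemma csum_map: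
  assumes f: "\<And>x y. x \<in> carrier A \<Longrightarrow> y \<in> carrier A \<Longrightarrow> f (x \<boxplus> y) = f x \<boxplus>\<^bsub>E\<^esub> f y"
    "f (czero A) = czero E"
    and g: "\<And>k. k < n \<Longrightarrow> g k \<in> carrier A"
  shows "csum A g n \<in> carrier A \<and> f (csum A g n) = csum E (\<lambda>k. f (g k)) n"
  using g by (induction n) (auto simp: f closed)

text \<open>
  The matrix with entries \<open>a\<^sup>*a, a\<^sup>*b, b\<^sup>*a, b\<^sup>*b\<close> is \<open>Y\<^sup>*Y\<close> for the matrix \<open>Y\<close> with first row
  \<open>(a, b)\<close> and second row \<open>0\<close>; its image is again of this form.
\<close>

lemma cp_map_two_positive:
  assumes cp: "cp_map A (matrix_algebra n) \<phi>" and a: "a \<in> carrier A" and b: "b \<in> carrier A"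
  obtains P Q R S where
    "P \<in> carrier_mat n n" "Q \<in> carrier_mat n n" "R \<in> carrier_mat n n" "S \<in> carrier_mat n n"
    "\<phi> (cstar A a \<boxdot> a) = mat_adjoint P * P + mat_adjoint Q * Q"
    "\<phi> (cstar A a \<boxdot> b) = mat_adjoint P * R + mat_adjoint Q * S"
    "\<phi> (cstar A b \<boxdot> a) = mat_adjoint R * P + mat_adjoint S * Q"
    "\<phi> (cstar A b \<boxdot> b) = mat_adjoint R * R + mat_adjoint S * S"
proof -
  define c where "c j = (if j = 0 then a else b)" for j :: nat
  have c: "c j \<in> carrier A" for j using a b by (simp add: c_def)
  let ?X = "\<lambda>i j. cstar A (c i) \<boxdot> c j"
  have "mat_cpositive A 2 ?X"
    unfolding mat_cpositive_def
    by (intro exI[of _ "\<lambda>k j. if k = 0 then c j else czero A"])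
      (simp add: numeral_2_eq_2 c closed star_zero zero_times plus_zero zero_plus)
  then have "mat_cpositive (matrix_algebra n) 2 (\<lambda>i j. \<phi> (?X i j))"
    using cp by (simp add: cp_map_def)
  then obtain Y where Y: "\<forall>i<2. \<forall>j<2. Y i j \<in> carrier_mat n n \<and> \<phi> (?X i j)
        = csum (matrix_algebra n) (\<lambda>k. mat_adjoint (Y k i) * Y k j) 2"
    unfolding mat_cpositive_matrix_iff by (rule exE)
  have "\<phi> (?X i j) = mat_adjoint (Y 0 i) * Y 0 j + mat_adjoint (Y 1 i) * Y 1 j" if "i < 2" "j < 2" for i j
  proof -
    have "mat_adjoint (Y 0 i) * Y 0 j \<in> carrier_mat n n"
      using Y that by (intro mult_carrier_mat[of _ n n] adjoint_carrier) auto
    then show ?thesis using Y that by (simp add: numeral_2_eq_2)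
  qed
  from this[of 0 0] this[of 0 1] this[of 1 0] this[of 1 1] show thesis
    using Y by (intro that[of "Y 0 0" "Y 1 0" "Y 0 1" "Y 1 1"]) (auto simp: c_def)
qed

lemma cp_map_star_products:
  assumes cp: "cp_map A (matrix_algebra n) \<phi>" and a: "a \<in> carrier A" and b: "b \<in> carrier A"
  shows "\<phi> (cstar A (a \<boxdot> b)) = mat_adjoint (\<phi> (a \<boxdot> b))"
proof -
  obtain P Q R S where
    c: "P \<in> carrier_mat n n" "Q \<in> carrier_mat n n" "R \<in> carrier_mat n n" "S \<in> carrier_mat n n" and
    "\<phi> (cstar A (cstar A a) \<boxdot> b) = mat_adjoint P * R + mat_adjoint Q * S"
    "\<phi> (cstar A b \<boxdot> cstar A a) = mat_adjoint R * P + mat_adjoint S * Q"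
    using cp_map_two_positive[OF cp star_closed[OF a] b] by metis
  moreover have "mat_adjoint (mat_adjoint P * R + mat_adjoint Q * S) = mat_adjoint R * P + mat_adjoint S * Q"
    using c by (simp add: adjoint_simps)
  ultimately show ?thesis using a b by (simp add: star_star star_times)
qed

text \<open>
  This is the value of the positive image of the 2-by-2 matrix in \<open>cp_map_two_positive\<close> at the
  vector \<open>(v, w)\<close>.
\<close>

lemma cp_map_form_nonneg:
  assumes cp: "cp_map A (matrix_algebra n) \<phi>" and a: "a \<in> carrier A" and b: "b \<in> carrier A"
    and v: "v \<in> carrier_vec n" and w: "w \<in> carrier_vec n"
  shows "0 \<le> Re (cinner (\<phi> (cstar A a \<boxdot> a) *\<^sub>v v) v) + 2 * Re (cinner (\<phi> (cstar A a \<boxdot> b) *\<^sub>v w) v)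
           + Re (cinner (\<phi> (cstar A b \<boxdot> b) *\<^sub>v w) w)"
proof -
  obtain P Q R S where
    c: "P \<in> carrier_mat n n" "Q \<in> carrier_mat n n" "R \<in> carrier_mat n n" "S \<in> carrier_mat n n" and
    eq: "\<phi> (cstar A a \<boxdot> a) = mat_adjoint P * P + mat_adjoint Q * Q"
    "\<phi> (cstar A a \<boxdot> b) = mat_adjoint P * R + mat_adjoint Q * S"
    "\<phi> (cstar A b \<boxdot> b) = mat_adjoint R * R + mat_adjoint S * S"
    using cp_map_two_positive[OF cp a b] by metis
  have form: "cinner ((mat_adjoint T * U) *\<^sub>v x) y = cinner (U *\<^sub>v x) (T *\<^sub>v y)"
    if "T \<in> carrier_mat n n" "U \<in> carrier_mat n n" "x \<in> carrier_vec n" "y \<in> carrier_vec n" for T U x y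
    using that by (simp add: mat_vec_simps cinner_adjoint'[of _ n n])
  have sum: "cinner ((mat_adjoint T * U + mat_adjoint T' * U') *\<^sub>v x) y
      = cinner (U *\<^sub>v x) (T *\<^sub>v y) + cinner (U' *\<^sub>v x) (T' *\<^sub>v y)"
    if "T \<in> carrier_mat n n" "U \<in> carrier_mat n n" "T' \<in> carrier_mat n n" "U' \<in> carrier_mat n n"
      "x \<in> carrier_vec n" "y \<in> carrier_vec n" for T U T' U' x y
    using that by (simp add: mat_vec_simps(1) cinner_simps form[symmetric])
  have "Re (cinner (\<phi> (cstar A a \<boxdot> a) *\<^sub>v v) v) + 2 * Re (cinner (\<phi> (cstar A a \<boxdot> b) *\<^sub>v w) v)
           + Re (cinner (\<phi> (cstar A b \<boxdot> b) *\<^sub>v w) w)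
    = (vnorm (R *\<^sub>v w + P *\<^sub>v v))\<^sup>2 + (vnorm (S *\<^sub>v w + Q *\<^sub>v v))\<^sup>2"
    using c v w unfolding eq
    by (simp add: sum Re_cinner_self vnorm_add_sq[of _ n])
  then show ?thesis by simp
qed

lemma cp_map_positive:
  assumes cp: "cp_map A (matrix_algebra n) \<phi>" and a: "a \<in> carrier A" and v: "v \<in> carrier_vec n"
  shows "0 \<le> Re (cinner (\<phi> (cstar A a \<boxdot> a) *\<^sub>v v) v)"
  using cp_map_form_nonneg[OF cp a a v v] by simp

text \<open>
  In a unital algebra this reads \<open>e\<^sup>*(1 - s)\<^sup>2e = e\<^sup>*e - e\<^sup>*xe\<close>. It exhibits the difference
  \<open>e\<^sup>*e - e\<^sup>*xe\<close> as a positive element.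
\<close>

lemma quasi_root_complement:
  assumes e: "e \<in> carrier A" and x: "x \<in> carrier A"
    and s: "s \<in> carrier A" "cstar A s = s" "s \<boxplus> s = x \<boxplus> s \<boxdot> s"
  shows "cstar A (cminus A e (s \<boxdot> e)) \<boxdot> cminus A e (s \<boxdot> e) \<boxplus> cstar A e \<boxdot> (x \<boxdot> e) = cstar A e \<boxdot> e"
proof -
  let ?p = "cstar A e \<boxdot> e" and ?q = "cstar A e \<boxdot> (s \<boxdot> e)"
    and ?r = "cstar A e \<boxdot> (s \<boxdot> (s \<boxdot> e))" and ?z = "cstar A e \<boxdot> (x \<boxdot> e)"
  have c: "?p \<in> carrier A" "?q \<in> carrier A" "?r \<in> carrier A" "?z \<in> carrier A"
    using e x s by (auto simp: closed)
  have "cstar A e \<boxdot> ((s \<boxplus> s) \<boxdot> e) = cstar A e \<boxdot> ((x \<boxplus> s \<boxdot> s) \<boxdot> e)" by (simp add: s)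
  then have qz: "?q \<boxplus> ?q = ?r \<boxplus> ?z"
    using e x s(1) c by (simp add: plus_times times_plus times_assoc closed plus_commute)
  have "cstar A (cminus A e (s \<boxdot> e)) \<boxdot> cminus A e (s \<boxdot> e)
      = ?p \<boxplus> ((-1) \<triangleright> ?q \<boxplus> ((-1) \<triangleright> ?q \<boxplus> ?r))"
    using e s(1,2) by (simp add: cminus_def star_plus star_scale star_times times_plus plus_times
        times_assoc scale_times times_scale scale_scale scale_one scale_plus closed plus_assoc)
  then have "cstar A (cminus A e (s \<boxdot> e)) \<boxdot> cminus A e (s \<boxdot> e) \<boxplus> ?z
      = ?p \<boxplus> ((-1) \<triangleright> ?q \<boxplus> ((-1) \<triangleright> ?q \<boxplus> (?r \<boxplus> ?z)))"
    using c by (simp add: plus_assoc closed)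
  also have "\<dots> = ?p \<boxplus> ((-1) \<triangleright> (?q \<boxplus> ?q) \<boxplus> (?q \<boxplus> ?q))"
    unfolding qz[symmetric] using c by (simp add: scale_plus plus_assoc closed)
  also have "(-1) \<triangleright> (?q \<boxplus> ?q) \<boxplus> (?q \<boxplus> ?q) = czero A"
    using c by (metis plus_commute plus_inverse plus_closed scale_closed)
  finally show ?thesis using c by (simp add: plus_zero)
qed

text \<open>
  This is the bound on the off-diagonal corner of a positive 2-by-2 operator matrix by its
  diagonal; the form is evaluated at \<open>v = - T w / K\<close>, where it is minimal.
\<close>

lemma op_norm_le_of_form:
  assumes T: "T \<in> carrier_mat n n" and K: "0 < K" and M: "0 \<le> M"
    and form: "\<And>v w. v \<in> carrier_vec n \<Longrightarrow> w \<in> carrier_vec n \<Longrightarrow>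
      0 \<le> K * (vnorm v)\<^sup>2 + 2 * Re (cinner (T *\<^sub>v w) v) + K * M\<^sup>2 * (vnorm w)\<^sup>2"
  shows "op_norm T \<le> K * M"
proof (rule op_norm_leI[OF T])
  fix w :: "complex vec" assume w: "w \<in> carrier_vec n"
  let ?u = "T *\<^sub>v w"
  have u: "?u \<in> carrier_vec n" using T w by simp
  have "0 \<le> K * (vnorm (complex_of_real (- 1 / K) \<cdot>\<^sub>v ?u))\<^sup>2
      + 2 * Re (cinner ?u (complex_of_real (- 1 / K) \<cdot>\<^sub>v ?u)) + K * M\<^sup>2 * (vnorm w)\<^sup>2"
    using u w by (intro form) auto
  also have "cinner ?u (complex_of_real (- 1 / K) \<cdot>\<^sub>v ?u) = complex_of_real (- 1 / K * (vnorm ?u)\<^sup>2)"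
    unfolding cinner_smult_right[OF u u] cinner_self by simp
  also have "vnorm (complex_of_real (- 1 / K) \<cdot>\<^sub>v ?u) = 1 / K * vnorm ?u"
    using K by (simp add: vnorm_smult norm_divide)
  finally have "0 \<le> K * (1 / K * vnorm ?u)\<^sup>2 + 2 * (- 1 / K * (vnorm ?u)\<^sup>2) + K * M\<^sup>2 * (vnorm w)\<^sup>2"
    by (simp only: Re_complex_of_real)
  also have "\<dots> = ((K * M * vnorm w)\<^sup>2 - (vnorm ?u)\<^sup>2) / K"
    using K by (simp add: field_simps power2_eq_square)
  finally have "(vnorm ?u)\<^sup>2 \<le> (K * M * vnorm w)\<^sup>2"
    using K by (simp only: zero_le_divide_iff) linarith
  moreover have "0 \<le> K * M * vnorm w" using K M by (intro mult_nonneg_nonneg vnorm_nonneg) simp_all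
  ultimately show "vnorm ?u \<le> K * M * vnorm w" by (rule power2_le_imp_le)
qed (use K M in simp)

text \<open>
  For \<open>M > \<parallel>a\<parallel>\<close> the element \<open>M\<^sup>2 e\<^sup>*e - e\<^sup>*a\<^sup>*ae\<close> is positive by \<open>quasi_square_root\<close>. So both
  diagonal corners of the positive matrix with entries \<open>\<phi>(e\<^sup>*e), \<phi>(e\<^sup>*ae), \<phi>(e\<^sup>*a\<^sup>*e), \<phi>(e\<^sup>*a\<^sup>*ae)\<close>
  are controlled by \<open>\<phi>(e\<^sup>*e)\<close>, and the off-diagonal corner is bounded by them.
\<close>

theorem cp_map_compression_bound:
  assumes cp: "cp_map A (matrix_algebra n) \<phi>" and e: "e \<in> carrier A" and a: "a \<in> carrier A"
    and K: "0 < K" "op_norm (\<phi> (cstar A e \<boxdot> e)) \<le> K"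
  shows "op_norm (\<phi> (cstar A e \<boxdot> (a \<boxdot> e))) \<le> K * cnorm A a"
proof -
  note lin = clinear_mapD[OF cp_map_linear[OF cp]]
  have carr: "\<phi> x \<in> carrier_mat n n" if "x \<in> carrier A" for x using lin(1)[OF that] by simp
  let ?T = "\<phi> (cstar A e \<boxdot> (a \<boxdot> e))"
  \<comment> \<open>strict inequality is needed for \<open>quasi_square_root\<close>; the claim follows by letting \<open>M\<close> decrease\<close>
  have bound: "op_norm ?T \<le> K * M" if M: "cnorm A a < M" for M
  proof (rule op_norm_le_of_form)
    have Mpos: "0 < M" using M norm_nonneg[OF a] by linarith
    then show "0 \<le> M" by simp
    define x where "x = complex_of_real (1 / M\<^sup>2) \<triangleright> (cstar A a \<boxdot> a)"
    have x: "x \<in> carrier A" "cstar A x = x"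
      using a by (auto simp: x_def closed star_scale star_times star_star)
    have "(cnorm A a)\<^sup>2 < M\<^sup>2" using M norm_nonneg[OF a] by (intro power_strict_mono) auto
    then have "cnorm A x < 1"
      using a Mpos by (simp add: x_def norm_scale closed cstar_identity norm_divide norm_power)
    then obtain s where s: "s \<in> carrier A" "cstar A s = s" "s \<boxplus> s = x \<boxplus> s \<boxdot> s"
      using quasi_square_root[OF x] by blast
    fix v w :: "complex vec" assume v: "v \<in> carrier_vec n" and w: "w \<in> carrier_vec n"
    let ?P = "\<phi> (cstar A e \<boxdot> e)"
    let ?f = "\<lambda>T u. Re (cinner (T *\<^sub>v u) u)"
    have P: "?f ?P u \<le> K * (vnorm u)\<^sup>2" if u: "u \<in> carrier_vec n" for u
    proof -
      have "?f ?P u \<le> vnorm (?P *\<^sub>v u) * vnorm u"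
        using order_trans[OF complex_Re_le_cmod cinner_Cauchy_Schwarz[of "?P *\<^sub>v u" n u]]
          carr[of "cstar A e \<boxdot> e"] e u by (simp add: closed)
      also have "\<dots> \<le> (op_norm ?P * vnorm u) * vnorm u"
        using vnorm_mult_le[of ?P n n u] carr[of "cstar A e \<boxdot> e"] e u
        by (intro mult_right_mono) (auto simp: closed)
      also have "\<dots> \<le> (K * vnorm u) * vnorm u" using K by (intro mult_right_mono) auto
      finally show ?thesis by (simp add: power2_eq_square)
    qed
    have "?f (\<phi> (cstar A (a \<boxdot> e) \<boxdot> (a \<boxdot> e))) w \<le> M\<^sup>2 * ?f ?P w"
    proof -
      let ?y = "cminus A e (s \<boxdot> e)" and ?z = "cstar A e \<boxdot> (x \<boxdot> e)"
      have y: "?y \<in> carrier A" using e s by (simp add: minus_closed closed)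
      have z: "?z \<in> carrier A" using e x by (simp add: closed)
      have "?P = \<phi> (cstar A ?y \<boxdot> ?y) + \<phi> ?z"
        using quasi_root_complement[OF e x(1) s] lin(2)[of "cstar A ?y \<boxdot> ?y" ?z] y z
        by (simp add: closed)
      then have "?f ?P w = ?f (\<phi> (cstar A ?y \<boxdot> ?y)) w + ?f (\<phi> ?z) w"
        using carr[of "cstar A ?y \<boxdot> ?y"] carr[of ?z] y z w
        by (simp add: closed mat_vec_simps cinner_simps)
      then have "?f (\<phi> ?z) w \<le> ?f ?P w" using cp_map_positive[OF cp y w] by simp
      moreover have "cstar A (a \<boxdot> e) \<boxdot> (a \<boxdot> e) = complex_of_real (M\<^sup>2) \<triangleright> ?z"
      proof -
        have "complex_of_real (M\<^sup>2) * complex_of_real (1 / M\<^sup>2) = 1" using Mpos by simp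
        then show ?thesis using a e
          by (simp only: x_def scale_times times_scale scale_scale scale_one closed star_times times_assoc)
      qed
      then have "?f (\<phi> (cstar A (a \<boxdot> e) \<boxdot> (a \<boxdot> e))) w = M\<^sup>2 * ?f (\<phi> ?z) w"
        using lin(3)[OF z, of "complex_of_real (M\<^sup>2)"] carr[OF z] w
        by (simp add: mat_vec_simps cinner_simps flip: of_real_power)
      ultimately show ?thesis using Mpos by simp
    qed
    also have "M\<^sup>2 * ?f ?P w \<le> M\<^sup>2 * (K * (vnorm w)\<^sup>2)" by (intro mult_left_mono P w) auto
    finally show "0 \<le> K * (vnorm v)\<^sup>2 + 2 * Re (cinner (?T *\<^sub>v w) v) + K * M\<^sup>2 * (vnorm w)\<^sup>2"
      using cp_map_form_nonneg[OF cp e times_closed[OF a e] v w] P[OF v] by (simp add: mult_ac)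
  qed (use carr a e K in \<open>auto simp: closed\<close>)
  have "op_norm ?T / K \<le> cnorm A a"
  proof (rule dense_ge)
    fix M assume "cnorm A a < M"
    then show "op_norm ?T / K \<le> M" using bound[of M] K by (simp add: field_simps)
  qed
  then show ?thesis using K by (simp add: field_simps)
qed

lemma mat_cpositive_compression:
  assumes X: "mat_cpositive A N X" and e: "e \<in> carrier A"
  shows "mat_cpositive A N (\<lambda>i j. cstar A e \<boxdot> (X i j \<boxdot> e))"
proof -
  obtain Y where Y: "\<And>i j. i < N \<Longrightarrow> j < N \<Longrightarrow> Y i j \<in> carrier A"
    "\<And>i j. i < N \<Longrightarrow> j < N \<Longrightarrow> X i j = csum A (\<lambda>k. cstar A (Y k i) \<boxdot> Y k j) N"
    using X unfolding mat_cpositive_def by blast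
  have "cstar A e \<boxdot> (X i j \<boxdot> e) = csum A (\<lambda>k. cstar A (Y k i \<boxdot> e) \<boxdot> (Y k j \<boxdot> e)) N"
    if ij: "i < N" "j < N" for i j
  proof -
    let ?f = "\<lambda>x. cstar A e \<boxdot> (x \<boxdot> e)"
    have "?f (X i j) = csum A (\<lambda>k. ?f (cstar A (Y k i) \<boxdot> Y k j)) N"
      unfolding Y(2)[OF ij]
      by (rule csum_map[of ?f A N, THEN conjunct2])
        (use e Y(1) ij in \<open>auto simp: plus_times times_plus closed zero_times times_zero\<close>)
    also have "\<dots> = csum A (\<lambda>k. cstar A (Y k i \<boxdot> e) \<boxdot> (Y k j \<boxdot> e)) N"
      using e Y(1) ij by (intro csum_cong) (simp add: star_times times_assoc closed)
    finally show ?thesis .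
  qed
  then show ?thesis
    unfolding mat_cpositive_def using Y(1) e
    by (intro exI[of _ "\<lambda>k j. Y k j \<boxdot> e"]) (auto simp: closed)
qed

end

lemma mat_cpositive_matrix_scale:
  assumes X: "mat_cpositive (matrix_algebra n) N X" and c: "0 \<le> c"
  shows "mat_cpositive (matrix_algebra n) N (\<lambda>i j. complex_of_real c \<cdot>\<^sub>m X i j)"
proof -
  obtain Y where Y12: "\<forall>i<N. \<forall>j<N. Y i j \<in> carrier_mat n n \<and>
      X i j = csum (matrix_algebra n) (\<lambda>k. mat_adjoint (Y k i) * Y k j) N"
    using X unfolding mat_cpositive_matrix_iff by (rule exE)
  then have Y: "Y i j \<in> carrier_mat n n"
    "X i j = csum (matrix_algebra n) (\<lambda>k. mat_adjoint (Y k i) * Y k j) N" if "i < N" "j < N" for i j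
    using that by simp_all
  define r where "r = complex_of_real (sqrt c)"
  have r: "r * cnj r = complex_of_real c" using c by (simp add: r_def flip: of_real_mult)
  have "complex_of_real c \<cdot>\<^sub>m X i j = csum (matrix_algebra n) (\<lambda>k. mat_adjoint (r \<cdot>\<^sub>m Y k i) * (r \<cdot>\<^sub>m Y k j)) N"
    if ij: "i < N" "j < N" for i j
  proof -
    have "L \<le> N \<Longrightarrow> complex_of_real c \<cdot>\<^sub>m csum (matrix_algebra n) (\<lambda>k. mat_adjoint (Y k i) * Y k j) L
      = csum (matrix_algebra n) (\<lambda>k. mat_adjoint (r \<cdot>\<^sub>m Y k i) * (r \<cdot>\<^sub>m Y k j)) L" for L
    proof (induction L)
      case (Suc L)
      have YL: "Y L i \<in> carrier_mat n n" "Y L j \<in> carrier_mat n n" using Y(1) ij Suc.prems by auto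
      have "csum (matrix_algebra n) (\<lambda>k. mat_adjoint (Y k i) * Y k j) L \<in> carrier_mat n n"
        using Y(1) ij Suc.prems by (intro csum_matrix_carrier mult_carrier_mat[of _ n n] adjoint_carrier) auto
      moreover have "mat_adjoint (r \<cdot>\<^sub>m Y L i) * (r \<cdot>\<^sub>m Y L j) = complex_of_real c \<cdot>\<^sub>m (mat_adjoint (Y L i) * Y L j)"
        using YL by (simp add: adjoint_smult mult_smult_distrib[of _ n n _ n] mult_smult_assoc_mat[of _ n n _ n]
            mat_smult_smult r)
      ultimately show ?case
        using Suc YL by (simp add: add_smult_distrib_left_mat[of _ n n] mult_carrier_mat[of _ n n])
    qed simp
    then show ?thesis using Y(2)[OF ij] by simp
  qed
  then show ?thesis
    unfolding mat_cpositive_def using Y(1)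
    by (intro exI[of _ "\<lambda>k j. r \<cdot>\<^sub>m Y k j"]) auto
qed

lemma (in cstar_algebra) cp_map_compression:
  assumes cp: "cp_map A (matrix_algebra n) \<phi>" and e: "e \<in> carrier A" and c: "0 \<le> c"
  shows "cp_map A (matrix_algebra n) (\<lambda>a. complex_of_real c \<cdot>\<^sub>m \<phi> (cstar A e \<boxdot> (a \<boxdot> e)))"
  unfolding cp_map_def
proof (intro conjI allI impI)
  note lin = clinear_mapD[OF cp_map_linear[OF cp]]
  have carr: "\<phi> x \<in> carrier_mat n n" if "x \<in> carrier A" for x using lin(1)[OF that] by simp
  show "clinear_map A (matrix_algebra n) (\<lambda>a. complex_of_real c \<cdot>\<^sub>m \<phi> (cstar A e \<boxdot> (a \<boxdot> e)))"
    unfolding clinear_map_def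
  proof (intro conjI ballI allI)
    fix a b assume ab: "a \<in> carrier A" "b \<in> carrier A"
    have "\<phi> (cstar A e \<boxdot> ((a \<boxplus> b) \<boxdot> e)) = \<phi> (cstar A e \<boxdot> (a \<boxdot> e)) + \<phi> (cstar A e \<boxdot> (b \<boxdot> e))"
      using ab e by (simp add: plus_times times_plus closed lin)
    then show "complex_of_real c \<cdot>\<^sub>m \<phi> (cstar A e \<boxdot> ((a \<boxplus> b) \<boxdot> e)) = complex_of_real c \<cdot>\<^sub>m \<phi> (cstar A e \<boxdot> (a \<boxdot> e))
          \<boxplus>\<^bsub>matrix_algebra n\<^esub> complex_of_real c \<cdot>\<^sub>m \<phi> (cstar A e \<boxdot> (b \<boxdot> e))"
      using carr[of "cstar A e \<boxdot> (a \<boxdot> e)"] carr[of "cstar A e \<boxdot> (b \<boxdot> e)"] ab e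
      by (simp add: closed add_smult_distrib_left_mat[of _ n n])
  next
    fix d a assume a: "a \<in> carrier A"
    have "\<phi> (cstar A e \<boxdot> ((d \<triangleright> a) \<boxdot> e)) = d \<cdot>\<^sub>m \<phi> (cstar A e \<boxdot> (a \<boxdot> e))"
      using a e by (simp add: scale_times times_scale closed lin)
    then show "complex_of_real c \<cdot>\<^sub>m \<phi> (cstar A e \<boxdot> ((d \<triangleright> a) \<boxdot> e))
        = d \<triangleright>\<^bsub>matrix_algebra n\<^esub> (complex_of_real c \<cdot>\<^sub>m \<phi> (cstar A e \<boxdot> (a \<boxdot> e)))"
      by (simp add: mat_smult_smult mult.commute)
  qed (use carr e in \<open>auto simp: closed\<close>)
  fix N X assume "mat_cpositive A N X"
  then show "mat_cpositive (matrix_algebra n) N (\<lambda>i j. complex_of_real c \<cdot>\<^sub>m \<phi> (cstar A e \<boxdot> (X i j \<boxdot> e)))"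
    using cp c e mat_cpositive_compression[of N X e] unfolding cp_map_def
    by (intro mat_cpositive_matrix_scale) simp_all
qed

lemma (in cstar_algebra) mat_cpositive_entries:
  assumes "mat_cpositive A N X" "i < N" "j < N" shows "X i j \<in> carrier A"
proof -
  obtain Y where Y: "\<And>i j. i < N \<Longrightarrow> j < N \<Longrightarrow> Y i j \<in> carrier A"
    "\<And>i j. i < N \<Longrightarrow> j < N \<Longrightarrow> X i j = csum A (\<lambda>k. cstar A (Y k i) \<boxdot> Y k j) N"
    using assms(1) unfolding mat_cpositive_def by blast
  have "csum A (\<lambda>k. cstar A (Y k i) \<boxdot> Y k j) N \<in> carrier A"
    by (rule csum_map[of "\<lambda>x. x" A N, THEN conjunct1]) (use Y(1) assms(2,3) in \<open>auto simp: closed\<close>)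
  then show ?thesis using Y(2) assms(2,3) by simp
qed

section \<open>Completely positive maps into products\<close>

lemma cp_map_coordinate:
  assumes cp: "cp_map A (prod_mat m) \<psi>"
  shows "cp_map A (matrix_algebra (m n)) (\<lambda>a. \<psi> a n)"
  unfolding cp_map_def
proof (intro conjI allI impI)
  show "clinear_map A (matrix_algebra (m n)) (\<lambda>a. \<psi> a n)"
    using cp_map_linear[OF cp] by (auto simp: clinear_map_def Pi_iff prod_mat_carrier)
  fix N X assume "mat_cpositive A N X"
  then have "mat_cpositive (prod_mat m) N (\<lambda>i j. \<psi> (X i j))" using cp by (simp add: cp_map_def)
  then obtain Y where "(\<forall>i<N. \<forall>j<N. Y i j \<in> carrier (prod_mat m)) \<and>
    (\<forall>i<N. \<forall>j<N. \<psi> (X i j) = csum (prod_mat m) (\<lambda>k. cstar (prod_mat m) (Y k i) \<boxdot>\<^bsub>prod_mat m\<^esub> Y k j) N)"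
    unfolding mat_cpositive_def by (rule exE)
  then show "mat_cpositive (matrix_algebra (m n)) N (\<lambda>i j. \<psi> (X i j) n)"
    unfolding mat_cpositive_matrix_iff
    by (intro exI[of _ "\<lambda>k j. Y k j n"]) (simp add: prod_mat_carrier csum_prod_mat)
qed

lemma cp_map_zero: "cp_map A (matrix_algebra n) (\<lambda>_. 0\<^sub>m n n)"
proof -
  have "csum (matrix_algebra n) (\<lambda>_. 0\<^sub>m n n) N = 0\<^sub>m n n" for N by (induction N) auto
  then have "mat_cpositive (matrix_algebra n) N (\<lambda>_ _. 0\<^sub>m n n)" for N
    unfolding mat_cpositive_def by (intro exI[of _ "\<lambda>_ _. 0\<^sub>m n n"]) auto
  then show ?thesis by (auto simp: cp_map_def clinear_map_def)
qed

text \<open>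
  Positivity in the product requires the coordinatewise square roots \<open>Y\<close> to be bounded. They
  are, because each entry \<open>Y\<^sub>i\<^sub>j\<close> satisfies \<open>Y\<^sub>i\<^sub>j\<^sup>*Y\<^sub>i\<^sub>j \<le> \<Sum>\<^sub>k Y\<^sub>k\<^sub>j\<^sup>*Y\<^sub>k\<^sub>j\<close>, which is a diagonal entry of the given
  bounded matrix.
\<close>

lemma (in cstar_algebra) cp_map_product:
  assumes cp: "\<And>n. cp_map A (matrix_algebra (m n)) (\<lambda>a. \<psi> a n)"
    and bounded: "\<And>a. a \<in> carrier A \<Longrightarrow> \<psi> a \<in> carrier (prod_mat m)"
  shows "cp_map A (prod_mat m) \<psi>"
  unfolding cp_map_def
proof (intro conjI allI impI)
  show "clinear_map A (prod_mat m) \<psi>"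
    using cp bounded by (auto simp: cp_map_def clinear_map_def fun_eq_iff)
  fix N X assume X: "mat_cpositive A N X"
  have "mat_cpositive (matrix_algebra (m n)) N (\<lambda>i j. \<psi> (X i j) n)" for n
    using cp[of n] X by (simp add: cp_map_def)
  then have "\<forall>n. \<exists>Y. \<forall>i<N. \<forall>j<N. Y i j \<in> carrier_mat (m n) (m n) \<and>
      \<psi> (X i j) n = csum (matrix_algebra (m n)) (\<lambda>k. mat_adjoint (Y k i) * Y k j) N"
    unfolding mat_cpositive_matrix_iff by (rule allI)
  then obtain Y where Y12: "\<forall>n. \<forall>i<N. \<forall>j<N. Y n i j \<in> carrier_mat (m n) (m n) \<and>
    \<psi> (X i j) n = csum (matrix_algebra (m n)) (\<lambda>k. mat_adjoint (Y n k i) * Y n k j) N"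
    by (rule choice[THEN exE])
  then have Y: "Y n i j \<in> carrier_mat (m n) (m n)"
    "\<psi> (X i j) n = csum (matrix_algebra (m n)) (\<lambda>k. mat_adjoint (Y n k i) * Y n k j) N"
    if "i < N" "j < N" for n i j
    using that by simp_all
  have "(\<lambda>n. Y n i j) \<in> carrier (prod_mat m)" if ij: "i < N" "j < N" for i j
  proof -
    obtain C where C: "0 \<le> C" "\<And>n. op_norm (\<psi> (X j j) n) \<le> C"
      using prod_mat_bounded[OF bounded[OF mat_cpositive_entries[OF X ij(2) ij(2)]]] by blast
    have "op_norm (Y n i j) \<le> sqrt C" for n
    proof (rule op_norm_leI)
      show "Y n i j \<in> carrier_mat (m n) (m n)" by (rule Y(1)[OF ij])
      fix v :: "complex vec" assume v: "v \<in> carrier_vec (m n)"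
      have Xc: "\<psi> (X j j) n \<in> carrier_mat (m n) (m n)"
        using bounded[OF mat_cpositive_entries[OF X ij(2) ij(2)]] by (rule prod_mat_carrier)
      have "(vnorm (Y n i j *\<^sub>v v))\<^sup>2 \<le> (\<Sum>k<N. (vnorm (Y n k j *\<^sub>v v))\<^sup>2)"
        using ij by (intro member_le_sum) auto
      also have "\<dots> = Re (cinner (\<psi> (X j j) n *\<^sub>v v) v)"
        using csum_adjoint_mult_form[of N "\<lambda>k. Y n k j" "m n" v] Y ij v by simp
      also have "\<dots> \<le> vnorm (\<psi> (X j j) n *\<^sub>v v) * vnorm v"
        using order_trans[OF complex_Re_le_cmod cinner_Cauchy_Schwarz[of _ "m n" v]] Xc v by simp
      also have "\<dots> \<le> (C * vnorm v) * vnorm v"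
        using order_trans[OF vnorm_mult_le[OF Xc v] mult_right_mono[OF C(2)]] by (intro mult_right_mono) auto
      finally have "sqrt ((vnorm (Y n i j *\<^sub>v v))\<^sup>2) \<le> sqrt (C * (vnorm v)\<^sup>2)"
        by (intro real_sqrt_le_mono) (simp add: power2_eq_square)
      then show "vnorm (Y n i j *\<^sub>v v) \<le> sqrt C * vnorm v" by (simp add: real_sqrt_mult)
    qed (use C in auto)
    then show ?thesis using Y(1)[OF ij] by (intro prod_matI)
  qed
  then show "mat_cpositive (prod_mat m) N (\<lambda>i j. \<psi> (X i j))"
    unfolding mat_cpositive_def using Y(2)
    by (intro exI[of _ "\<lambda>i j n. Y n i j"]) (auto simp: fun_eq_iff csum_prod_mat)
qed

section \<open>Contractive completely positive maps preserve adjoints\<close>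

context cstar_algebra begin

text \<open>
  With \<open>1 + w' = (1 + w)(1 + b)\<close> and \<open>1 + x = (1 + w)\<^sup>*(1 + w)\<close>, this expands
  \<open>(1 + w')\<^sup>*(1 + w') = (1 + b)\<^sup>*(1 + x)(1 + b)\<close> without using a unit. The terms that cancel
  for \<open>b\<^sup>* = - b\<close> commuting with \<open>x\<close> are collected at the end.
\<close>

lemma quasi_product_defect:
  assumes w: "w \<in> carrier A" and b: "b \<in> carrier A"
  defines "x \<equiv> cstar A w \<boxplus> (w \<boxplus> cstar A w \<boxdot> w)" and "w' \<equiv> w \<boxplus> (b \<boxplus> w \<boxdot> b)"
  shows "cstar A w' \<boxplus> (w' \<boxplus> cstar A w' \<boxdot> w')
    = (x \<boxplus> (cstar A b \<boxdot> b \<boxplus> cstar A b \<boxdot> (x \<boxdot> b))) \<boxplus> ((b \<boxplus> cstar A b) \<boxplus> (x \<boxdot> b \<boxplus> cstar A b \<boxdot> x))"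
  using w b unfolding x_def w'_def
  by (simp add: closed star_plus star_times times_plus plus_times times_assoc plus_assoc
      plus_commute plus_left_commute)

text \<open>
  Here \<open>w N\<close> is \<open>(1 + b)\<^sup>N - 1\<close>. As \<open>b\<close> is skew-adjoint, \<open>(1 + b)\<^sup>*(1 + b) = 1 - bb\<close>, and therefore
  \<open>w\<^sup>*w + w\<^sup>* + w\<close> is \<open>(1 - bb)\<^sup>N - 1\<close>, whose norm is at most \<open>(1 + t)\<^sup>N - 1\<close>.
  The C*-identity turns this into a quadratic inequality for the norm of \<open>w N\<close>.
\<close>

lemma quasi_unitary_powers:
  assumes b: "b \<in> carrier A" "cstar A b = (-1) \<triangleright> b" and t: "(cnorm A b)\<^sup>2 \<le> t"
  defines "w \<equiv> rec_nat (czero A) (\<lambda>_ w. w \<boxplus> (b \<boxplus> w \<boxdot> b))"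
  shows "w N \<in> carrier A" and "(cnorm A (w N))\<^sup>2 \<le> 2 * cnorm A (w N) + ((1 + t) ^ N - 1)"
proof -
  define x where "x N = cstar A (w N) \<boxplus> (w N \<boxplus> cstar A (w N) \<boxdot> w N)" for N
  have w_Suc: "w (Suc N) = w N \<boxplus> (b \<boxplus> w N \<boxdot> b)" for N by (simp add: w_def)
  have w: "w N \<in> carrier A" for N by (induction N) (use b in \<open>auto simp: w_def closed\<close>)
  then show "w N \<in> carrier A" .
  have x: "x N \<in> carrier A" for N using w by (simp add: x_def closed)
  have t0: "0 \<le> t" using t zero_le_power2[of "cnorm A b"] by linarith
  have inv: "x N \<boxdot> b = b \<boxdot> x N \<and> cnorm A (x N) \<le> (1 + t) ^ N - 1" for N
  proof (induction N)
    case 0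
    have "x 0 = czero A" by (simp add: x_def w_def star_zero times_zero zero_closed plus_zero)
    then show ?case using b by (simp add: zero_times times_zero norm_zero)
  next
    case (Suc N)
    have "x (Suc N) = (x N \<boxplus> (cstar A b \<boxdot> b \<boxplus> cstar A b \<boxdot> (x N \<boxdot> b)))
        \<boxplus> ((b \<boxplus> cstar A b) \<boxplus> (x N \<boxdot> b \<boxplus> cstar A b \<boxdot> x N))"
      unfolding x_def w_Suc by (rule quasi_product_defect[OF w b(1)])
    also have "(b \<boxplus> cstar A b) \<boxplus> (x N \<boxdot> b \<boxplus> cstar A b \<boxdot> x N) = czero A"
      using b x[of N] Suc by (simp add: scale_times plus_inverse closed plus_zero)
    finally have step: "x (Suc N) = x N \<boxplus> (cstar A b \<boxdot> b \<boxplus> cstar A b \<boxdot> (x N \<boxdot> b))"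
      using b(1) x[of N] by (simp add: closed plus_zero)
    have "x (Suc N) \<boxdot> b = b \<boxdot> x (Suc N)"
    proof -
      have com: "x N \<boxdot> b = b \<boxdot> x N" using Suc by blast
      have "b \<boxdot> (x N \<boxdot> b) \<boxdot> b = b \<boxdot> (b \<boxdot> (x N \<boxdot> b))"
        using b(1) x[of N] com by (simp add: times_assoc closed flip: times_assoc[of "x N" b])
      then show ?thesis
        unfolding step using b x[of N] com
        by (simp add: closed plus_times times_plus scale_times times_scale times_assoc)
    qed
    moreover have "cnorm A (x (Suc N)) \<le> (1 + t) ^ Suc N - 1"
    proof -
      have nb: "cnorm A (cstar A b) = cnorm A b" using b norm_star by blast
      have "cnorm A (x (Suc N)) \<le> cnorm A (x N) + (cnorm A (cstar A b \<boxdot> b) + cnorm A (cstar A b \<boxdot> (x N \<boxdot> b)))"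
        unfolding step using b(1) x[of N]
        by (intro order_trans[OF norm_triangle] add_left_mono norm_triangle closed)
      also have "cnorm A (cstar A b \<boxdot> b) = (cnorm A b)\<^sup>2" by (rule cstar_identity[OF b(1)])
      also have "cnorm A (cstar A b \<boxdot> (x N \<boxdot> b)) \<le> cnorm A b * (cnorm A (x N) * cnorm A b)"
        using b(1) x[of N] norm_nonneg[of b]
        by (intro order_trans[OF norm_times] closed) (auto simp: nb closed intro!: mult_left_mono norm_times)
      also have "cnorm A (x N) + ((cnorm A b)\<^sup>2 + cnorm A b * (cnorm A (x N) * cnorm A b))
          = cnorm A (x N) + (cnorm A b)\<^sup>2 * (1 + cnorm A (x N))"
        by (simp add: algebra_simps power2_eq_square)
      also have "\<dots> \<le> cnorm A (x N) + t * (1 + cnorm A (x N))"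
        using t norm_nonneg[OF x] by (intro add_left_mono mult_right_mono) auto
      also have "\<dots> = (1 + t) * (1 + cnorm A (x N)) - 1" by (simp add: algebra_simps)
      also have "\<dots> \<le> (1 + t) * (1 + t) ^ N - 1"
        using Suc t0 by (intro diff_right_mono mult_left_mono) auto
      finally show ?thesis by simp
    qed
    ultimately show ?case by blast
  qed
  have "cstar A (w N) \<boxdot> w N = cminus A (cminus A (x N) (w N)) (cstar A (w N))"
  proof -
    have "x N = (cstar A (w N) \<boxdot> w N \<boxplus> cstar A (w N)) \<boxplus> w N"
      using w[of N] by (simp add: x_def closed plus_assoc plus_commute plus_left_commute)
    then show ?thesis using w[of N] by (simp add: minus_plus_cancel closed)
  qed
  then have "(cnorm A (w N))\<^sup>2 \<le> cnorm A (x N) + cnorm A (w N) + cnorm A (w N)"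
    using norm_minus_le[of "cminus A (x N) (w N)" "cstar A (w N)"] norm_minus_le[of "x N" "w N"] w[of N] x[of N]
    by (simp add: cstar_identity[symmetric] minus_closed closed norm_star)
  then show "(cnorm A (w N))\<^sup>2 \<le> 2 * cnorm A (w N) + ((1 + t) ^ N - 1)"
    using inv[of N] by simp
qed

definition star_defect :: "('a \<Rightarrow> complex mat) \<Rightarrow> 'a \<Rightarrow> complex mat" where
  "star_defect \<phi> a = \<phi> (cstar A a) - mat_adjoint (\<phi> a)"

text \<open>
  The defect \<open>D\<close> is additive, bounded, and vanishes on products. For \<open>b = \<i>a / \<surd>N\<close> the element
  \<open>(1 + b)\<^sup>N - 1\<close> equals \<open>N b\<close> modulo products, so its defect has norm \<open>\<surd>N \<parallel>D a\<parallel>\<close>; but by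
  \<open>quasi_unitary_powers\<close> its norm, hence also its defect, stays bounded as \<open>N\<close> grows.
\<close>

theorem ccp_map_star_selfadjoint:
  assumes ccp: "ccp_map A (matrix_algebra n) \<phi>" and a: "a \<in> carrier A" "cstar A a = a" "cnorm A a \<le> 1"
  shows "mat_adjoint (\<phi> a) = \<phi> a"
proof -
  have cp: "cp_map A (matrix_algebra n) \<phi>" using ccp by (simp add: ccp_map_def)
  note lin = clinear_mapD[OF cp_map_linear[OF cp], unfolded matrix_algebra_simps]
  have contr: "op_norm (\<phi> y) \<le> cnorm A y" if "y \<in> carrier A" for y
    using ccp that by (simp add: ccp_map_def)
  let ?D = "star_defect \<phi>"
  have carr: "\<phi> y \<in> carrier_mat n n" "\<phi> (cstar A y) \<in> carrier_mat n n" "?D y \<in> carrier_mat n n"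
    if "y \<in> carrier A" for y using that lin(1) by (auto simp: closed star_defect_def)
  have D_add: "?D (y \<boxplus> z) = ?D y + ?D z" if "y \<in> carrier A" "z \<in> carrier A" for y z
    using that carr[of y] carr[of z]
    using that adjoint_add[OF carr(1)[OF that(1)] carr(1)[OF that(2)]]
      mat_add_minus_add[OF carr(2)[OF that(1)] carr(2)[OF that(2)]
        adjoint_carrier[OF carr(1)[OF that(1)]] adjoint_carrier[OF carr(1)[OF that(2)]]]
    by (simp add: star_defect_def star_plus lin closed)
  have D_prod: "?D (y \<boxdot> z) = 0\<^sub>m n n" if "y \<in> carrier A" "z \<in> carrier A" for y z
    unfolding star_defect_def cp_map_star_products[OF cp that]
    using carr[of "y \<boxdot> z"] that by (intro minus_r_inv_mat[of _ n n] adjoint_carrier) (auto simp: closed)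
  have D_norm: "op_norm (?D y) \<le> 2 * cnorm A y" if y: "y \<in> carrier A" for y
    using op_norm_minus[of "\<phi> (cstar A y)" n n "mat_adjoint (\<phi> y)"] carr[OF y] contr[OF y]
      contr[OF star_closed[OF y]] y by (simp add: star_defect_def op_norm_adjoint norm_star)
  have bound: "sqrt (real N) * op_norm (?D a) \<le> 6" if N: "0 < N" for N
  proof -
    define c where "c = \<i> * complex_of_real (1 / sqrt (real N))"
    let ?b = "c \<triangleright> a"
    define w where "w = rec_nat (czero A) (\<lambda>_ w. w \<boxplus> (?b \<boxplus> w \<boxdot> ?b))"
    have c: "cnj c = - c" "cmod c = 1 / sqrt (real N)" by (simp_all add: c_def norm_mult norm_divide)
    have b: "?b \<in> carrier A" "cstar A ?b = (-1) \<triangleright> ?b"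
      using a c by (auto simp: closed star_scale scale_scale)
    have "(cnorm A ?b)\<^sup>2 \<le> 1 / real N"
      using a norm_nonneg[OF a(1)] N
      by (auto simp: norm_scale c power_mult_distrib power_divide divide_simps power_le_one)
    note w = quasi_unitary_powers[OF b this, folded w_def]
    have "(1 + 1 / real N) ^ N \<le> exp (1 / real N) ^ N"
      by (intro power_mono exp_ge_add_one_self) auto
    also have "\<dots> = exp 1" using N by (simp flip: exp_of_nat_mult)
    also have "\<dots> \<le> 3" by (rule exp_le)
    finally have "(cnorm A (w N))\<^sup>2 \<le> 2 * cnorm A (w N) + 2" using w(2)[of N] by linarith
    then have "(cnorm A (w N) - 1)\<^sup>2 \<le> 2\<^sup>2" by (simp add: power2_eq_square algebra_simps)
    \<comment> \<open>any bound independent of \<open>N\<close> would do; this one uses \<open>exp 1 \<le> 3\<close>\<close>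
    then have w3: "cnorm A (w N) \<le> 3" using power2_le_imp_le[of "cnorm A (w N) - 1" 2] by simp
    have "?D (w L) = complex_of_nat L \<cdot>\<^sub>m ?D ?b" for L
    proof (induction L)
      case 0
      have "?D (czero A) = 0\<^sub>m n n"
        using D_prod[of "czero A" "czero A"] by (simp add: zero_closed zero_times)
      then show ?case using carr(3)[OF b(1)] by (simp add: w_def) (intro eq_matI, auto)
    next
      case (Suc L)
      have "w (Suc L) = w L \<boxplus> (?b \<boxplus> w L \<boxdot> ?b)" by (simp add: w_def)
      then have "?D (w (Suc L)) = complex_of_nat L \<cdot>\<^sub>m ?D ?b + (?D ?b + 0\<^sub>m n n)"
        using w(1)[of L] b(1) Suc by (simp add: D_add D_prod closed)
      then show ?case using carr(3)[OF b(1)] by simp (intro eq_matI, auto simp: algebra_simps)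
    qed
    moreover have "?D ?b = (- c) \<cdot>\<^sub>m ?D a"
    proof -
      have "dim_row (\<phi> a) = n" "dim_col (\<phi> a) = n" using carr(1)[OF a(1)] by auto
      then have "(- c) \<cdot>\<^sub>m \<phi> a - (- c) \<cdot>\<^sub>m mat_adjoint (\<phi> a) = (- c) \<cdot>\<^sub>m (\<phi> a - mat_adjoint (\<phi> a))"
        by (intro eq_matI) (auto simp: algebra_simps)
      then show ?thesis using a c by (simp add: star_defect_def star_scale lin closed adjoint_smult)
    qed
    ultimately have "op_norm (?D (w N)) = real N * (1 / sqrt (real N) * op_norm (?D a))"
      using carr(3)[OF a(1)] by (simp add: op_norm_smult[of _ n n] c)
    also have "\<dots> = (real N / sqrt (real N)) * op_norm (?D a)" by simp
    also have "real N / sqrt (real N) = sqrt (real N)" by (rule real_div_sqrt) simp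
    finally show ?thesis using D_norm[OF w(1)[of N]] w3 by linarith
  qed
  have "op_norm (?D a) = 0"
  proof (rule ccontr)
    assume "op_norm (?D a) \<noteq> 0"
    then have pos: "0 < op_norm (?D a)" using op_norm_nonneg[of "?D a"] by linarith
    obtain N where N: "(7 / op_norm (?D a))\<^sup>2 < real N" using reals_Archimedean2 by blast
    then have "0 < N" using zero_le_power2[of "7 / op_norm (?D a)"] by (cases N) auto
    have "7 / op_norm (?D a) < sqrt (real N)" using N pos by (intro real_less_rsqrt)
    then have "7 < sqrt (real N) * op_norm (?D a)" using pos by (simp add: field_simps)
    then show False using bound[OF \<open>0 < N\<close>] by simp
  qed
  then have zero: "vnorm (?D a *\<^sub>v v) = 0" if "v \<in> carrier_vec n" for v
    using vnorm_mult_le[OF carr(3)[OF a(1)] that] vnorm_nonneg[of "?D a *\<^sub>v v"] by simp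
  have D0: "?D a $$ (i, j) = 0" if "i < n" "j < n" for i j
  proof -
    have "?D a *\<^sub>v unit_vec n j = 0\<^sub>v n"
      using zero[of "unit_vec n j"] carr(3)[OF a(1)] by (intro vnorm_eq_0) auto
    then have "(?D a *\<^sub>v unit_vec n j) $ i = 0" using that by simp
    then show ?thesis using that carr(3)[OF a(1)] by simp
  qed
  have dims: "dim_row (\<phi> a) = n" "dim_col (\<phi> a) = n" using carr(1)[OF a(1)] by auto
  show ?thesis
  proof (rule eq_matI)
    fix i j assume "i < dim_row (\<phi> a)" "j < dim_col (\<phi> a)"
    then show "mat_adjoint (\<phi> a) $$ (i, j) = \<phi> a $$ (i, j)"
      using D0[of i j] dims a(2) unfolding star_defect_def by simp
  qed (simp_all add: dims)
qed

theorem ccp_map_star: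
  assumes ccp: "ccp_map A (matrix_algebra n) \<phi>" and a: "a \<in> carrier A"
  shows "\<phi> (cstar A a) = mat_adjoint (\<phi> a)"
proof -
  have cp: "cp_map A (matrix_algebra n) \<phi>" using ccp by (simp add: ccp_map_def)
  note lin = clinear_mapD[OF cp_map_linear[OF cp], unfolded matrix_algebra_simps]
  have sa: "mat_adjoint (\<phi> h) = \<phi> h" if h: "h \<in> carrier A" "cstar A h = h" for h
  proof -
    define r where "r = 1 / (1 + cnorm A h)"
    have r: "0 < r" "r * cnorm A h \<le> 1"
      using norm_nonneg[OF h(1)] by (auto simp: r_def divide_simps)
    let ?h = "complex_of_real r \<triangleright> h"
    have "mat_adjoint (\<phi> ?h) = \<phi> ?h"
      using h r by (intro ccp_map_star_selfadjoint[OF ccp]) (auto simp: closed star_scale norm_scale)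
    then have eq: "complex_of_real r \<cdot>\<^sub>m mat_adjoint (\<phi> h) = complex_of_real r \<cdot>\<^sub>m \<phi> h"
      using h by (simp add: lin adjoint_smult)
    have "complex_of_real (1 / r) * complex_of_real r = 1" using r by simp
    then show ?thesis
      using arg_cong[OF eq, of "\<lambda>T. complex_of_real (1 / r) \<cdot>\<^sub>m T"]
      by (simp only: mat_smult_smult mat_smult_one)
  qed
  let ?s = "a \<boxplus> cstar A a" and ?d = "\<i> \<triangleright> cminus A a (cstar A a)"
  have s: "?s \<in> carrier A" "cstar A ?s = ?s" using a by (auto simp: closed star_plus star_star plus_commute)
  have d: "?d \<in> carrier A" "cstar A ?d = ?d"
    using a by (auto simp: closed minus_closed star_scale star_minus star_star minus_swap[of a "cstar A a"]
        scale_scale)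
  have c: "\<phi> a \<in> carrier_mat n n" "\<phi> (cstar A a) \<in> carrier_mat n n" using a lin by (auto simp: closed)
  have "mat_adjoint (\<phi> a) + mat_adjoint (\<phi> (cstar A a)) = \<phi> a + \<phi> (cstar A a)"
    using sa[OF s] a c by (simp add: lin closed adjoint_simps)
  moreover have "- \<i> \<cdot>\<^sub>m (mat_adjoint (\<phi> a) - mat_adjoint (\<phi> (cstar A a))) = \<i> \<cdot>\<^sub>m (\<phi> a - \<phi> (cstar A a))"
    using sa[OF d] a c by (simp add: cminus_def lin closed adjoint_simps adjoint_smult mat_minus_eq[of _ n])
  ultimately have e: "\<And>i j. i < n \<Longrightarrow> j < n \<Longrightarrow> cnj (\<phi> a $$ (j, i)) + cnj (\<phi> (cstar A a) $$ (j, i))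
        = \<phi> a $$ (i, j) + \<phi> (cstar A a) $$ (i, j)"
      "\<And>i j. i < n \<Longrightarrow> j < n \<Longrightarrow> - \<i> * (cnj (\<phi> a $$ (j, i)) - cnj (\<phi> (cstar A a) $$ (j, i)))
        = \<i> * (\<phi> a $$ (i, j) - \<phi> (cstar A a) $$ (i, j))"
    using c by (auto dest!: arg_cong[where f = "\<lambda>T. T $$ (_, _)"] simp: mat_eq_iff)
  show ?thesis
  proof (rule eq_matI)
    fix i j assume "i < dim_row (mat_adjoint (\<phi> a))" "j < dim_col (mat_adjoint (\<phi> a))"
    then have ij: "i < n" "j < n" using c by auto
    let ?p = "cnj (\<phi> a $$ (j, i))" and ?q = "cnj (\<phi> (cstar A a) $$ (j, i))"
      and ?r = "\<phi> a $$ (i, j)" and ?s = "\<phi> (cstar A a) $$ (i, j)"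
    have "\<i> * (- (?p - ?q)) = \<i> * (?r - ?s)"
      using e(2)[OF ij] by (simp only: mult_minus_left mult_minus_right)
    then have m: "- (?p - ?q) = ?r - ?s" by (rule mult_left_cancel[OF complex_i_not_zero, THEN iffD1])
    have "?p = ((?p + ?q) - (- (?p - ?q))) / 2" by simp
    also have "\<dots> = ((?r + ?s) - (?r - ?s)) / 2" by (simp only: m e(1)[OF ij])
    also have "\<dots> = ?s" by simp
    finally have "?p = ?s" .
    then show "\<phi> (cstar A a) $$ (i, j) = mat_adjoint (\<phi> a) $$ (i, j)" using c ij by simp
  qed (use c in auto)
qed

end

lemma (in cstar_algebra) ccp_asymptotic_hom:
  assumes ccp: "\<And>n. ccp_map A (matrix_algebra (m n)) (\<phi> n)"
    and mult: "asymptotically_multiplicative A (\<lambda>n. matrix_algebra (m n)) \<phi>"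
  shows "asymptotic_hom A (\<lambda>n. matrix_algebra (m n)) \<phi>"
proof -
  note lin = clinear_mapD[OF cp_map_linear, of A "matrix_algebra (m n)" "\<phi> n" for n, unfolded matrix_algebra_simps]
  have cp: "cp_map A (matrix_algebra (m n)) (\<phi> n)" for n using ccp by (simp add: ccp_map_def)
  have c: "\<phi> n a \<in> carrier_mat (m n) (m n)" if "a \<in> carrier A" for n a using lin(1)[OF cp that] .
  have zero: "cminus (matrix_algebra n) S S = 0\<^sub>m n n" if "S \<in> carrier_mat n n" for n S
    using that by (simp add: matrix_algebra_minus)
  show ?thesis
    unfolding asymptotic_hom_def
  proof (intro conjI allI ballI)
    fix a assume a: "a \<in> carrier A"
    show "bdd_above (range (\<lambda>k. cnorm (matrix_algebra (m k)) (\<phi> k a)))"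
      using ccp a by (intro bdd_aboveI2[of _ _ "cnorm A a"]) (simp add: ccp_map_def)
    have "\<phi> k (cstar A a) = cstar (matrix_algebra (m k)) (\<phi> k a)" for k
      using ccp_map_star[OF ccp a] by simp
    then show "(\<lambda>k. cnorm (matrix_algebra (m k)) (cminus (matrix_algebra (m k)) (\<phi> k (cstar A a))
        (cstar (matrix_algebra (m k)) (\<phi> k a)))) \<longlonglongrightarrow> 0"
      using c[OF a] by (simp add: zero)
    fix b x y assume b: "b \<in> carrier A"
    have "\<phi> k (x \<triangleright> a \<boxplus> y \<triangleright> b) = x \<cdot>\<^sub>m \<phi> k a + y \<cdot>\<^sub>m \<phi> k b" for k
      using a b by (simp add: lin[OF cp] closed)
    then show "(\<lambda>k. cnorm (matrix_algebra (m k)) (cminus (matrix_algebra (m k)) (\<phi> k (x \<triangleright> a \<boxplus> y \<triangleright> b))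
       (x \<triangleright>\<^bsub>matrix_algebra (m k)\<^esub> \<phi> k a \<boxplus>\<^bsub>matrix_algebra (m k)\<^esub> y \<triangleright>\<^bsub>matrix_algebra (m k)\<^esub> \<phi> k b))) \<longlonglongrightarrow> 0"
      using c[OF a] c[OF b] by (simp add: zero)
  qed (use c mult in auto)
qed

section \<open>Approximate units in matrix algebras\<close>

text \<open>
  The hypothesis says \<open>H\<^sup>2 \<le> H\<close>, that is \<open>0 \<le> H \<le> 1\<close>, and \<open>g\<close> is the operator \<open>G = 1 - H\<close>.
  Spectrally, the second claim is \<open>N t (1 - t)\<^sup>2\<^sup>N \<le> 1\<close> and the third \<open>0 \<le> 1 - (1 - t)\<^sup>2\<^sup>N \<le> 1\<close> for
  \<open>0 \<le> t \<le> 1\<close>. Instead of diagonalizing \<open>H\<close>, one uses that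
  \<open>f(u) = \<langle>H u, u\<rangle>\<close> decreases along the iterates of \<open>G\<close>, while \<open>f(u) \<le> \<parallel>u\<parallel>\<^sup>2 - \<parallel>G u\<parallel>\<^sup>2\<close> makes the
  sum of its values telescope.
\<close>

lemma selfadjoint_power_estimates:
  fixes H :: "complex mat"
  assumes H: "H \<in> carrier_mat n n" "mat_adjoint H = H"
    and le: "\<And>v. v \<in> carrier_vec n \<Longrightarrow> (vnorm (H *\<^sub>v v))\<^sup>2 \<le> Re (cinner (H *\<^sub>v v) v)"
  defines "g \<equiv> \<lambda>v. v - H *\<^sub>v v"
  assumes v: "v \<in> carrier_vec n"
  shows "(g ^^ N) v \<in> carrier_vec n"
    and "real N * Re (cinner (H *\<^sub>v (g ^^ N) v) ((g ^^ N) v)) \<le> (vnorm v)\<^sup>2"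
    and "vnorm (v - (g ^^ (N + N)) v) \<le> vnorm v"
proof -
  let ?f = "\<lambda>u. Re (cinner (H *\<^sub>v u) u)"
  have g: "g u \<in> carrier_vec n" if "u \<in> carrier_vec n" for u using that H by (simp add: g_def)
  have gN: "(g ^^ L) u \<in> carrier_vec n" if "u \<in> carrier_vec n" for L u
    using that by (induction L) (auto intro: g)
  then show "(g ^^ N) v \<in> carrier_vec n" using v by blast
  have sym: "cinner (H *\<^sub>v x) y = cinner x (H *\<^sub>v y)" if "x \<in> carrier_vec n" "y \<in> carrier_vec n" for x y
    using cinner_adjoint[OF H(1) that] H(2) by simp
  have f_le: "?f u \<le> (vnorm u)\<^sup>2" if u: "u \<in> carrier_vec n" for u
  proof -
    have f: "?f u \<le> vnorm (H *\<^sub>v u) * vnorm u"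
      using order_trans[OF complex_Re_le_cmod cinner_Cauchy_Schwarz[of _ n u]] H u by simp
    have "vnorm (H *\<^sub>v u) \<le> vnorm u"
    proof (rule ccontr)
      assume "\<not> vnorm (H *\<^sub>v u) \<le> vnorm u"
      then have lt: "vnorm u < vnorm (H *\<^sub>v u)" by simp
      then have "vnorm (H *\<^sub>v u) * vnorm u < vnorm (H *\<^sub>v u) * vnorm (H *\<^sub>v u)"
        using vnorm_nonneg[of u] by (intro mult_strict_left_mono) linarith+
      then show False using le[OF u] f by (simp add: power2_eq_square)
    qed
    then have "vnorm (H *\<^sub>v u) * vnorm u \<le> vnorm u * vnorm u" by (intro mult_right_mono) auto
    then show ?thesis using f by (simp add: power2_eq_square)
  qed
  have f_nonneg: "0 \<le> ?f u" if "u \<in> carrier_vec n" for u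
    using le[OF that] zero_le_power2[of "vnorm (H *\<^sub>v u)"] by linarith
  have g_norm: "(vnorm (g u))\<^sup>2 \<le> (vnorm u)\<^sup>2 - ?f u" if u: "u \<in> carrier_vec n" for u
    using vnorm_diff_sq[of u n "H *\<^sub>v u"] sym[OF u u] le[OF u] H u by (simp add: g_def)
  have f_g: "?f (g u) \<le> ?f u" if u: "u \<in> carrier_vec n" for u
  proof -
    have Hu: "H *\<^sub>v u \<in> carrier_vec n" using H u by simp
    have "?f (g u) = ?f u - 2 * (vnorm (H *\<^sub>v u))\<^sup>2 + ?f (H *\<^sub>v u)"
      using H u Hu sym[OF Hu u] by (simp add: g_def mat_vec_simps cinner_simps Re_cinner_self)
    then show ?thesis using f_le[OF Hu] zero_le_power2[of "vnorm (H *\<^sub>v u)"] by linarith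
  qed
  have "real L * ?f ((g ^^ L) v) \<le> (vnorm v)\<^sup>2 - (vnorm ((g ^^ L) v))\<^sup>2" for L
  proof (induction L)
    case (Suc L)
    have "real (Suc L) * ?f ((g ^^ Suc L) v) \<le> real (Suc L) * ?f ((g ^^ L) v)"
      using f_g[OF gN[OF v]] by (intro mult_left_mono) auto
    then show ?case using Suc g_norm[OF gN[OF v], of L] by (simp add: algebra_simps)
  qed simp
  then show "real N * ?f ((g ^^ N) v) \<le> (vnorm v)\<^sup>2"
    using zero_le_power2[of "vnorm ((g ^^ N) v)"] order_trans by (smt (verit))
  have g_contr: "vnorm ((g ^^ L) u) \<le> vnorm u" if u: "u \<in> carrier_vec n" for L u
  proof (induction L)
    case (Suc L)
    have "(vnorm (g ((g ^^ L) u)))\<^sup>2 \<le> (vnorm ((g ^^ L) u))\<^sup>2"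
      using g_norm[OF gN[OF u], of L] f_nonneg[OF gN[OF u], of L] by linarith
    then have "vnorm (g ((g ^^ L) u)) \<le> vnorm ((g ^^ L) u)" by (rule power2_le_imp_le) simp
    then show ?case using Suc by simp
  qed simp
  have g_sym: "cinner ((g ^^ L) x) y = cinner x ((g ^^ L) y)" if "x \<in> carrier_vec n" "y \<in> carrier_vec n" for L x y
    using that
  proof (induction L arbitrary: y)
    case (Suc L)
    have "cinner (g u) y = cinner u (g y)" if u: "u \<in> carrier_vec n" for u
      using u Suc.prems H sym[OF u Suc.prems(2)] by (simp add: g_def cinner_simps)
    then have "cinner ((g ^^ Suc L) x) y = cinner ((g ^^ L) x) (g y)" using gN[OF Suc.prems(1)] by simp
    then show ?case using Suc.IH[OF Suc.prems(1) g[OF Suc.prems(2)]] by (simp add: funpow_swap1)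
  qed simp
  have "cinner v ((g ^^ (N + N)) v) = cinner ((g ^^ N) v) ((g ^^ N) v)"
    using g_sym[OF v gN[OF v], of N N] by (simp add: funpow_add)
  then have "(vnorm (v - (g ^^ (N + N)) v))\<^sup>2 = (vnorm v)\<^sup>2 - 2 * (vnorm ((g ^^ N) v))\<^sup>2 + (vnorm ((g ^^ (N + N)) v))\<^sup>2"
    using vnorm_diff_sq[OF v gN[OF v]] by (simp add: Re_cinner_self)
  also have "(vnorm ((g ^^ (N + N)) v))\<^sup>2 \<le> (vnorm ((g ^^ N) v))\<^sup>2"
    using g_contr[OF gN[OF v], of N N] by (intro power_mono) (auto simp: funpow_add)
  finally have "(vnorm (v - (g ^^ (N + N)) v))\<^sup>2 \<le> (vnorm v)\<^sup>2"
    using zero_le_power2[of "vnorm ((g ^^ N) v)"] by linarith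
  then show "vnorm (v - (g ^^ (N + N)) v) \<le> vnorm v" by (rule power2_le_imp_le) simp
qed

text \<open>
  The matrix \<open>1 - (1 - H)\<^sup>N\<close>, expressed without \<open>1\<close> so that the same recursion makes sense in a
  non-unital algebra.
\<close>

primrec approx_unit :: "nat \<Rightarrow> complex mat \<Rightarrow> nat \<Rightarrow> complex mat" where
  "approx_unit n H 0 = 0\<^sub>m n n"
| "approx_unit n H (Suc N) = approx_unit n H N + (H - approx_unit n H N * H)"

lemma approx_unit_carrier: "H \<in> carrier_mat n n \<Longrightarrow> approx_unit n H N \<in> carrier_mat n n"
  by (induction N) auto

lemma vec_minus_rearrange:
  fixes v :: "complex vec"
  assumes c: "v \<in> carrier_vec n" "h \<in> carrier_vec n" "x \<in> carrier_vec n" "e \<in> carrier_vec n" "f \<in> carrier_vec n"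
    and eq: "e - f = (v - h) - x"
  shows "e + (h - f) = v - x"
proof (rule eq_vecI)
  fix i assume "i < dim_vec (v - x)"
  then have "i < n" using c by simp
  then show "(e + (h - f)) $ i = (v - x) $ i"
    using arg_cong[OF eq, of "\<lambda>u. u $ i"] c by (simp add: algebra_simps)
qed (use c in auto)

lemma approx_unit_apply:
  assumes H: "H \<in> carrier_mat n n" and v: "v \<in> carrier_vec n"
  shows "approx_unit n H N *\<^sub>v v = v - ((\<lambda>v. v - H *\<^sub>v v) ^^ N) v"
  using v
proof (induction N arbitrary: v)
  case 0
  then show ?case by (intro eq_vecI) auto
next
  case (Suc N)
  let ?g = "\<lambda>v. v - H *\<^sub>v v" and ?E = "approx_unit n H N"
  have E: "?E \<in> carrier_mat n n" by (rule approx_unit_carrier[OF H])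
  have "(?g ^^ Suc N) v = (?g ^^ N) (v - H *\<^sub>v v)" by (simp only: funpow_Suc_right o_def)
  moreover have "?E *\<^sub>v (v - H *\<^sub>v v) = (v - H *\<^sub>v v) - (?g ^^ N) (v - H *\<^sub>v v)"
    using Suc H by simp
  moreover have "(?g ^^ N) (v - H *\<^sub>v v) \<in> carrier_vec n"
  proof -
    have "(?g ^^ L) u \<in> carrier_vec n" if "u \<in> carrier_vec n" for L u
      using that H by (induction L) auto
    then show ?thesis using Suc.prems H by simp
  qed
  moreover have "approx_unit n H (Suc N) *\<^sub>v v = ?E *\<^sub>v v + (H *\<^sub>v v - ?E *\<^sub>v (H *\<^sub>v v))"
    using E H Suc.prems by (simp add: mat_vec_simps)
  moreover have "?E *\<^sub>v (v - H *\<^sub>v v) = ?E *\<^sub>v v - ?E *\<^sub>v (H *\<^sub>v v)"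
    using E H Suc.prems by (simp add: mat_vec_simps)
  moreover have "?E *\<^sub>v v \<in> carrier_vec n" "?E *\<^sub>v (H *\<^sub>v v) \<in> carrier_vec n" "H *\<^sub>v v \<in> carrier_vec n"
    using E H Suc.prems by auto
  ultimately show ?case using Suc.prems H by (simp only:) (rule vec_minus_rearrange[of _ n]; simp)
qed

lemma approx_unit_norm:
  assumes "H \<in> carrier_mat n n" "mat_adjoint H = H"
    and "\<And>v. v \<in> carrier_vec n \<Longrightarrow> (vnorm (H *\<^sub>v v))\<^sup>2 \<le> Re (cinner (H *\<^sub>v v) v)"
  shows "op_norm (approx_unit n H (N + N)) \<le> 1"
  using assms selfadjoint_power_estimates(3)[OF assms]
  by (intro op_norm_leI[OF approx_unit_carrier]) (auto simp: approx_unit_apply)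

lemma approx_unit_error:
  assumes H: "H \<in> carrier_mat n n" "mat_adjoint H = H"
    and le: "\<And>v. v \<in> carrier_vec n \<Longrightarrow> (vnorm (H *\<^sub>v v))\<^sup>2 \<le> Re (cinner (H *\<^sub>v v) v)"
    and T: "T \<in> carrier_mat n n" and c: "0 < c" and N: "0 < N"
    and TH: "\<And>v. v \<in> carrier_vec n \<Longrightarrow> c * (vnorm (T *\<^sub>v v))\<^sup>2 \<le> Re (cinner (H *\<^sub>v v) v)"
  shows "op_norm (T - T * approx_unit n H N) \<le> 1 / sqrt (c * real N)"
proof (rule op_norm_leI)
  let ?g = "\<lambda>v. v - H *\<^sub>v v" and ?E = "approx_unit n H N"
  have E: "?E \<in> carrier_mat n n" by (rule approx_unit_carrier[OF H(1)])
  then show "T - T * ?E \<in> carrier_mat n n" using T by auto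
  fix v :: "complex vec" assume v: "v \<in> carrier_vec n"
  note est = selfadjoint_power_estimates[OF H le v]
  let ?w = "(?g ^^ N) v"
  have w: "?w \<in> carrier_vec n" by (rule est(1))
  have "(T - T * ?E) *\<^sub>v v = T *\<^sub>v (v - ?E *\<^sub>v v)"
    using T E v by (simp add: mat_vec_simps)
  also have "v - ?E *\<^sub>v v = ?w"
    using approx_unit_apply[OF H(1) v, of N] v w by (auto simp: vec_eq_iff)
  finally have eq: "(T - T * ?E) *\<^sub>v v = T *\<^sub>v ?w" .
  have "real N * (c * (vnorm (T *\<^sub>v ?w))\<^sup>2) \<le> real N * Re (cinner (H *\<^sub>v ?w) ?w)"
    using TH[OF w] by (intro mult_left_mono) auto
  also have "\<dots> \<le> (vnorm v)\<^sup>2" by (rule est(2))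
  finally have "(vnorm (T *\<^sub>v ?w))\<^sup>2 \<le> (vnorm v)\<^sup>2 / (c * real N)"
    using c N by (simp add: field_simps)
  then have "sqrt ((vnorm (T *\<^sub>v ?w))\<^sup>2) \<le> sqrt ((vnorm v)\<^sup>2 / (c * real N))"
    by (rule real_sqrt_le_mono)
  then show "vnorm ((T - T * ?E) *\<^sub>v v) \<le> 1 / sqrt (c * real N) * vnorm v"
    unfolding eq by (simp add: real_sqrt_divide)
qed (use c in simp)

text \<open>
  Normalizing \<open>\<Sum>Y\<^sub>i\<^sup>*Y\<^sub>i\<close> by the sum of the \<open>\<parallel>Y\<^sub>i\<parallel>\<^sup>2\<close> gives a matrix as in
  \<open>selfadjoint_power_estimates\<close> that dominates all \<open>c Y\<^sub>i\<^sup>*Y\<^sub>i\<close>; \<open>H\<^sup>2 \<le> H\<close> is the Cauchy-Schwarz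
  inequality for the sum.
\<close>

lemma gram_sum_properties:
  fixes Y :: "nat \<Rightarrow> complex mat"
  assumes Y: "\<And>i. i < r \<Longrightarrow> Y i \<in> carrier_mat n n" and C: "\<And>i. i < r \<Longrightarrow> op_norm (Y i) \<le> C i"
    and c: "0 \<le> c" "c * (\<Sum>i<r. (C i)\<^sup>2) \<le> 1"
  defines "H \<equiv> complex_of_real c \<cdot>\<^sub>m csum (matrix_algebra n) (\<lambda>i. mat_adjoint (Y i) * Y i) r"
  shows "H \<in> carrier_mat n n" and "mat_adjoint H = H"
    and "\<And>v. v \<in> carrier_vec n \<Longrightarrow> (vnorm (H *\<^sub>v v))\<^sup>2 \<le> Re (cinner (H *\<^sub>v v) v)"
    and "\<And>v i. v \<in> carrier_vec n \<Longrightarrow> i < r \<Longrightarrow> c * (vnorm (Y i *\<^sub>v v))\<^sup>2 \<le> Re (cinner (H *\<^sub>v v) v)"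
proof -
  let ?S = "\<lambda>L. csum (matrix_algebra n) (\<lambda>i. mat_adjoint (Y i) * Y i) L"
  have S: "?S L \<in> carrier_mat n n" if "L \<le> r" for L
    using Y that by (intro csum_matrix_carrier mult_carrier_mat[of _ n n] adjoint_carrier) auto
  show H: "H \<in> carrier_mat n n" using S[of r] by (simp add: H_def)
  have "L \<le> r \<Longrightarrow> mat_adjoint (?S L) = ?S L" for L
  proof (induction L)
    case (Suc L)
    have d: "dim_row (?S L) = n" "dim_col (?S L) = n" "dim_row (Y L) = n" "dim_col (Y L) = n"
      using S[of L] Y[of L] Suc.prems by auto
    then show ?case using Suc by (simp add: adjoint_simps)
  qed simp
  then show "mat_adjoint H = H" by (simp add: H_def adjoint_smult)
  fix v :: "complex vec" assume v: "v \<in> carrier_vec n"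
  have dS: "dim_col (?S r) = n" "dim_row (?S r) = n" using S[of r] by auto
  have form: "Re (cinner (H *\<^sub>v v) v) = c * (\<Sum>i<r. (vnorm (Y i *\<^sub>v v))\<^sup>2)"
    using csum_adjoint_mult_form[OF Y v, of r] dS v
    by (simp add: H_def mat_vec_simps cinner_simps)
  then show "c * (vnorm (Y i *\<^sub>v v))\<^sup>2 \<le> Re (cinner (H *\<^sub>v v) v)" if "i < r" for i
    using that c by (auto intro!: mult_left_mono member_le_sum)
  have "L \<le> r \<Longrightarrow> vnorm (?S L *\<^sub>v v) \<le> (\<Sum>i<L. C i * vnorm (Y i *\<^sub>v v))" for L
  proof (induction L)
    case 0
    have "0\<^sub>m n n *\<^sub>v v = 0\<^sub>v n" using v by (intro eq_vecI) auto
    then show ?case by simp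
  next
    case (Suc L)
    have YL: "Y L \<in> carrier_mat n n" using Y Suc.prems by simp
    have d: "dim_row (?S L) = n" "dim_col (?S L) = n" "dim_row (Y L) = n" "dim_col (Y L) = n"
      using S[of L] YL Suc.prems by auto
    have "?S (Suc L) *\<^sub>v v = ?S L *\<^sub>v v + mat_adjoint (Y L) *\<^sub>v (Y L *\<^sub>v v)"
      using d v by (simp add: mat_vec_simps)
    moreover have "?S L *\<^sub>v v \<in> carrier_vec n" "mat_adjoint (Y L) *\<^sub>v (Y L *\<^sub>v v) \<in> carrier_vec n"
      using d by (auto intro!: carrier_vecI)
    ultimately have "vnorm (?S (Suc L) *\<^sub>v v) \<le> vnorm (?S L *\<^sub>v v) + vnorm (mat_adjoint (Y L) *\<^sub>v (Y L *\<^sub>v v))"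
      by (simp only: vnorm_add[of _ n])
    also have "vnorm (mat_adjoint (Y L) *\<^sub>v (Y L *\<^sub>v v)) \<le> op_norm (Y L) * vnorm (Y L *\<^sub>v v)"
      using YL v by (intro vnorm_adjoint_mult) auto
    also have "\<dots> \<le> C L * vnorm (Y L *\<^sub>v v)" using C Suc.prems by (intro mult_right_mono) auto
    finally show ?case using Suc.IH Suc.prems by simp
  qed
  from this[of r] have "(vnorm (?S r *\<^sub>v v))\<^sup>2 \<le> (\<Sum>i<r. C i * vnorm (Y i *\<^sub>v v))\<^sup>2"
    by (intro power_mono) auto
  also have "\<dots> \<le> (\<Sum>i<r. (C i)\<^sup>2) * (\<Sum>i<r. (vnorm (Y i *\<^sub>v v))\<^sup>2)"
    by (rule Cauchy_Schwarz_ineq_sum)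
  finally have "c\<^sup>2 * (vnorm (?S r *\<^sub>v v))\<^sup>2 \<le> c\<^sup>2 * ((\<Sum>i<r. (C i)\<^sup>2) * (\<Sum>i<r. (vnorm (Y i *\<^sub>v v))\<^sup>2))"
    by (intro mult_left_mono) auto
  also have "\<dots> = (c * (\<Sum>i<r. (C i)\<^sup>2)) * Re (cinner (H *\<^sub>v v) v)"
    by (simp add: form power2_eq_square)
  also have "\<dots> \<le> 1 * Re (cinner (H *\<^sub>v v) v)"
    using c by (intro mult_right_mono) (auto simp: form sum_nonneg)
  finally show "(vnorm (H *\<^sub>v v))\<^sup>2 \<le> Re (cinner (H *\<^sub>v v) v)"
    using dS v c by (simp add: H_def mat_vec_simps vnorm_smult power_mult_distrib)
qed

text \<open>
  Write \<open>E\<^sup>*TE - T = E\<^sup>*(TE - T) + (E\<^sup>*T - T)\<close>; the last term is the adjoint of \<open>T\<^sup>*E - T\<^sup>*\<close>.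
\<close>

lemma compression_error:
  assumes T: "T \<in> carrier_mat n n" and E: "E \<in> carrier_mat n n" and E1: "op_norm E \<le> 1"
  shows "op_norm (mat_adjoint E * (T * E) - T) \<le> op_norm (T - T * E) + op_norm (mat_adjoint T - mat_adjoint T * E)"
proof -
  let ?E = "mat_adjoint E"
  have c: "?E \<in> carrier_mat n n" "T * E \<in> carrier_mat n n" "?E * T \<in> carrier_mat n n" "?E * (T * E) \<in> carrier_mat n n"
    using T E by (auto intro: mult_carrier_mat)
  have "op_norm (?E * (T * E) - T) \<le> op_norm (?E * (T * E) - ?E * T) + op_norm (?E * T - T)"
    using c T by (intro op_norm_minus_triangle)
  also have "?E * (T * E) - ?E * T = ?E * (T * E - T)"
    using c T by (simp add: mult_minus_distrib_mat[of _ n n _ n])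
  also have "op_norm (?E * (T * E - T)) \<le> op_norm ?E * op_norm (T * E - T)"
    using c T by (intro op_norm_mult[of _ n n _ n]) auto
  also have "\<dots> \<le> 1 * op_norm (T * E - T)"
    using E1 E by (intro mult_right_mono) (auto simp: op_norm_adjoint)
  also have "op_norm (T * E - T) = op_norm (T - T * E)" using c T by (intro op_norm_minus_commute)
  also have "op_norm (?E * T - T) = op_norm (mat_adjoint (?E * T - T))"
    using c T by (intro op_norm_adjoint[symmetric]) auto
  also have "mat_adjoint (?E * T - T) = mat_adjoint T * E - mat_adjoint T"
    using T E by (simp add: adjoint_simps)
  also have "op_norm (mat_adjoint T * E - mat_adjoint T) = op_norm (mat_adjoint T - mat_adjoint T * E)"
    using T E by (intro op_norm_minus_commute[of _ n] mult_carrier_mat[of _ n n] adjoint_carrier)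
  finally show ?thesis by simp
qed

lemma eventually_subseq_ex:
  assumes "\<forall>\<^sub>F k in sequentially. P k" shows "\<exists>k\<ge>(j::nat). P k"
  using assms eventually_ge_at_top[of j] unfolding eventually_sequentially by (metis nle_le)

section \<open>Making completely positive maps contractive\<close>

context matrix_asymptotic_hom begin

lemma hom_csum:
  assumes g: "\<And>i. i < r \<Longrightarrow> g i \<in> carrier A" and Y: "\<And>i. i < r \<Longrightarrow> norm_asymp m (\<lambda>k. \<theta> k (g i)) (\<lambda>k. Y k i)"
  shows "norm_asymp m (\<lambda>k. \<theta> k (csum A g r)) (\<lambda>k. csum (matrix_algebra (m k)) (Y k) r)
    \<and> csum A g r \<in> carrier A"
  using assms
proof (induction r)
  case 0
  then show ?case by (simp add: hom_zero zero_closed)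
next
  case (Suc r)
  then have IH: "norm_asymp m (\<lambda>k. \<theta> k (csum A g r)) (\<lambda>k. csum (matrix_algebra (m k)) (Y k) r)"
    "csum A g r \<in> carrier A" and gr: "g r \<in> carrier A" by simp_all
  have "norm_asymp m (\<lambda>k. \<theta> k (csum A g (Suc r))) (\<lambda>k. \<theta> k (csum A g r) + \<theta> k (g r))"
    using hom_add[OF IH(2) gr] by simp
  also have "norm_asymp m \<dots> (\<lambda>k. csum (matrix_algebra (m k)) (Y k) r + Y k r)"
    using Suc.prems by (intro norm_asymp_add IH(1)) simp
  finally show ?case using IH gr by (simp add: closed)
qed

lemma hom_approx_unit:
  assumes h: "h \<in> carrier A" and H: "norm_asymp m (\<lambda>k. \<theta> k h) H"
  defines "e \<equiv> rec_nat (czero A) (\<lambda>_ e. e \<boxplus> cminus A h (e \<boxdot> h))"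
  shows "e N \<in> carrier A \<and> norm_asymp m (\<lambda>k. \<theta> k (e N)) (\<lambda>k. approx_unit (m k) (H k) N)"
proof (induction N)
  case 0
  then show ?case by (simp add: e_def hom_zero zero_closed)
next
  case (Suc N)
  then have IH: "e N \<in> carrier A" "norm_asymp m (\<lambda>k. \<theta> k (e N)) (\<lambda>k. approx_unit (m k) (H k) N)"
    by simp_all
  have eS: "e (Suc N) = e N \<boxplus> cminus A h (e N \<boxdot> h)" by (simp add: e_def)
  have "norm_asymp m (\<lambda>k. \<theta> k (e (Suc N))) (\<lambda>k. \<theta> k (e N) + \<theta> k (cminus A h (e N \<boxdot> h)))"
    unfolding eS using IH h by (intro hom_add minus_closed closed)
  also have "norm_asymp m \<dots> (\<lambda>k. \<theta> k (e N) + (\<theta> k h - \<theta> k (e N \<boxdot> h)))"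
    using IH h by (intro norm_asymp_add hom_minus norm_asymp_refl hom_closed closed)
  also have "norm_asymp m \<dots> (\<lambda>k. \<theta> k (e N) + (\<theta> k h - \<theta> k (e N) * \<theta> k h))"
    using IH h by (intro norm_asymp_add norm_asymp_minus hom_mult norm_asymp_refl hom_closed closed)
  also have "norm_asymp m \<dots> (\<lambda>k. approx_unit (m k) (H k) N + (H k - approx_unit (m k) (H k) N * H k))"
    by (intro norm_asymp_add norm_asymp_minus norm_asymp_mult IH H)
  finally show ?case using IH h by (simp add: eS minus_closed closed)
qed

text \<open>
  Both \<open>F\<^sub>i\<close> and \<open>F\<^sub>i\<^sup>*\<close> have to be absorbed by \<open>e\<close> from the right, so both contribute to \<open>h\<close>. The
  maps carry \<open>h\<close> asymptotically to a matrix \<open>H\<close> as in \<open>gram_sum_properties\<close>, and \<open>e\<close> to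
  \<open>1 - (1 - H)\<^sup>2\<^sup>M\<close>, which is a contraction and an approximate unit for large \<open>M\<close>.
\<close>

theorem approximate_compression:
  fixes F :: "nat \<Rightarrow> 'a"
  assumes F: "\<And>i. i < r \<Longrightarrow> F i \<in> carrier A" and eps: "0 < \<epsilon>"
  obtains e where "e \<in> carrier A"
    "\<forall>\<^sub>F k in sequentially. op_norm (\<theta> k (cstar A e \<boxdot> e)) \<le> 1 + \<epsilon> \<and>
       (\<forall>i<r. op_norm (\<theta> k (cstar A e \<boxdot> (F i \<boxdot> e)) - \<theta> k (F i)) \<le> \<epsilon>)"
proof -
  \<comment> \<open>the elements to be absorbed, followed by their adjoints; \<open>Y\<close> are their images, with exact adjoints\<close>
  define y where "y i = (if i < r then F i else cstar A (F (i - r)))" for i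
  define Y where "Y k i = (if i < r then \<theta> k (F i) else mat_adjoint (\<theta> k (F (i - r))))" for k i
  have y: "y i \<in> carrier A" if "i < r + r" for i using that F by (auto simp: y_def closed)
  have yY: "norm_asymp m (\<lambda>k. \<theta> k (y i)) (\<lambda>k. Y k i)" if "i < r + r" for i
  proof (cases "i < r")
    case True
    then show ?thesis using F by (simp add: y_def Y_def norm_asymp_refl hom_closed)
  next
    case False
    then have "i - r < r" using that by simp
    then show ?thesis using False F by (simp add: y_def Y_def hom_star)
  qed
  have "\<forall>i. \<exists>C. i < r + r \<longrightarrow> (\<forall>k. op_norm (Y k i) \<le> C)"
    using norm_asympD(2)[OF yY] prod_mat_bounded by meson
  then obtain C where C: "\<And>i k. i < r + r \<Longrightarrow> op_norm (Y k i) \<le> C i" by metis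
  define S where "S = (\<Sum>i<r + r. (C i)\<^sup>2)"
  define c where "c = 1 / (1 + S)"
  have S: "0 \<le> S" by (simp add: S_def sum_nonneg)
  then have c: "0 < c" "0 \<le> c" "c * S \<le> 1" by (auto simp: c_def divide_simps)
  define h where "h = complex_of_real c \<triangleright> csum A (\<lambda>i. cstar A (y i) \<boxdot> y i) (r + r)"
  define H where "H k = complex_of_real c \<cdot>\<^sub>m csum (matrix_algebra (m k)) (\<lambda>i. mat_adjoint (Y k i) * Y k i) (r + r)" for k
  have sum: "norm_asymp m (\<lambda>k. \<theta> k (csum A (\<lambda>i. cstar A (y i) \<boxdot> y i) (r + r)))
      (\<lambda>k. csum (matrix_algebra (m k)) (\<lambda>i. mat_adjoint (Y k i) * Y k i) (r + r))
    \<and> csum A (\<lambda>i. cstar A (y i) \<boxdot> y i) (r + r) \<in> carrier A"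
  proof (rule hom_csum)
    fix i assume i: "i < r + r"
    show "cstar A (y i) \<boxdot> y i \<in> carrier A" using y[OF i] by (simp add: closed)
    have "norm_asymp m (\<lambda>k. \<theta> k (cstar A (y i) \<boxdot> y i)) (\<lambda>k. \<theta> k (cstar A (y i)) * \<theta> k (y i))"
      using y[OF i] by (intro hom_mult closed)
    also have "norm_asymp m \<dots> (\<lambda>k. mat_adjoint (\<theta> k (y i)) * \<theta> k (y i))"
      using y[OF i] by (intro norm_asymp_mult hom_star norm_asymp_refl hom_closed)
    also have "norm_asymp m \<dots> (\<lambda>k. mat_adjoint (Y k i) * Y k i)"
      by (intro norm_asymp_mult norm_asymp_star yY i)
    finally show "norm_asymp m (\<lambda>k. \<theta> k (cstar A (y i) \<boxdot> y i)) (\<lambda>k. mat_adjoint (Y k i) * Y k i)" .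
  qed
  have h: "h \<in> carrier A" using sum by (simp add: h_def closed)
  have hH: "norm_asymp m (\<lambda>k. \<theta> k h) H"
    unfolding h_def H_def
    by (rule norm_asymp_trans[OF hom_scale norm_asymp_scale]) (use sum in auto)
  have Yc: "Y k i \<in> carrier_mat (m k) (m k)" if "i < r + r" for k i
    using norm_asympD(2)[OF yY[OF that]] by (rule prod_mat_carrier)
  have cS: "c * (\<Sum>i<r + r. (C i)\<^sup>2) \<le> 1" using c by (simp add: S_def)
  note gram = gram_sum_properties[of "r + r" "Y k" "m k" C c for k, OF Yc C c(2) cS, folded H_def]
  \<comment> \<open>large enough for the two error terms of \<open>compression_error\<close> to add up to at most \<open>\<epsilon> / 2\<close>\<close>
  obtain M where M: "16 / (c * \<epsilon>\<^sup>2) < real M" using reals_Archimedean2 by blast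
  have "0 \<le> 16 / (c * \<epsilon>\<^sup>2)" using c by simp
  then have M0: "0 < M" using M by (cases M) auto
  have small: "1 / sqrt (c * real (M + M)) \<le> \<epsilon> / 4"
  proof -
    have "16 < real M * (c * \<epsilon>\<^sup>2)" using M c eps by (simp add: pos_divide_less_eq)
    also have "\<dots> \<le> c * real (M + M) * \<epsilon>\<^sup>2" using c by (simp add: algebra_simps)
    finally have "sqrt 16 \<le> sqrt (c * real (M + M) * \<epsilon>\<^sup>2)" by (intro real_sqrt_le_mono) simp
    then have "4 \<le> sqrt (c * real (M + M)) * \<epsilon>" using eps by (simp add: real_sqrt_mult)
    moreover have "0 < sqrt (c * real (M + M))" using c M0 by simp
    ultimately show ?thesis by (simp add: divide_simps mult.commute)
  qed
  define e where "e = rec_nat (czero A) (\<lambda>_ e. e \<boxplus> cminus A h (e \<boxdot> h)) (M + M)"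
  define E where "E k = approx_unit (m k) (H k) (M + M)" for k
  have e: "e \<in> carrier A" and eE: "norm_asymp m (\<lambda>k. \<theta> k e) E"
    using hom_approx_unit[OF h hH, of "M + M"] unfolding e_def E_def by blast+
  have Ec: "E k \<in> carrier_mat (m k) (m k)" for k unfolding E_def by (intro approx_unit_carrier gram)
  have E1: "op_norm (E k) \<le> 1" for k unfolding E_def by (intro approx_unit_norm gram)
  have err: "op_norm (Y k i - Y k i * E k) \<le> \<epsilon> / 4" if i: "i < r + r" for k i
    unfolding E_def using M0
    by (intro order_trans[OF approx_unit_error[of _ _ _ c] small] gram Yc c i) auto
  have e_star: "norm_asymp m (\<lambda>k. \<theta> k (cstar A e)) (\<lambda>k. mat_adjoint (E k))"
    using hom_star[OF e] norm_asymp_star[OF eE] by (rule norm_asymp_trans)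
  have "\<forall>\<^sub>F k in sequentially. op_norm (\<theta> k (cstar A e \<boxdot> e)) < 1 + \<epsilon>"
  proof (rule norm_asymp_eventually_less)
    show "norm_asymp m (\<lambda>k. \<theta> k (cstar A e \<boxdot> e)) (\<lambda>k. mat_adjoint (E k) * E k)"
      by (rule norm_asymp_trans[OF hom_mult norm_asymp_mult[OF e_star eE]]) (use e in \<open>auto simp: closed\<close>)
    have "op_norm (mat_adjoint (E k) * E k) \<le> op_norm (E k) * op_norm (E k)" for k
      using op_norm_mult[of "mat_adjoint (E k)" "m k" "m k" "E k" "m k"] Ec[of k] by (simp add: op_norm_adjoint)
    also have "op_norm (E k) * op_norm (E k) \<le> 1" for k using E1[of k] by (simp add: mult_le_one)
    finally show "\<forall>\<^sub>F k in sequentially. op_norm (mat_adjoint (E k) * E k) \<le> 1" by simp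
  qed (use eps in simp)
  moreover have "\<forall>\<^sub>F k in sequentially. op_norm (\<theta> k (cstar A e \<boxdot> (F i \<boxdot> e)) - \<theta> k (F i)) < \<epsilon>" if i: "i < r" for i
  proof (rule norm_asymp_eventually_less)
    have "norm_asymp m (\<lambda>k. \<theta> k (cstar A e \<boxdot> (F i \<boxdot> e))) (\<lambda>k. \<theta> k (cstar A e) * \<theta> k (F i \<boxdot> e))"
      using e F[OF i] by (intro hom_mult closed)
    also have "norm_asymp m \<dots> (\<lambda>k. \<theta> k (cstar A e) * (\<theta> k (F i) * \<theta> k e))"
      using e F[OF i] by (intro norm_asymp_mult hom_mult norm_asymp_refl hom_closed closed)
    also have "norm_asymp m \<dots> (\<lambda>k. mat_adjoint (E k) * (\<theta> k (F i) * E k))"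
      using F[OF i] by (intro norm_asymp_mult e_star eE norm_asymp_refl hom_closed)
    finally show "norm_asymp m (\<lambda>k. \<theta> k (cstar A e \<boxdot> (F i \<boxdot> e)) - \<theta> k (F i))
        (\<lambda>k. mat_adjoint (E k) * (\<theta> k (F i) * E k) - \<theta> k (F i))"
      using F[OF i] by (intro norm_asymp_minus norm_asymp_refl hom_closed)
    have "op_norm (mat_adjoint (E k) * (\<theta> k (F i) * E k) - \<theta> k (F i)) \<le> \<epsilon> / 4 + \<epsilon> / 4" for k
      using compression_error[OF hom_carrier_mat[OF F[OF i]] Ec E1, of k] err[of i k] err[of "r + i" k] i
      by (simp add: Y_def)
    then show "\<forall>\<^sub>F k in sequentially. op_norm (mat_adjoint (E k) * (\<theta> k (F i) * E k) - \<theta> k (F i)) \<le> \<epsilon> / 2"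
      by simp
  qed (use eps in simp)
  then have "\<forall>\<^sub>F k in sequentially. \<forall>i\<in>{..<r}. op_norm (\<theta> k (cstar A e \<boxdot> (F i \<boxdot> e)) - \<theta> k (F i)) < \<epsilon>"
    by (intro eventually_ball_finite) auto
  ultimately have "\<forall>\<^sub>F k in sequentially. op_norm (\<theta> k (cstar A e \<boxdot> e)) \<le> 1 + \<epsilon> \<and>
       (\<forall>i<r. op_norm (\<theta> k (cstar A e \<boxdot> (F i \<boxdot> e)) - \<theta> k (F i)) \<le> \<epsilon>)"
    by eventually_elim (auto intro: less_imp_le)
  then show thesis by (rule that[OF e])
qed

text \<open>
  The \<open>j\<close>-th map is the compression by an element \<open>e\<^sub>j\<close> which is nearly a unit for the first \<open>j\<close>
  members of the dense sequence, applied at an index so late that the asymptotic estimates of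
  \<open>approximate_compression\<close> hold with error \<open>1 / (j + 1)\<close>. Asymptotic equality spreads from the dense
  sequence to \<open>A\<close> because one side is contractive and the other asymptotically contractive.
\<close>

theorem ccp_approximation:
  fixes d :: "nat \<Rightarrow> 'a"
  assumes cp: "\<And>k. cp_map A (matrix_algebra (m k)) (\<theta> k)"
    and d: "\<And>i. d i \<in> carrier A"
    and dense: "\<And>a \<epsilon>. a \<in> carrier A \<Longrightarrow> 0 < \<epsilon> \<Longrightarrow> \<exists>i. cnorm A (cminus A a (d i)) < \<epsilon>"
  obtains \<kappa> :: "nat \<Rightarrow> nat" and \<phi> where "filterlim \<kappa> sequentially sequentially"
    "\<And>j. ccp_map A (matrix_algebra (m (\<kappa> j))) (\<phi> j)"
    "\<And>a. a \<in> carrier A \<Longrightarrow> norm_asymp (\<lambda>j. m (\<kappa> j)) (\<lambda>j. \<phi> j a) (\<lambda>j. \<theta> (\<kappa> j) a)"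
proof -
  define \<epsilon> where "\<epsilon> j = 1 / real (Suc j)" for j
  have eps: "0 < \<epsilon> j" for j by (simp add: \<epsilon>_def)
  have "\<exists>e k. e \<in> carrier A \<and> j \<le> k \<and> op_norm (\<theta> k (cstar A e \<boxdot> e)) \<le> 1 + \<epsilon> j \<and>
       (\<forall>i<j. op_norm (\<theta> k (cstar A e \<boxdot> (d i \<boxdot> e)) - \<theta> k (d i)) \<le> \<epsilon> j)" for j
  proof -
    obtain e where e: "e \<in> carrier A" "\<forall>\<^sub>F k in sequentially. op_norm (\<theta> k (cstar A e \<boxdot> e)) \<le> 1 + \<epsilon> j \<and>
       (\<forall>i<j. op_norm (\<theta> k (cstar A e \<boxdot> (d i \<boxdot> e)) - \<theta> k (d i)) \<le> \<epsilon> j)"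
      using approximate_compression[of j d, OF d eps] by blast
    then show ?thesis using eventually_subseq_ex[OF e(2), of j] by blast
  qed
  then obtain e \<kappa> where e: "\<And>j. e j \<in> carrier A" and \<kappa>: "\<And>j. j \<le> \<kappa> j"
    and e1: "\<And>j. op_norm (\<theta> (\<kappa> j) (cstar A (e j) \<boxdot> e j)) \<le> 1 + \<epsilon> j"
    and ed: "\<And>j i. i < j \<Longrightarrow> op_norm (\<theta> (\<kappa> j) (cstar A (e j) \<boxdot> (d i \<boxdot> e j)) - \<theta> (\<kappa> j) (d i)) \<le> \<epsilon> j"
    by metis
  have lim: "filterlim \<kappa> sequentially sequentially"
    by (rule filterlim_at_top_mono[OF filterlim_ident]) (simp add: \<kappa>)
  \<comment> \<open>the compression has norm at most \<open>1 + \<epsilon> j\<close>\<close>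
  define \<phi> where "\<phi> j a = complex_of_real (1 / (1 + \<epsilon> j)) \<cdot>\<^sub>m \<theta> (\<kappa> j) (cstar A (e j) \<boxdot> (a \<boxdot> e j))" for j a
  have K: "0 < 1 + \<epsilon> j" for j using eps[of j] by simp
  have raw: "op_norm (\<theta> (\<kappa> j) (cstar A (e j) \<boxdot> (a \<boxdot> e j))) \<le> (1 + \<epsilon> j) * cnorm A a" if "a \<in> carrier A" for j a
    by (rule cp_map_compression_bound[OF cp e that K e1])
  have cc: "cstar A (e j) \<boxdot> (a \<boxdot> e j) \<in> carrier A" if "a \<in> carrier A" for a j
    using e[of j] that by (simp add: closed)
  have ccp: "ccp_map A (matrix_algebra (m (\<kappa> j))) (\<phi> j)" for j
    unfolding ccp_map_def
  proof (intro conjI ballI)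
    show "cp_map A (matrix_algebra (m (\<kappa> j))) (\<phi> j)"
      unfolding \<phi>_def using K[of j] by (intro cp_map_compression cp e) simp
    fix a assume a: "a \<in> carrier A"
    have "op_norm (\<phi> j a) = op_norm (\<theta> (\<kappa> j) (cstar A (e j) \<boxdot> (a \<boxdot> e j))) / (1 + \<epsilon> j)"
      unfolding \<phi>_def op_norm_smult[OF hom_carrier_mat[OF cc[OF a]]] using K[of j] by (simp only: norm_of_real) simp
    also have "\<dots> \<le> cnorm A a" using raw[OF a, of j] K[of j] by (simp add: pos_divide_le_eq mult.commute)
    finally show "cnorm (matrix_algebra (m (\<kappa> j))) (\<phi> j a) \<le> cnorm A a" by simp
  qed
  have \<phi>c: "\<phi> j a \<in> carrier_mat (m (\<kappa> j)) (m (\<kappa> j))" if "a \<in> carrier A" for j a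
    using hom_carrier_mat[OF cc[OF that]] by (simp add: \<phi>_def)
  have \<phi>le: "op_norm (\<phi> j a) \<le> cnorm A a" if "a \<in> carrier A" for j a
    using ccp[of j] that by (simp add: ccp_map_def)
  interpret sub: matrix_asymptotic_hom A "\<lambda>j. m (\<kappa> j)" "\<lambda>j. \<theta> (\<kappa> j)"
    by unfold_locales (rule asymptotic_hom_subseq[OF asymptotic_hom lim])
  have eps0: "\<epsilon> \<longlonglongrightarrow> 0" unfolding \<epsilon>_def by (rule LIMSEQ_Suc[OF lim_1_over_n])
  have on_dense: "\<forall>\<^sub>F j in sequentially. op_norm (\<phi> j (d i) - \<theta> (\<kappa> j) (d i)) < \<delta>" if \<delta>: "0 < \<delta>" for i \<delta>
  proof -
    have "(\<lambda>j. \<epsilon> j * (cnorm A (d i) + 1)) \<longlonglongrightarrow> 0 * (cnorm A (d i) + 1)"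
      by (intro tendsto_intros eps0)
    then have "\<forall>\<^sub>F j in sequentially. \<epsilon> j * (cnorm A (d i) + 1) < \<delta>"
      using \<delta> by (intro order_tendstoD(2)) auto
    then show ?thesis using eventually_gt_at_top[of i]
    proof eventually_elim
      case (elim j)
      let ?R = "\<theta> (\<kappa> j) (cstar A (e j) \<boxdot> (d i \<boxdot> e j))"
      have R: "?R \<in> carrier_mat (m (\<kappa> j)) (m (\<kappa> j))" by (rule hom_carrier_mat[OF cc[OF d]])
      have "?R - \<phi> j (d i) = complex_of_real (\<epsilon> j / (1 + \<epsilon> j)) \<cdot>\<^sub>m ?R"
      proof -
        have "\<epsilon> j / (1 + \<epsilon> j) = 1 - 1 / (1 + \<epsilon> j)" using K[of j] by (simp add: field_simps)
        then have "complex_of_real (\<epsilon> j / (1 + \<epsilon> j)) = 1 - complex_of_real (1 / (1 + \<epsilon> j))"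
          by (simp only: of_real_diff of_real_1)
        then show ?thesis unfolding \<phi>_def using mat_minus_smult[OF R] by simp
      qed
      then have "op_norm (?R - \<phi> j (d i)) = \<epsilon> j / (1 + \<epsilon> j) * op_norm ?R"
        using op_norm_smult[OF R, of "complex_of_real (\<epsilon> j / (1 + \<epsilon> j))"] eps[of j] by (simp only: norm_of_real) simp
      also have "\<dots> \<le> \<epsilon> j / (1 + \<epsilon> j) * ((1 + \<epsilon> j) * cnorm A (d i))"
        using eps[of j] by (intro mult_left_mono raw d) simp
      also have "\<dots> = \<epsilon> j * cnorm A (d i)" using K[of j] by simp
      finally have "op_norm (\<phi> j (d i) - ?R) \<le> \<epsilon> j * cnorm A (d i)"
        using op_norm_minus_commute[OF R \<phi>c[OF d]] by simp
      then have "op_norm (\<phi> j (d i) - \<theta> (\<kappa> j) (d i)) \<le> \<epsilon> j * cnorm A (d i) + \<epsilon> j"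
        using op_norm_minus_triangle[OF \<phi>c[OF d[of i]] R hom_carrier_mat[OF d[of i]]] ed[OF elim(2)]
        by linarith
      then show ?case using elim(1) by (simp add: algebra_simps)
    qed
  qed
  have "norm_asymp (\<lambda>j. m (\<kappa> j)) (\<lambda>j. \<phi> j a) (\<lambda>j. \<theta> (\<kappa> j) a)" if a: "a \<in> carrier A" for a
    unfolding norm_asymp_def
  proof (intro conjI)
    show "(\<lambda>j. \<phi> j a) \<in> carrier (prod_mat (\<lambda>j. m (\<kappa> j)))"
      by (rule prod_matI[OF \<phi>c[OF a] \<phi>le[OF a]])
    show "(\<lambda>j. \<theta> (\<kappa> j) a) \<in> carrier (prod_mat (\<lambda>j. m (\<kappa> j)))" by (rule sub.hom_closed[OF a])
    show "(\<lambda>j. op_norm (\<phi> j a - \<theta> (\<kappa> j) a)) \<longlonglongrightarrow> 0"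
    proof (rule order_tendstoI)
      fix \<delta> :: real assume \<delta>: "0 < \<delta>"
      obtain i where i: "cnorm A (cminus A a (d i)) < \<delta> / 3" using dense[OF a, of "\<delta> / 3"] \<delta> by auto
      have i': "cnorm A (cminus A (d i) a) < \<delta> / 3" using i norm_minus_commute[OF a d] by simp
      have "0 < \<delta> / 3" using \<delta> by simp
      from on_dense[OF this, of i] sub.hom_dist[OF d a i']
      show "\<forall>\<^sub>F j in sequentially. op_norm (\<phi> j a - \<theta> (\<kappa> j) a) < \<delta>"
      proof eventually_elim
        case (elim j)
        have "\<phi> j a - \<phi> j (d i) = \<phi> j (cminus A a (d i))"
          using clinear_mapD[OF cp_map_linear, of A "matrix_algebra (m (\<kappa> j))" "\<phi> j"] ccp[of j] a d \<phi>c[OF a] \<phi>c[OF d]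
          by (simp add: ccp_map_def cminus_def closed mat_minus_eq[of _ "m (\<kappa> j)"])
        then have "op_norm (\<phi> j a - \<phi> j (d i)) < \<delta> / 3"
          using \<phi>le[OF minus_closed[OF a d], of j i] i by simp
        moreover have "op_norm (\<phi> j a - \<theta> (\<kappa> j) a) \<le> op_norm (\<phi> j a - \<phi> j (d i)) + op_norm (\<phi> j (d i) - \<theta> (\<kappa> j) a)"
          by (intro op_norm_minus_triangle[of _ "m (\<kappa> j)"] \<phi>c a d hom_carrier_mat)
        moreover have "op_norm (\<phi> j (d i) - \<theta> (\<kappa> j) a)
            \<le> op_norm (\<phi> j (d i) - \<theta> (\<kappa> j) (d i)) + op_norm (\<theta> (\<kappa> j) (d i) - \<theta> (\<kappa> j) a)"
          by (intro op_norm_minus_triangle[of _ "m (\<kappa> j)"] \<phi>c a d hom_carrier_mat)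
        ultimately show ?case using elim by linarith
      qed
    next
      fix \<delta> :: real assume "\<delta> < 0"
      then show "\<forall>\<^sub>F j in sequentially. \<delta> < op_norm (\<phi> j a - \<theta> (\<kappa> j) a)"
        by (intro always_eventually allI less_le_trans[OF _ op_norm_nonneg])
    qed
  qed
  then show thesis using that[OF lim ccp] by blast
qed

theorem quasidiagonal_trace_of_cp:
  fixes d :: "nat \<Rightarrow> 'a"
  assumes cp: "\<And>k. cp_map A (matrix_algebra (m k)) (\<theta> k)"
    and d: "\<And>i. d i \<in> carrier A"
    and dense: "\<And>a \<epsilon>. a \<in> carrier A \<Longrightarrow> 0 < \<epsilon> \<Longrightarrow> \<exists>i. cnorm A (cminus A a (d i)) < \<epsilon>"
    and m: "\<And>k. 0 < m k" and \<tau>: "is_trace A \<tau>"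
    and trace: "\<And>a. a \<in> carrier A \<Longrightarrow> (\<lambda>k. ntr (\<theta> k a)) \<longlonglongrightarrow> \<tau> a"
  shows "quasidiagonal_trace A \<tau>"
proof -
  obtain \<kappa> \<phi> where lim: "filterlim \<kappa> sequentially sequentially"
    and ccp: "\<And>j. ccp_map A (matrix_algebra (m (\<kappa> j))) (\<phi> j)"
    and \<phi>: "\<And>a. a \<in> carrier A \<Longrightarrow> norm_asymp (\<lambda>j. m (\<kappa> j)) (\<lambda>j. \<phi> j a) (\<lambda>j. \<theta> (\<kappa> j) a)"
    using ccp_approximation[OF cp d dense] by blast
  interpret sub: matrix_asymptotic_hom A "\<lambda>j. m (\<kappa> j)" "\<lambda>j. \<theta> (\<kappa> j)"
    by unfold_locales (rule asymptotic_hom_subseq[OF asymptotic_hom lim])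
  show ?thesis
    unfolding quasidiagonal_trace_def
  proof (intro conjI exI)
    show "\<forall>n. 0 < m (\<kappa> n)" using m by simp
    show "\<forall>n. ccp_map A (matrix_algebra (m (\<kappa> n))) (\<phi> n)" using ccp by simp
    show "asymptotically_multiplicative A (\<lambda>n. matrix_algebra (m (\<kappa> n))) \<phi>"
      unfolding asymptotically_multiplicative_def
    proof (intro ballI)
      fix a b assume ab: "a \<in> carrier A" "b \<in> carrier A"
      have "norm_asymp (\<lambda>j. m (\<kappa> j)) (\<lambda>j. \<phi> j (a \<boxdot> b)) (\<lambda>j. \<theta> (\<kappa> j) (a \<boxdot> b))"
        using ab by (intro \<phi> closed)
      also have "norm_asymp (\<lambda>j. m (\<kappa> j)) \<dots> (\<lambda>j. \<theta> (\<kappa> j) a * \<theta> (\<kappa> j) b)" using ab by (rule sub.hom_mult)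
      also have "norm_asymp (\<lambda>j. m (\<kappa> j)) \<dots> (\<lambda>j. \<phi> j a * \<phi> j b)"
        using ab by (intro norm_asymp_mult norm_asymp_sym[OF \<phi>])
      finally have "norm_asymp (\<lambda>j. m (\<kappa> j)) (\<lambda>j. \<phi> j (a \<boxdot> b)) (\<lambda>j. \<phi> j a * \<phi> j b)" .
      note D = norm_asympD[OF this]
      show "(\<lambda>k. cnorm (matrix_algebra (m (\<kappa> k))) (cminus (matrix_algebra (m (\<kappa> k))) (\<phi> k (a \<boxdot> b))
                (\<phi> k a \<boxdot>\<^bsub>matrix_algebra (m (\<kappa> k))\<^esub> \<phi> k b))) \<longlonglongrightarrow> 0"
        using D(3) prod_mat_carrier[OF D(1)] prod_mat_carrier[OF D(2)] by (simp add: matrix_algebra_minus)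
    qed
    show "\<forall>a\<in>carrier A. (\<lambda>n. cmod (\<tau> a - ntr (\<phi> n a))) \<longlonglongrightarrow> 0"
    proof
      fix a assume a: "a \<in> carrier A"
      have "(\<lambda>j. ntr (\<phi> j a)) \<longlonglongrightarrow> \<tau> a"
        by (rule ntr_norm_asymp[OF \<phi>[OF a] filterlim_compose[OF trace[OF a] lim]])
      from tendsto_norm_zero[OF tendsto_diff[OF tendsto_const this, of "\<tau> a", simplified]]
      show "(\<lambda>n. cmod (\<tau> a - ntr (\<phi> n a))) \<longlonglongrightarrow> 0" .
    qed
  qed (rule \<tau>)
qed

end

section \<open>Limits along free ultrafilters\<close>

text \<open>
  An ultrafilter containing a singleton is principal, so this one contains the complements of
  all singletons, and hence of all finite sets.
\<close>

lemma nontrivial_ultrafilter_le_sequentially: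
  assumes "nontrivial_ultrafilter \<omega>" shows "\<omega> \<le> sequentially"
proof -
  have ne: "\<omega> \<noteq> bot" and ultra: "\<And>P. eventually P \<omega> \<or> eventually (\<lambda>n. \<not> P n) \<omega>"
    and free: "\<And>n. \<omega> \<noteq> principal {n}"
    using assms by (auto simp: nontrivial_ultrafilter_def)
  have "eventually (\<lambda>n. n \<noteq> k) \<omega>" for k
  proof (rule ccontr)
    assume "\<not> eventually (\<lambda>n. n \<noteq> k) \<omega>"
    then have k: "eventually (\<lambda>n. n = k) \<omega>" using ultra[of "\<lambda>n. n \<noteq> k"] by simp
    have "\<omega> = principal {k}"
    proof (rule filter_eq_iff[THEN iffD2], intro allI iffI)
      fix P assume "eventually P \<omega>"
      with k have "eventually (\<lambda>_. P k) \<omega>" by eventually_elim auto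
      then show "eventually P (principal {k})" using ne by (auto simp: eventually_principal eventually_const)
    next
      fix P assume "eventually P (principal {k})"
      then have "P k" by (simp add: eventually_principal)
      with k show "eventually P \<omega>" by (auto elim: eventually_mono)
    qed
    then show False using free by blast
  qed
  then have avoid: "eventually (\<lambda>n. \<forall>k\<in>{..<N}. n \<noteq> k) \<omega>" for N
    by (intro eventually_ball_finite) auto
  have "eventually (\<lambda>n. N \<le> n) \<omega>" for N
    by (rule eventually_mono[OF avoid[of N]]) (auto simp flip: not_less)
  then show ?thesis
    unfolding le_filter_def eventually_sequentially by (metis eventually_mono)
qed

text \<open>
  Compactness of a disc yields a cluster point, and for an ultrafilter a cluster point is a limit.
\<close>

lemma ultrafilter_bounded_limit:
  fixes u :: "nat \<Rightarrow> complex"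
  assumes "nontrivial_ultrafilter \<omega>" and "\<And>n. cmod (u n) \<le> C"
  obtains c where "(u \<longlongrightarrow> c) \<omega>"
proof -
  have ne: "\<omega> \<noteq> bot" and ultra: "\<And>P. eventually P \<omega> \<or> eventually (\<lambda>n. \<not> P n) \<omega>"
    using assms(1) by (auto simp: nontrivial_ultrafilter_def)
  have "\<exists>x\<in>cball 0 C. inf (nhds x) (filtermap u \<omega>) \<noteq> bot"
    using compact_cball[of "0 :: complex" C] unfolding compact_filter
    by (elim allE[of _ "filtermap u \<omega>"])
      (auto simp: filtermap_bot_iff ne eventually_filtermap assms(2))
  then obtain c where c: "inf (nhds c) (filtermap u \<omega>) \<noteq> bot" by blast
  have "(u \<longlongrightarrow> c) \<omega>"
  proof (rule topological_tendstoI)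
    fix S assume S: "open S" "c \<in> S"
    show "\<forall>\<^sub>F n in \<omega>. u n \<in> S"
    proof (rule ccontr)
      assume "\<not> (\<forall>\<^sub>F n in \<omega>. u n \<in> S)"
      then have "eventually (\<lambda>z. z \<notin> S) (filtermap u \<omega>)"
        using ultra[of "\<lambda>n. u n \<in> S"] by (simp add: eventually_filtermap)
      moreover have "eventually (\<lambda>z. z \<in> S) (nhds c)" using S by (rule eventually_nhds_in_open)
      ultimately have "eventually (\<lambda>_. False) (inf (nhds c) (filtermap u \<omega>))"
        unfolding eventually_inf by blast
      then show False using c by (simp add: eventually_False)
    qed
  qed
  then show thesis by (rule that)
qed

section \<open>The tracial quotient\<close>

lemma tracial_idealD:
  assumes "T \<in> tracial_ideal m \<omega>"
  shows "T \<in> carrier (prod_mat m)" "((\<lambda>n. norm2 (T n)) \<longlongrightarrow> 0) \<omega>"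
  using assms by (auto simp: tracial_ideal_def)

lemma tracial_idealI:
  assumes T: "T \<in> carrier (prod_mat m)" and "\<And>n. norm2 (T n) \<le> u n" and "(u \<longlongrightarrow> 0) \<omega>"
  shows "T \<in> tracial_ideal m \<omega>"
proof -
  have "((\<lambda>n. norm2 (T n)) \<longlongrightarrow> 0) \<omega>"
    by (rule Lim_null_comparison[OF always_eventually assms(3)])
      (use assms(2) norm2_nonneg[OF prod_mat_carrier[OF T]] in auto)
  then show ?thesis using T by (simp add: tracial_ideal_def)
qed

lemma tracial_ideal_zero: "(\<lambda>n. 0\<^sub>m (m n) (m n)) \<in> tracial_ideal m \<omega>"
  by (rule tracial_idealI[OF prod_mat_zero_closed, of _ "\<lambda>_. 0"]) (auto simp: norm2_zero)

lemma tracial_ideal_add: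
  assumes S: "S \<in> tracial_ideal m \<omega>" and T: "T \<in> tracial_ideal m \<omega>"
  shows "(\<lambda>n. S n + T n) \<in> tracial_ideal m \<omega>"
proof (rule tracial_idealI)
  show "norm2 (S n + T n) \<le> norm2 (S n) + norm2 (T n)" for n
    using assms by (intro norm2_add[of _ "m n"] prod_mat_carrier) (auto dest: tracial_idealD)
  show "((\<lambda>n. norm2 (S n) + norm2 (T n)) \<longlongrightarrow> 0) \<omega>"
    using tendsto_add[OF tracial_idealD(2)[OF S] tracial_idealD(2)[OF T]] by simp
qed (use assms in \<open>auto dest: tracial_idealD intro: prod_mat_closed\<close>)

lemma tracial_ideal_scale:
  assumes T: "T \<in> tracial_ideal m \<omega>" shows "(\<lambda>n. c \<cdot>\<^sub>m T n) \<in> tracial_ideal m \<omega>"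
proof (rule tracial_idealI)
  show "norm2 (c \<cdot>\<^sub>m T n) \<le> cmod c * norm2 (T n)" for n
    using norm2_smult[OF prod_mat_carrier[OF tracial_idealD(1)[OF T]]] by simp
  show "((\<lambda>n. cmod c * norm2 (T n)) \<longlongrightarrow> 0) \<omega>"
    using tendsto_mult_left[OF tracial_idealD(2)[OF T], of "cmod c"] by simp
qed (use assms in \<open>auto dest: tracial_idealD intro: prod_mat_closed\<close>)

lemma tracial_ideal_star:
  assumes T: "T \<in> tracial_ideal m \<omega>" shows "(\<lambda>n. mat_adjoint (T n)) \<in> tracial_ideal m \<omega>"
proof (rule tracial_idealI)
  show "norm2 (mat_adjoint (T n)) \<le> norm2 (T n)" for n
    using norm2_adjoint[OF prod_mat_carrier[OF tracial_idealD(1)[OF T]]] by simp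
qed (use tracial_idealD[OF T] in \<open>auto intro: prod_mat_closed\<close>)

lemma tracial_ideal_mult_left:
  assumes X: "X \<in> carrier (prod_mat m)" and T: "T \<in> tracial_ideal m \<omega>"
  shows "(\<lambda>n. X n * T n) \<in> tracial_ideal m \<omega>"
proof -
  obtain C where C: "\<And>n. op_norm (X n) \<le> C" using prod_mat_bounded[OF X] by blast
  note Tc = prod_mat_carrier[OF tracial_idealD(1)[OF T]]
  show ?thesis
  proof (rule tracial_idealI)
    show "norm2 (X n * T n) \<le> C * norm2 (T n)" for n
      using norm2_mult_left[OF prod_mat_carrier[OF X] Tc, of n] mult_right_mono[OF C norm2_nonneg[OF Tc], of n n]
      by linarith
    show "((\<lambda>n. C * norm2 (T n)) \<longlongrightarrow> 0) \<omega>"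
      using tendsto_mult_left[OF tracial_idealD(2)[OF T], of C] by simp
  qed (use assms in \<open>auto dest: tracial_idealD intro: prod_mat_closed\<close>)
qed

lemma tracial_ideal_mult_right:
  assumes X: "X \<in> carrier (prod_mat m)" and T: "T \<in> tracial_ideal m \<omega>"
  shows "(\<lambda>n. T n * X n) \<in> tracial_ideal m \<omega>"
proof -
  obtain C where C: "\<And>n. op_norm (X n) \<le> C" using prod_mat_bounded[OF X] by blast
  note Tc = prod_mat_carrier[OF tracial_idealD(1)[OF T]]
  show ?thesis
  proof (rule tracial_idealI)
    show "norm2 (T n * X n) \<le> norm2 (T n) * C" for n
      using norm2_mult_right[OF Tc prod_mat_carrier[OF X], of n] mult_left_mono[OF C norm2_nonneg[OF Tc], of n n]
      by linarith
    show "((\<lambda>n. norm2 (T n) * C) \<longlongrightarrow> 0) \<omega>"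
      using tendsto_mult_right[OF tracial_idealD(2)[OF T], of C] by simp
  qed (use assms in \<open>auto dest: tracial_idealD intro: prod_mat_closed\<close>)
qed

lemma quot_map_mem:
  assumes x: "x \<in> carrier (prod_mat m)"
  shows "z \<in> quot_map m \<omega> x \<longleftrightarrow> z \<in> carrier (prod_mat m) \<and> (\<lambda>n. z n - x n) \<in> tracial_ideal m \<omega>"
proof
  assume "z \<in> quot_map m \<omega> x"
  then obtain t where t: "t \<in> tracial_ideal m \<omega>" "z = (\<lambda>n. x n + t n)"
    by (auto simp: quot_map_def ccoset_def)
  have "x n + t n - x n = t n" for n
    using prod_mat_carrier[OF x, of n] prod_mat_carrier[OF tracial_idealD(1)[OF t(1)], of n]
    by (intro eq_matI) auto
  then show "z \<in> carrier (prod_mat m) \<and> (\<lambda>n. z n - x n) \<in> tracial_ideal m \<omega>"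
    using t x by (auto dest: tracial_idealD intro: prod_mat_closed)
next
  assume z: "z \<in> carrier (prod_mat m) \<and> (\<lambda>n. z n - x n) \<in> tracial_ideal m \<omega>"
  have "z n = x n + (z n - x n)" for n
    using prod_mat_carrier[OF x, of n] prod_mat_carrier[of z m n] z by (intro eq_matI) auto
  then show "z \<in> quot_map m \<omega> x"
    using z unfolding quot_map_def ccoset_def by (intro image_eqI[of _ _ "\<lambda>n. z n - x n"]) auto
qed

lemma quot_map_self: "x \<in> carrier (prod_mat m) \<Longrightarrow> x \<in> quot_map m \<omega> x"
  by (simp add: quot_map_mem minus_r_inv_mat[OF prod_mat_carrier] tracial_ideal_zero)

lemma quot_map_eqI:
  assumes x: "x \<in> carrier (prod_mat m)" and y: "y \<in> carrier (prod_mat m)"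
    and xy: "(\<lambda>n. x n - y n) \<in> tracial_ideal m \<omega>"
  shows "quot_map m \<omega> x = quot_map m \<omega> y"
proof -
  have sub: "quot_map m \<omega> u \<subseteq> quot_map m \<omega> v"
    if u: "u \<in> carrier (prod_mat m)" and v: "v \<in> carrier (prod_mat m)"
      and uv: "(\<lambda>n. u n - v n) \<in> tracial_ideal m \<omega>" for u v
  proof
    fix z assume "z \<in> quot_map m \<omega> u"
    then have z: "z \<in> carrier (prod_mat m)" "(\<lambda>n. z n - u n) \<in> tracial_ideal m \<omega>"
      using quot_map_mem[OF u] by auto
    have "(z n - u n) + (u n - v n) = z n - v n" for n
      using u v z(1) by (intro mat_minus_chain[symmetric, of _ "m n"] prod_mat_carrier)
    then show "z \<in> quot_map m \<omega> v"
      using tracial_ideal_add[OF z(2) uv] z(1) by (simp add: quot_map_mem[OF v])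
  qed
  have "(-1) \<cdot>\<^sub>m (x n - y n) = y n - x n" for n
    using prod_mat_carrier[OF x, of n] prod_mat_carrier[OF y, of n] by (intro eq_matI) auto
  then have "(\<lambda>n. y n - x n) \<in> tracial_ideal m \<omega>"
    using tracial_ideal_scale[OF xy, of "-1"] by simp
  then show ?thesis using sub[OF x y xy] sub[OF y x] by blast
qed

lemma norm_asymp_quot_map_eq:
  assumes XY: "norm_asymp m X Y" and \<omega>: "\<omega> \<le> sequentially"
  shows "quot_map m \<omega> X = quot_map m \<omega> Y"
proof -
  note c = norm_asympD(1,2)[OF XY]
  have "((\<lambda>n. op_norm (X n - Y n)) \<longlongrightarrow> 0) \<omega>"
    using norm_asympD(3)[OF XY] \<omega> by (rule tendsto_mono[rotated])
  moreover have "norm2 (X n - Y n) \<le> op_norm (X n - Y n)" for n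
    using c by (intro norm2_le_op_norm[of _ "m n"] minus_carrier_mat prod_mat_carrier)
  ultimately have "(\<lambda>n. X n - Y n) \<in> tracial_ideal m \<omega>"
    using c by (intro tracial_idealI[of _ _ "\<lambda>n. op_norm (X n - Y n)"] prod_mat_closed)
  then show ?thesis using c by (intro quot_map_eqI)
qed

lemma tracial_quotient_plus:
  assumes x: "x \<in> carrier (prod_mat m)" and y: "y \<in> carrier (prod_mat m)"
  shows "quot_map m \<omega> x \<boxplus>\<^bsub>tracial_quotient m \<omega>\<^esub> quot_map m \<omega> y = quot_map m \<omega> (\<lambda>n. x n + y n)"
proof -
  have "quot_map m \<omega> (\<lambda>n. x' n + y' n) = quot_map m \<omega> (\<lambda>n. x n + y n)"
    if "x' \<in> quot_map m \<omega> x" "y' \<in> quot_map m \<omega> y" for x' y'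
  proof -
    have c: "x' \<in> carrier (prod_mat m)" "y' \<in> carrier (prod_mat m)"
      and I: "(\<lambda>n. x' n - x n) \<in> tracial_ideal m \<omega>" "(\<lambda>n. y' n - y n) \<in> tracial_ideal m \<omega>"
      using that by (auto simp: quot_map_mem x y)
    have "(x' n - x n) + (y' n - y n) = (x' n + y' n) - (x n + y n)" for n
      using c x y by (intro mat_add_minus_add[symmetric, of _ "m n"] prod_mat_carrier)
    then show ?thesis
      using tracial_ideal_add[OF I] c x y by (intro quot_map_eqI prod_mat_closed) simp_all
  qed
  then show ?thesis
    unfolding tracial_quotient_def quotient_algebra_def
    by (simp flip: quot_map_def) (use quot_map_self[OF x] quot_map_self[OF y] in blast)
qed

lemma tracial_quotient_times:
  assumes x: "x \<in> carrier (prod_mat m)" and y: "y \<in> carrier (prod_mat m)"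
  shows "quot_map m \<omega> x \<boxdot>\<^bsub>tracial_quotient m \<omega>\<^esub> quot_map m \<omega> y = quot_map m \<omega> (\<lambda>n. x n * y n)"
proof -
  have "quot_map m \<omega> (\<lambda>n. x' n * y' n) = quot_map m \<omega> (\<lambda>n. x n * y n)"
    if "x' \<in> quot_map m \<omega> x" "y' \<in> quot_map m \<omega> y" for x' y'
  proof -
    have c: "x' \<in> carrier (prod_mat m)" "y' \<in> carrier (prod_mat m)"
      and I: "(\<lambda>n. x' n - x n) \<in> tracial_ideal m \<omega>" "(\<lambda>n. y' n - y n) \<in> tracial_ideal m \<omega>"
      using that by (auto simp: quot_map_mem x y)
    have "x' n * (y' n - y n) + (x' n - x n) * y n = x' n * y' n - x n * y n" for n
    proof -
      note cn = c[THEN prod_mat_carrier, of n] x[THEN prod_mat_carrier, of n] y[THEN prod_mat_carrier, of n]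
      have "x' n * y' n - x n * y n = (x' n * y' n - x' n * y n) + (x' n * y n - x n * y n)"
        using cn by (intro mat_minus_chain[of _ "m n"] mult_carrier_mat[of _ _ "m n"])
      then show ?thesis using cn
        by (simp add: mult_minus_distrib_mat[of _ "m n" "m n" _ "m n"] minus_mult_distrib_mat[of _ "m n" "m n" _ _ "m n"])
    qed
    then show ?thesis
      using tracial_ideal_add[OF tracial_ideal_mult_left[OF c(1) I(2)] tracial_ideal_mult_right[OF y I(1)]] c x y
      by (intro quot_map_eqI prod_mat_closed) simp_all
  qed
  then show ?thesis
    unfolding tracial_quotient_def quotient_algebra_def
    by (simp flip: quot_map_def) (use quot_map_self[OF x] quot_map_self[OF y] in blast)
qed

lemma tracial_quotient_scale:
  assumes x: "x \<in> carrier (prod_mat m)"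
  shows "c \<triangleright>\<^bsub>tracial_quotient m \<omega>\<^esub> quot_map m \<omega> x = quot_map m \<omega> (\<lambda>n. c \<cdot>\<^sub>m x n)"
proof -
  have "quot_map m \<omega> (\<lambda>n. c \<cdot>\<^sub>m x' n) = quot_map m \<omega> (\<lambda>n. c \<cdot>\<^sub>m x n)" if "x' \<in> quot_map m \<omega> x" for x'
  proof -
    have x': "x' \<in> carrier (prod_mat m)" "(\<lambda>n. x' n - x n) \<in> tracial_ideal m \<omega>"
      using that by (auto simp: quot_map_mem x)
    have "c \<cdot>\<^sub>m (x' n - x n) = c \<cdot>\<^sub>m x' n - c \<cdot>\<^sub>m x n" for n
      using x'(1)[THEN prod_mat_carrier, of n] x[THEN prod_mat_carrier, of n]
      by (intro eq_matI) (auto simp: algebra_simps)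
    then show ?thesis
      using tracial_ideal_scale[OF x'(2), of c] x'(1) x by (intro quot_map_eqI prod_mat_closed) simp_all
  qed
  then show ?thesis
    unfolding tracial_quotient_def quotient_algebra_def
    by (simp flip: quot_map_def) (use quot_map_self[OF x] in blast)
qed

lemma tracial_quotient_star:
  assumes x: "x \<in> carrier (prod_mat m)"
  shows "cstar (tracial_quotient m \<omega>) (quot_map m \<omega> x) = quot_map m \<omega> (\<lambda>n. mat_adjoint (x n))"
proof -
  have "quot_map m \<omega> (\<lambda>n. mat_adjoint (x' n)) = quot_map m \<omega> (\<lambda>n. mat_adjoint (x n))" if "x' \<in> quot_map m \<omega> x" for x'
  proof -
    have x': "x' \<in> carrier (prod_mat m)" "(\<lambda>n. x' n - x n) \<in> tracial_ideal m \<omega>"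
      using that by (auto simp: quot_map_mem x)
    have "mat_adjoint (x' n - x n) = mat_adjoint (x' n) - mat_adjoint (x n)" for n
      using x'(1) x by (intro adjoint_minus[of _ "m n" "m n"] prod_mat_carrier)
    then show ?thesis
      using tracial_ideal_star[OF x'(2)] x'(1) x by (intro quot_map_eqI prod_mat_closed) simp_all
  qed
  then show ?thesis
    unfolding tracial_quotient_def quotient_algebra_def
    by (simp flip: quot_map_def) (use quot_map_self[OF x] in blast)
qed

lemma tracial_quotient_minus:
  assumes x: "x \<in> carrier (prod_mat m)" and y: "y \<in> carrier (prod_mat m)"
  shows "cminus (tracial_quotient m \<omega>) (quot_map m \<omega> x) (quot_map m \<omega> y) = quot_map m \<omega> (\<lambda>n. x n - y n)"
  using x y
  by (simp add: cminus_def tracial_quotient_scale tracial_quotient_plus prod_mat_closed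
      mat_minus_eq[OF prod_mat_carrier prod_mat_carrier])

lemma tracial_quotient_carrier: "carrier (tracial_quotient m \<omega>) = quot_map m \<omega> ` carrier (prod_mat m)"
  by (simp add: tracial_quotient_def quotient_algebra_def quot_map_def)

lemma tracial_quotient_norm: "cnorm (tracial_quotient m \<omega>) X = (INF x\<in>X. cnorm (prod_mat m) x)"
  by (simp add: tracial_quotient_def quotient_algebra_def)

lemma prod_norm_nonneg: "x \<in> carrier (prod_mat m) \<Longrightarrow> 0 \<le> cnorm (prod_mat m) x"
  using op_norm_le_prod_norm[of x m 0] op_norm_nonneg order_trans by blast

lemma tracial_quotient_minus_self:
  assumes "X \<in> carrier (tracial_quotient m \<omega>)"
  shows "cnorm (tracial_quotient m \<omega>) (cminus (tracial_quotient m \<omega>) X X) = 0"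
proof -
  let ?z = "\<lambda>n. 0\<^sub>m (m n) (m n) :: complex mat"
  obtain x where x: "x \<in> carrier (prod_mat m)" "X = quot_map m \<omega> x"
    using assms by (auto simp: tracial_quotient_carrier)
  have "cminus (tracial_quotient m \<omega>) X X = quot_map m \<omega> ?z"
    using x by (simp add: tracial_quotient_minus minus_r_inv_mat[OF prod_mat_carrier])
  moreover have "(INF x\<in>quot_map m \<omega> ?z. cnorm (prod_mat m) x) = 0"
  proof (rule antisym)
    have "(INF x\<in>quot_map m \<omega> ?z. cnorm (prod_mat m) x) \<le> cnorm (prod_mat m) ?z"
      by (intro cINF_lower bdd_belowI2[of _ 0] quot_map_self prod_mat_zero_closed)
        (auto simp: quot_map_mem prod_mat_zero_closed simp del: prod_mat_simps intro: prod_norm_nonneg)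
    then show "(INF x\<in>quot_map m \<omega> ?z. cnorm (prod_mat m) x) \<le> 0" by simp
    show "0 \<le> (INF x\<in>quot_map m \<omega> ?z. cnorm (prod_mat m) x)"
    proof (rule cINF_greatest)
      show "quot_map m \<omega> ?z \<noteq> {}" using quot_map_self[OF prod_mat_zero_closed] by blast
    qed (auto simp: quot_map_mem prod_mat_zero_closed simp del: prod_mat_simps intro: prod_norm_nonneg)
  qed
  ultimately show ?thesis by (simp add: tracial_quotient_norm)
qed

lemma ntr_tendsto_quot_map:
  assumes x: "x \<in> carrier (prod_mat m)" and z: "z \<in> quot_map m \<omega> x" and lim: "((\<lambda>n. ntr (x n)) \<longlongrightarrow> c) \<omega>"
  shows "((\<lambda>n. ntr (z n)) \<longlongrightarrow> c) \<omega>"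
proof -
  have zc: "z \<in> carrier (prod_mat m)" and I: "(\<lambda>n. z n - x n) \<in> tracial_ideal m \<omega>"
    using z by (auto simp: quot_map_mem[OF x])
  have "cmod (ntr (z n) - ntr (x n)) \<le> norm2 (z n - x n)" for n
    using ntr_le_norm2[of "z n - x n" "m n"] zc[THEN prod_mat_carrier, of n] x[THEN prod_mat_carrier, of n]
    by (simp add: ntr_minus)
  then have "((\<lambda>n. ntr (z n) - ntr (x n)) \<longlongrightarrow> 0) \<omega>"
    by (intro Lim_null_comparison[OF always_eventually tracial_idealD(2)[OF I]]) auto
  from tendsto_add[OF this lim] show ?thesis by simp
qed

lemma quot_trace_eq:
  assumes x: "x \<in> carrier (prod_mat m)" and lim: "((\<lambda>n. ntr (x n)) \<longlongrightarrow> c) \<omega>" and \<omega>: "\<omega> \<noteq> bot"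
  shows "quot_trace \<omega> (quot_map m \<omega> x) = c"
  unfolding quot_trace_def
proof (rule the_equality)
  show "\<forall>T\<in>quot_map m \<omega> x. ((\<lambda>n. ntr (T n)) \<longlongrightarrow> c) \<omega>"
    using ntr_tendsto_quot_map[OF x _ lim] by blast
  fix c' assume "\<forall>T\<in>quot_map m \<omega> x. ((\<lambda>n. ntr (T n)) \<longlongrightarrow> c') \<omega>"
  then have "((\<lambda>n. ntr (x n)) \<longlongrightarrow> c') \<omega>" using quot_map_self[OF x] by blast
  then show "c' = c" using tendsto_unique[OF \<omega> _ lim] by blast
qed

lemma quot_trace_tendsto:
  assumes \<omega>: "nontrivial_ultrafilter \<omega>" and x: "x \<in> carrier (prod_mat m)"
  shows "((\<lambda>n. ntr (x n)) \<longlongrightarrow> quot_trace \<omega> (quot_map m \<omega> x)) \<omega>"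
proof -
  obtain C where C: "\<And>n. op_norm (x n) \<le> C" using prod_mat_bounded[OF x] by blast
  have "cmod (ntr (x n)) \<le> C" for n
    using ntr_le_op_norm[OF prod_mat_carrier[OF x]] C order_trans by blast
  then obtain c where c: "((\<lambda>n. ntr (x n)) \<longlongrightarrow> c) \<omega>" using ultrafilter_bounded_limit[OF \<omega>, of "\<lambda>n. ntr (x n)" C] by blast
  have "\<omega> \<noteq> bot" using \<omega> by (simp add: nontrivial_ultrafilter_def)
  then show ?thesis using quot_trace_eq[OF x c] c by simp
qed

text \<open>
  The quotient norm is an infimum over representatives \<open>z\<close> of the difference, and each of them has
  the same limit of traces, which is bounded by the norm of \<open>z\<close>.
\<close>

lemma quot_trace_dist:
  assumes \<omega>: "nontrivial_ultrafilter \<omega>"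
    and x: "x \<in> carrier (prod_mat m)" and Y: "Y \<in> carrier (tracial_quotient m \<omega>)"
  shows "cmod (quot_trace \<omega> (quot_map m \<omega> x) - quot_trace \<omega> Y)
    \<le> cnorm (tracial_quotient m \<omega>) (cminus (tracial_quotient m \<omega>) (quot_map m \<omega> x) Y)"
proof -
  obtain y where y: "y \<in> carrier (prod_mat m)" "Y = quot_map m \<omega> y"
    using Y by (auto simp: tracial_quotient_carrier)
  let ?d = "\<lambda>n. x n - y n"
  have d: "?d \<in> carrier (prod_mat m)" using x y by (intro prod_mat_closed)
  have ne: "\<omega> \<noteq> bot" using \<omega> by (simp add: nontrivial_ultrafilter_def)
  let ?c = "quot_trace \<omega> (quot_map m \<omega> x) - quot_trace \<omega> Y"
  have "((\<lambda>n. ntr (x n) - ntr (y n)) \<longlongrightarrow> ?c) \<omega>"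
    unfolding y(2) by (intro tendsto_diff quot_trace_tendsto \<omega> x y(1))
  then have lim: "((\<lambda>n. ntr (x n - y n)) \<longlongrightarrow> ?c) \<omega>"
    by (simp add: ntr_minus[OF prod_mat_carrier[OF x] prod_mat_carrier[OF y(1)]])
  have "cmod ?c \<le> (INF z\<in>quot_map m \<omega> ?d. cnorm (prod_mat m) z)"
  proof (rule cINF_greatest)
    show "quot_map m \<omega> ?d \<noteq> {}" using quot_map_self[OF d] by blast
    fix z assume z: "z \<in> quot_map m \<omega> ?d"
    then have zc: "z \<in> carrier (prod_mat m)" by (simp add: quot_map_mem[OF d])
    have "((\<lambda>n. cmod (ntr (z n))) \<longlongrightarrow> cmod ?c) \<omega>"
      by (intro tendsto_norm ntr_tendsto_quot_map[OF d z lim])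
    moreover have "cmod (ntr (z n)) \<le> cnorm (prod_mat m) z" for n
      using ntr_le_op_norm[OF prod_mat_carrier[OF zc]] op_norm_le_prod_norm[OF zc] order_trans by blast
    ultimately show "cmod ?c \<le> cnorm (prod_mat m) z"
      by (intro tendsto_upperbound[OF _ always_eventually ne]) auto
  qed
  then show ?thesis
    using x y by (simp add: tracial_quotient_norm tracial_quotient_minus)
qed

section \<open>From matrices to the tracial quotient\<close>

definition truncate :: "(nat \<Rightarrow> nat) \<Rightarrow> nat \<Rightarrow> (nat \<Rightarrow> complex mat) \<Rightarrow> nat \<Rightarrow> complex mat" where
  "truncate m k X = (\<lambda>n. if k \<le> n then X n else 0\<^sub>m (m n) (m n))"

lemma truncate_closed:
  assumes X: "X \<in> carrier (prod_mat m)" shows "truncate m k X \<in> carrier (prod_mat m)"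
proof -
  obtain C where "0 \<le> C" "\<And>n. op_norm (X n) \<le> C" using prod_mat_bounded[OF X] by blast
  then show ?thesis
    by (intro prod_matI[of _ _ C]) (auto simp: truncate_def prod_mat_carrier[OF X])
qed

lemma truncate_norm_le:
  assumes "\<And>n. k \<le> n \<Longrightarrow> op_norm (X n) \<le> C" "0 \<le> C"
  shows "cnorm (prod_mat m) (truncate m k X) \<le> C"
  using assms by (auto simp: truncate_def intro!: cSUP_least)

text \<open>
  Norm convergence in single coordinates becomes uniform after truncation, because the supremum
  then only extends over coordinates from \<open>k\<close> on.
\<close>

lemma truncate_asymp:
  assumes XY: "norm_asymp m X Y"
  shows "(\<lambda>k. cnorm (prod_mat m) (cminus (prod_mat m) (truncate m k X) (truncate m k Y))) \<longlonglongrightarrow> 0"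
proof (rule order_tendstoI)
  note c = norm_asympD(1,2)[OF XY]
  have eq: "cminus (prod_mat m) (truncate m k X) (truncate m k Y) = truncate m k (\<lambda>n. X n - Y n)" for k
    using c by (auto simp: prod_mat_minus truncate_closed) (auto simp: truncate_def fun_eq_iff)
  fix \<delta> :: real
  {
    assume \<delta>: "0 < \<delta>"
    have "\<forall>\<^sub>F n in sequentially. op_norm (X n - Y n) < \<delta> / 2"
      using norm_asympD(3)[OF XY] \<delta> by (intro order_tendstoD(2)) auto
    then obtain N where N: "\<And>n. N \<le> n \<Longrightarrow> op_norm (X n - Y n) < \<delta> / 2"
      by (auto simp: eventually_sequentially)
    have "cnorm (prod_mat m) (truncate m k (\<lambda>n. X n - Y n)) \<le> \<delta> / 2" if "N \<le> k" for k
      using N that \<delta> by (intro truncate_norm_le) (auto intro: less_imp_le)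
    then show "\<forall>\<^sub>F k in sequentially. cnorm (prod_mat m) (cminus (prod_mat m) (truncate m k X) (truncate m k Y)) < \<delta>"
      unfolding eq eventually_sequentially using \<delta> by (intro exI[of _ N]) fastforce
  }
  {
    assume "\<delta> < 0"
    moreover have "0 \<le> cnorm (prod_mat m) (truncate m k (\<lambda>n. X n - Y n))" for k
      using c by (intro prod_norm_nonneg truncate_closed prod_mat_closed)
    ultimately show "\<forall>\<^sub>F k in sequentially. \<delta> < cnorm (prod_mat m) (cminus (prod_mat m) (truncate m k X) (truncate m k Y))"
      unfolding eq by (intro always_eventually allI) (rule less_le_trans)
  }
qed

lemma truncate_quot_map:
  assumes X: "X \<in> carrier (prod_mat m)" and \<omega>: "\<omega> \<le> sequentially"
  shows "quot_map m \<omega> (truncate m k X) = quot_map m \<omega> X"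
proof (rule norm_asymp_quot_map_eq[OF _ \<omega>])
  have "\<forall>\<^sub>F n in sequentially. op_norm (truncate m k X n - X n) = 0"
    using eventually_ge_at_top[of k]
    by eventually_elim (simp add: truncate_def minus_r_inv_mat[OF prod_mat_carrier[OF X]])
  then have "(\<lambda>n. op_norm (truncate m k X n - X n)) \<longlonglongrightarrow> 0" by (rule tendsto_eventually)
  then show "norm_asymp m (truncate m k X) X"
    using X by (simp add: norm_asymp_def truncate_closed)
qed

context matrix_asymptotic_hom begin

lemma star_hom_quotient:
  assumes \<omega>: "\<omega> \<le> sequentially"
  shows "star_hom A (tracial_quotient m \<omega>) (\<lambda>a. quot_map m \<omega> (\<lambda>n. \<theta> n a))"
  unfolding star_hom_def clinear_map_def
  using hom_closed norm_asymp_quot_map_eq[OF hom_add \<omega>] norm_asymp_quot_map_eq[OF hom_scale \<omega>]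
    norm_asymp_quot_map_eq[OF hom_mult \<omega>] norm_asymp_quot_map_eq[OF hom_star \<omega>]
  by (auto simp: tracial_quotient_carrier tracial_quotient_plus tracial_quotient_scale
      tracial_quotient_times tracial_quotient_star)

lemma truncated_discrete_asymptotic_hom:
  "discrete_asymptotic_hom A (prod_mat m) (\<lambda>k a. truncate m k (\<lambda>n. \<theta> n a))"
  unfolding discrete_asymptotic_hom_def asymptotic_hom_def asymptotically_multiplicative_def
proof (intro conjI allI ballI)
  fix a assume a: "a \<in> carrier A"
  obtain C where "0 \<le> C" "\<And>n. op_norm (\<theta> n a) \<le> C" using prod_mat_bounded[OF hom_closed[OF a]] by blast
  then show "bdd_above (range (\<lambda>k. cnorm (prod_mat m) (truncate m k (\<lambda>n. \<theta> n a))))"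
    by (intro bdd_aboveI2[of _ _ C] truncate_norm_le) auto
  have "cstar (prod_mat m) (truncate m k (\<lambda>n. \<theta> n a)) = truncate m k (\<lambda>n. mat_adjoint (\<theta> n a))" for k
    by (auto simp: truncate_def)
  then show "(\<lambda>k. cnorm (prod_mat m) (cminus (prod_mat m) (truncate m k (\<lambda>n. \<theta> n (cstar A a)))
      (cstar (prod_mat m) (truncate m k (\<lambda>n. \<theta> n a))))) \<longlonglongrightarrow> 0"
    using truncate_asymp[OF hom_star[OF a]] by (simp only:)
  fix b assume b: "b \<in> carrier A"
  have "truncate m k (\<lambda>n. \<theta> n a) \<boxdot>\<^bsub>prod_mat m\<^esub> truncate m k (\<lambda>n. \<theta> n b) = truncate m k (\<lambda>n. \<theta> n a * \<theta> n b)" for k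
    by (auto simp: truncate_def fun_eq_iff)
  then show "(\<lambda>k. cnorm (prod_mat m) (cminus (prod_mat m) (truncate m k (\<lambda>n. \<theta> n (a \<boxdot> b)))
      (truncate m k (\<lambda>n. \<theta> n a) \<boxdot>\<^bsub>prod_mat m\<^esub> truncate m k (\<lambda>n. \<theta> n b)))) \<longlonglongrightarrow> 0"
    using truncate_asymp[OF hom_mult[OF a b]] by (simp only:)
  fix c d
  have "c \<triangleright>\<^bsub>prod_mat m\<^esub> truncate m k (\<lambda>n. \<theta> n a) \<boxplus>\<^bsub>prod_mat m\<^esub> d \<triangleright>\<^bsub>prod_mat m\<^esub> truncate m k (\<lambda>n. \<theta> n b)
      = truncate m k (\<lambda>n. c \<cdot>\<^sub>m \<theta> n a + d \<cdot>\<^sub>m \<theta> n b)" for k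
    by (auto simp: truncate_def fun_eq_iff)
  then show "(\<lambda>k. cnorm (prod_mat m) (cminus (prod_mat m) (truncate m k (\<lambda>n. \<theta> n (c \<triangleright> a \<boxplus> d \<triangleright> b)))
      (c \<triangleright>\<^bsub>prod_mat m\<^esub> truncate m k (\<lambda>n. \<theta> n a) \<boxplus>\<^bsub>prod_mat m\<^esub> d \<triangleright>\<^bsub>prod_mat m\<^esub> truncate m k (\<lambda>n. \<theta> n b)))) \<longlonglongrightarrow> 0"
    using truncate_asymp[OF hom_lin[OF a b]] by (simp only:)
qed (auto intro: truncate_closed hom_closed)

end

lemma (in matrix_asymptotic_hom) truncated_cp:
  assumes cp: "\<And>n. cp_map A (matrix_algebra (m n)) (\<theta> n)"
  shows "cp_map A (prod_mat m) (\<lambda>a. truncate m k (\<lambda>n. \<theta> n a))"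
proof (rule cp_map_product)
  fix n
  show "cp_map A (matrix_algebra (m n)) (\<lambda>a. truncate m k (\<lambda>n. \<theta> n a) n)"
    using cp[of n] cp_map_zero[of A "m n"] by (cases "k \<le> n") (simp_all add: truncate_def)
qed (auto intro: truncate_closed hom_closed)

lemma (in cstar_algebra) star_hom_discrete_asymptotic_hom:
  assumes f: "star_hom A (tracial_quotient m \<omega>) f"
  shows "discrete_asymptotic_hom A (tracial_quotient m \<omega>) (\<lambda>_. f)"
proof -
  have c: "f a \<in> carrier (tracial_quotient m \<omega>)" if "a \<in> carrier A" for a
    using f that by (auto simp: star_hom_def clinear_map_def)
  have hom: "f (a \<boxdot> b) = f a \<boxdot>\<^bsub>tracial_quotient m \<omega>\<^esub> f b" "f (cstar A a) = cstar (tracial_quotient m \<omega>) (f a)"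
      "f (x \<triangleright> a \<boxplus> y \<triangleright> b) = x \<triangleright>\<^bsub>tracial_quotient m \<omega>\<^esub> f a \<boxplus>\<^bsub>tracial_quotient m \<omega>\<^esub> y \<triangleright>\<^bsub>tracial_quotient m \<omega>\<^esub> f b"
    if "a \<in> carrier A" "b \<in> carrier A" for a b x y
    using f that by (auto simp: star_hom_def clinear_map_def closed)
  show ?thesis
    unfolding discrete_asymptotic_hom_def asymptotic_hom_def asymptotically_multiplicative_def
    using c by (auto simp flip: hom simp: tracial_quotient_minus_self closed)
qed

lemma quotient_lift_imp_asymptotic_lift:
  assumes f: "star_hom A (tracial_quotient m \<omega>) f" and lift: "lifts_to A m \<omega> f \<psi>"
  shows "lifts_asymptotically_to A m \<omega> (\<lambda>_. f) \<psi>"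
proof -
  have c: "f a \<in> carrier (tracial_quotient m \<omega>)" if "a \<in> carrier A" for a
    using f that by (auto simp: star_hom_def clinear_map_def)
  show ?thesis
    using lift c by (simp add: lifts_asymptotically_to_def lifts_to_def tracial_quotient_minus_self)
qed

lemma (in matrix_asymptotic_hom) quotient_trace:
  assumes \<omega>: "nontrivial_ultrafilter \<omega>" and a: "a \<in> carrier A"
    and tr: "(\<lambda>n. cmod (\<tau> a - ntr (\<theta> n a))) \<longlonglongrightarrow> 0"
  shows "\<tau> a = quot_trace \<omega> (quot_map m \<omega> (\<lambda>n. \<theta> n a))"
proof -
  have "(\<lambda>n. \<tau> a - (\<tau> a - ntr (\<theta> n a))) \<longlonglongrightarrow> \<tau> a - 0"
    using tr by (intro tendsto_diff tendsto_const) (simp add: tendsto_norm_zero_iff)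
  then have "(\<lambda>n. ntr (\<theta> n a)) \<longlonglongrightarrow> \<tau> a" by simp
  then have "((\<lambda>n. ntr (\<theta> n a)) \<longlongrightarrow> \<tau> a) \<omega>"
    using tendsto_mono[OF nontrivial_ultrafilter_le_sequentially[OF \<omega>]] by blast
  then show ?thesis
    using quot_trace_eq[OF hom_closed[OF a]] \<omega> by (simp add: nontrivial_ultrafilter_def)
qed

lemma (in matrix_asymptotic_hom) truncation_lifts:
  assumes \<omega>: "nontrivial_ultrafilter \<omega>"
  shows "lifts_to A m \<omega> (\<lambda>a. quot_map m \<omega> (\<lambda>n. \<theta> n a)) (\<lambda>k a. truncate m k (\<lambda>n. \<theta> n a))"
  using truncate_quot_map[OF hom_closed nontrivial_ultrafilter_le_sequentially[OF \<omega>]]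
  by (simp add: lifts_to_def)

section \<open>From the tracial quotient to matrices\<close>

text \<open>
  The norm of a coordinate is bounded by the norm in the product, for every choice of
  coordinates \<open>n k\<close>.
\<close>

lemma (in cstar_algebra) asymptotic_hom_slice:
  assumes \<psi>: "discrete_asymptotic_hom A (prod_mat m) \<psi>"
  shows "asymptotic_hom A (\<lambda>k. matrix_algebra (m (n k))) (\<lambda>k a. \<psi> k a (n k))"
proof -
  have c: "\<psi> k a \<in> carrier (prod_mat m)" if "a \<in> carrier A" for k a
    using \<psi> that by (auto simp: discrete_asymptotic_hom_def asymptotic_hom_def)
  have slice: "(\<lambda>k. cnorm (matrix_algebra (m (n k))) (cminus (matrix_algebra (m (n k))) (X k (n k)) (Y k (n k)))) \<longlonglongrightarrow> 0"
    if X: "\<And>k. X k \<in> carrier (prod_mat m)" and Y: "\<And>k. Y k \<in> carrier (prod_mat m)"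
      and lim: "(\<lambda>k. cnorm (prod_mat m) (cminus (prod_mat m) (X k) (Y k))) \<longlonglongrightarrow> 0" for X Y
  proof (rule Lim_null_comparison[OF always_eventually lim], intro allI)
    fix k
    have "cminus (prod_mat m) (X k) (Y k) \<in> carrier (prod_mat m)"
      using X Y by (simp add: prod_mat_minus prod_mat_closed)
    from op_norm_le_prod_norm[OF this, of "n k"]
    show "norm (cnorm (matrix_algebra (m (n k))) (cminus (matrix_algebra (m (n k))) (X k (n k)) (Y k (n k))))
        \<le> cnorm (prod_mat m) (cminus (prod_mat m) (X k) (Y k))"
      by (simp add: cminus_def)
  qed
  show ?thesis
    unfolding asymptotic_hom_def asymptotically_multiplicative_def
  proof (intro conjI allI ballI)
    fix k show "(\<lambda>a. \<psi> k a (n k)) \<in> carrier A \<rightarrow> carrier (matrix_algebra (m (n k)))"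
      using prod_mat_carrier[OF c] by auto
  next
    fix a assume a: "a \<in> carrier A"
    have "bdd_above (range (\<lambda>k. cnorm (prod_mat m) (\<psi> k a)))"
      using \<psi> a by (simp add: discrete_asymptotic_hom_def asymptotic_hom_def del: prod_mat_simps)
    then obtain C where C: "\<And>k. cnorm (prod_mat m) (\<psi> k a) \<le> C" by (auto simp: bdd_above_def simp del: prod_mat_simps)
    show "bdd_above (range (\<lambda>k. cnorm (matrix_algebra (m (n k))) (\<psi> k a (n k))))"
      using order_trans[OF op_norm_le_prod_norm[OF c[OF a]] C] by (intro bdd_aboveI2[of _ _ C]) simp
    have "(\<lambda>k. cnorm (prod_mat m) (cminus (prod_mat m) (\<psi> k (cstar A a)) (cstar (prod_mat m) (\<psi> k a)))) \<longlonglongrightarrow> 0"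
      using \<psi> a unfolding discrete_asymptotic_hom_def asymptotic_hom_def by blast
    from slice[OF _ _ this] c[OF a] c[OF star_closed[OF a]]
    show "(\<lambda>k. cnorm (matrix_algebra (m (n k))) (cminus (matrix_algebra (m (n k))) (\<psi> k (cstar A a) (n k))
        (cstar (matrix_algebra (m (n k))) (\<psi> k a (n k))))) \<longlonglongrightarrow> 0"
      by (simp add: prod_mat_closed)
    fix b assume b: "b \<in> carrier A"
    have "(\<lambda>k. cnorm (prod_mat m) (cminus (prod_mat m) (\<psi> k (a \<boxdot> b)) (\<psi> k a \<boxdot>\<^bsub>prod_mat m\<^esub> \<psi> k b))) \<longlonglongrightarrow> 0"
      using \<psi> a b unfolding discrete_asymptotic_hom_def asymptotic_hom_def asymptotically_multiplicative_def by blast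
    from slice[OF _ _ this] c[OF a] c[OF b] c[OF times_closed[OF a b]]
    show "(\<lambda>k. cnorm (matrix_algebra (m (n k))) (cminus (matrix_algebra (m (n k))) (\<psi> k (a \<boxdot> b) (n k))
        (\<psi> k a (n k) \<boxdot>\<^bsub>matrix_algebra (m (n k))\<^esub> \<psi> k b (n k)))) \<longlonglongrightarrow> 0"
      by (simp add: prod_mat_closed)
    fix x y
    have "(\<lambda>k. cnorm (prod_mat m) (cminus (prod_mat m) (\<psi> k (x \<triangleright> a \<boxplus> y \<triangleright> b))
        (x \<triangleright>\<^bsub>prod_mat m\<^esub> \<psi> k a \<boxplus>\<^bsub>prod_mat m\<^esub> y \<triangleright>\<^bsub>prod_mat m\<^esub> \<psi> k b))) \<longlonglongrightarrow> 0"
      using \<psi> a b unfolding discrete_asymptotic_hom_def asymptotic_hom_def by blast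
    from slice[OF _ _ this] c[OF a] c[OF b] c[OF plus_closed[OF scale_closed[OF a] scale_closed[OF b]]]
    show "(\<lambda>k. cnorm (matrix_algebra (m (n k))) (cminus (matrix_algebra (m (n k))) (\<psi> k (x \<triangleright> a \<boxplus> y \<triangleright> b) (n k))
        (x \<triangleright>\<^bsub>matrix_algebra (m (n k))\<^esub> \<psi> k a (n k) \<boxplus>\<^bsub>matrix_algebra (m (n k))\<^esub> y \<triangleright>\<^bsub>matrix_algebra (m (n k))\<^esub> \<psi> k b (n k)))) \<longlonglongrightarrow> 0"
      by (simp add: prod_mat_closed)
  qed
qed

lemma separable_cstar_dense_sequence:
  assumes A: "cstar_algebra A" and sep: "separable_cstar A"
  obtains d :: "nat \<Rightarrow> 'a" where "\<And>i. d i \<in> carrier (A :: 'a star_alg)"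
    "\<And>a \<epsilon>. a \<in> carrier A \<Longrightarrow> 0 < \<epsilon> \<Longrightarrow> \<exists>i. cnorm A (cminus A a (d i)) < \<epsilon>"
proof -
  interpret cstar_algebra A by (rule A)
  interpret M: Metric_space "carrier A" "cdist A" by (rule metric_space)
  obtain D where D: "countable D" "D \<subseteq> carrier A" "M.mtopology closure_of D = carrier A"
    using sep unfolding separable_cstar_def separable_space_def M.topspace_mtopology by blast
  have near: "\<exists>x\<in>D. cnorm A (cminus A a x) < \<epsilon>" if a: "a \<in> carrier A" and e: "0 < \<epsilon>" for a \<epsilon>
  proof -
    have "a \<in> M.mtopology closure_of D" using D(3) a by simp
    then have "\<forall>r>0. \<exists>x\<in>D. x \<in> M.mball a r" unfolding M.metric_closure_of by simp
    then obtain x where x: "x \<in> D" "x \<in> M.mball a \<epsilon>" using e by (meson bexE)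
    then have "cnorm A (cminus A a x) < \<epsilon>" using a D(2) by (auto simp: cdist_def split: if_splits)
    then show ?thesis using x(1) by (rule bexI)
  qed
  have "D \<noteq> {}" using near[of "czero A" 1] zero_closed by auto
  then have r: "range (from_nat_into D) = D" using D(1) by (rule range_from_nat_into)
  show thesis
  proof (rule that[of "from_nat_into D"])
    show "from_nat_into D i \<in> carrier A" for i using from_nat_into[OF \<open>D \<noteq> {}\<close>, of i] D(2) by (rule subsetD[rotated])
    fix a and \<epsilon> :: real assume "a \<in> carrier A" "0 < \<epsilon>"
    then obtain x where x: "x \<in> D" "cnorm A (cminus A a x) < \<epsilon>" using near by meson
    then obtain i where "x = from_nat_into D i" using r by (metis rangeE)
    then show "\<exists>i. cnorm A (cminus A a (from_nat_into D i)) < \<epsilon>" using x(2) by auto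
  qed
qed

lemma trace_minus:
  assumes A: "cstar_algebra A" and \<tau>: "is_trace A \<tau>" and ab: "a \<in> carrier A" "b \<in> carrier A"
  shows "cmod (\<tau> a - \<tau> b) \<le> cnorm A (cminus A a b)"
proof -
  interpret cstar_algebra A by (rule A)
  have "\<tau> (cminus A a b) = \<tau> a - \<tau> b"
    using \<tau> ab by (simp add: is_trace_def cminus_def closed)
  then show ?thesis using \<tau> minus_closed[OF ab] unfolding is_trace_def by metis
qed

text \<open>
  The traces of \<open>\<psi>\<^sup>k(a)\<close> in the quotient converge to \<open>\<tau> a\<close> since they are close to those of \<open>f\<^sup>k(a)\<close>,
  and each of them is a limit along \<open>\<omega>\<close> of traces of coordinates. A single coordinate can serve
  finitely many elements, here the first \<open>k + 1\<close> of the dense sequence. Elements of \<open>A\<close> are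
  reached by asymptotic contractivity (\<open>hom_dist\<close>).
\<close>

theorem slice_traces:
  fixes A :: "'a star_alg" and d :: "nat \<Rightarrow> 'a"
  assumes A: "cstar_algebra A" and \<tau>: "is_trace A \<tau>" and \<omega>: "nontrivial_ultrafilter \<omega>"
    and d: "\<And>i. d i \<in> carrier A"
    and dense: "\<And>a \<epsilon>. a \<in> carrier A \<Longrightarrow> 0 < \<epsilon> \<Longrightarrow> \<exists>i. cnorm A (cminus A a (d i)) < \<epsilon>"
    and f: "discrete_asymptotic_hom A (tracial_quotient m \<omega>) f"
    and f_trace: "\<And>a. a \<in> carrier A \<Longrightarrow> (\<lambda>k. quot_trace \<omega> (f k a)) \<longlonglongrightarrow> \<tau> a"
    and \<psi>: "discrete_asymptotic_hom A (prod_mat m) \<psi>" and lift: "lifts_asymptotically_to A m \<omega> f \<psi>"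
  obtains n :: "nat \<Rightarrow> nat" where "asymptotic_hom A (\<lambda>k. matrix_algebra (m (n k))) (\<lambda>k a. \<psi> k a (n k))"
    "\<And>a. a \<in> carrier A \<Longrightarrow> (\<lambda>k. ntr (\<psi> k a (n k))) \<longlonglongrightarrow> \<tau> a"
proof -
  have ne: "\<omega> \<noteq> bot" using \<omega> by (simp add: nontrivial_ultrafilter_def)
  have c: "\<psi> k a \<in> carrier (prod_mat m)" if "a \<in> carrier A" for k a
    using \<psi> that by (auto simp: discrete_asymptotic_hom_def asymptotic_hom_def)
  let ?t = "\<lambda>k a. quot_trace \<omega> (quot_map m \<omega> (\<psi> k a))"
  have t: "(\<lambda>k. ?t k a) \<longlonglongrightarrow> \<tau> a" if a: "a \<in> carrier A" for a
  proof -
    have "f k a \<in> carrier (tracial_quotient m \<omega>)" for k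
      using f a by (auto simp: discrete_asymptotic_hom_def asymptotic_hom_def)
    then have le: "cmod (?t k a - quot_trace \<omega> (f k a))
        \<le> cnorm (tracial_quotient m \<omega>) (cminus (tracial_quotient m \<omega>) (quot_map m \<omega> (\<psi> k a)) (f k a))" for k
      by (intro quot_trace_dist \<omega> c a)
    have lim: "(\<lambda>k. cnorm (tracial_quotient m \<omega>) (cminus (tracial_quotient m \<omega>) (quot_map m \<omega> (\<psi> k a)) (f k a))) \<longlonglongrightarrow> 0"
      using lift a by (simp add: lifts_asymptotically_to_def)
    have "(\<lambda>k. ?t k a - quot_trace \<omega> (f k a)) \<longlonglongrightarrow> 0"
      by (rule Lim_null_comparison[OF always_eventually[OF allI[OF le]] lim])
    from tendsto_add[OF this f_trace[OF a]] show ?thesis by simp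
  qed
  have "\<exists>n. \<forall>i\<in>{..k}. cmod (ntr (\<psi> k (d i) n) - ?t k (d i)) < 1 / real (Suc k)" for k
  proof -
    have "\<forall>\<^sub>F n in \<omega>. cmod (ntr (\<psi> k (d i) n) - ?t k (d i)) < 1 / real (Suc k)" for i
      using tendstoD[OF quot_trace_tendsto[OF \<omega> c[OF d]], of "1 / real (Suc k)" k i] by (simp add: dist_norm)
    then have "\<forall>\<^sub>F n in \<omega>. \<forall>i\<in>{..k}. cmod (ntr (\<psi> k (d i) n) - ?t k (d i)) < 1 / real (Suc k)"
      by (intro eventually_ball_finite) auto
    then show ?thesis using eventually_happens'[OF ne] by blast
  qed
  then obtain n where n: "\<And>k i. i \<le> k \<Longrightarrow> cmod (ntr (\<psi> k (d i) (n k)) - ?t k (d i)) < 1 / real (Suc k)"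
    by (metis atMost_iff)
  have hom: "asymptotic_hom A (\<lambda>k. matrix_algebra (m (n k))) (\<lambda>k a. \<psi> k a (n k))"
    by (rule cstar_algebra.asymptotic_hom_slice[OF A \<psi>])
  interpret matrix_asymptotic_hom A "\<lambda>k. m (n k)" "\<lambda>k a. \<psi> k a (n k)"
    using A hom by (simp add: matrix_asymptotic_hom_def matrix_asymptotic_hom_axioms_def)
  have on_dense: "(\<lambda>k. ntr (\<psi> k (d i) (n k))) \<longlonglongrightarrow> \<tau> (d i)" for i
  proof -
    have "\<forall>\<^sub>F k in sequentially. cmod (ntr (\<psi> k (d i) (n k)) - ?t k (d i)) \<le> 1 / real (Suc k)"
      by (rule eventually_mono[OF eventually_ge_at_top[of i]]) (rule less_imp_le[OF n])
    then have "(\<lambda>k. ntr (\<psi> k (d i) (n k)) - ?t k (d i)) \<longlonglongrightarrow> 0"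
      by (rule Lim_null_comparison[OF _ LIMSEQ_Suc[OF lim_1_over_n]])
    from tendsto_add[OF this t[OF d[of i]]] show ?thesis by simp
  qed
  have "(\<lambda>k. ntr (\<psi> k a (n k))) \<longlonglongrightarrow> \<tau> a" if a: "a \<in> carrier A" for a
  proof (rule tendstoI)
    fix \<delta> :: real assume \<delta>: "0 < \<delta>"
    then obtain i where i: "cnorm A (cminus A a (d i)) < \<delta> / 3" using dense[OF a, of "\<delta> / 3"] by auto
    have "\<forall>\<^sub>F k in sequentially. dist (ntr (\<psi> k (d i) (n k))) (\<tau> (d i)) < \<delta> / 3"
      using \<delta> by (intro tendstoD[OF on_dense]) simp
    with hom_dist[OF a d i] show "\<forall>\<^sub>F k in sequentially. dist (ntr (\<psi> k a (n k))) (\<tau> a) < \<delta>"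
    proof eventually_elim
      case (elim k)
      have "cmod (ntr (\<psi> k a (n k)) - ntr (\<psi> k (d i) (n k))) \<le> op_norm (\<psi> k a (n k) - \<psi> k (d i) (n k))"
        using ntr_le_op_norm[of "\<psi> k a (n k) - \<psi> k (d i) (n k)" "m (n k)"] hom_carrier_mat[OF a, of k] hom_carrier_mat[OF d, of k i]
        by (simp add: ntr_minus)
      moreover have "cmod (\<tau> a - \<tau> (d i)) < \<delta> / 3" using trace_minus[OF A \<tau> a d, of i] i by linarith
      moreover have "dist (ntr (\<psi> k a (n k))) (\<tau> a) \<le> cmod (ntr (\<psi> k a (n k)) - ntr (\<psi> k (d i) (n k)))
          + (dist (ntr (\<psi> k (d i) (n k))) (\<tau> (d i)) + cmod (\<tau> a - \<tau> (d i)))"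
        by (simp add: dist_norm) norm
      ultimately show ?case using elim by linarith
    qed
  qed
  with hom show thesis by (rule that)
qed

section \<open>The equivalences\<close>

theorem proposition23:
  fixes A :: "'a star_alg"
    and \<tau> :: "'a \<Rightarrow> complex"
    and \<omega> :: "nat filter"
  assumes "cstar_algebra A"
    and "separable_cstar A"
    and "is_trace A \<tau>"
    and "nontrivial_ultrafilter \<omega>"
  shows
    "((MF_trace A \<tau> \<longleftrightarrow>
        (\<exists>(m :: nat \<Rightarrow> nat) f. (\<forall>n. 0 < m n) \<and>
           star_hom A (tracial_quotient m \<omega>) f \<and>
           (\<forall>a\<in>carrier A. \<tau> a = quot_trace \<omega> (f a)) \<and>
           (\<exists>\<psi>. discrete_asymptotic_hom A (prod_mat m) \<psi> \<and> lifts_to A m \<omega> f \<psi>)))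
      \<and>
      (MF_trace A \<tau> \<longleftrightarrow>
        (\<exists>(m :: nat \<Rightarrow> nat) f. (\<forall>n. 0 < m n) \<and>
           discrete_asymptotic_hom A (tracial_quotient m \<omega>) f \<and>
           (\<forall>a\<in>carrier A. (\<lambda>k. quot_trace \<omega> (f k a)) \<longlonglongrightarrow> \<tau> a) \<and>
           (\<exists>\<psi>. discrete_asymptotic_hom A (prod_mat m) \<psi> \<and> lifts_asymptotically_to A m \<omega> f \<psi>))))
     \<and>
     ((quasidiagonal_trace A \<tau> \<longleftrightarrow>
        (\<exists>(m :: nat \<Rightarrow> nat) f. (\<forall>n. 0 < m n) \<and>
           star_hom A (tracial_quotient m \<omega>) f \<and>
           (\<forall>a\<in>carrier A. \<tau> a = quot_trace \<omega> (f a)) \<and>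
           (\<exists>\<psi>. cp_discrete_asymptotic_hom A (prod_mat m) \<psi> \<and> lifts_to A m \<omega> f \<psi>)))
      \<and>
      (quasidiagonal_trace A \<tau> \<longleftrightarrow>
        (\<exists>(m :: nat \<Rightarrow> nat) f. (\<forall>n. 0 < m n) \<and>
           discrete_asymptotic_hom A (tracial_quotient m \<omega>) f \<and>
           (\<forall>a\<in>carrier A. (\<lambda>k. quot_trace \<omega> (f k a)) \<longlonglongrightarrow> \<tau> a) \<and>
           (\<exists>\<psi>. cp_discrete_asymptotic_hom A (prod_mat m) \<psi> \<and> lifts_asymptotically_to A m \<omega> f \<psi>))))"
proof -
  note A = assms(1) and \<tau> = assms(3) and \<omega> = assms(4)
  let ?hom = "\<lambda>P. \<exists>(m :: nat \<Rightarrow> nat) f. (\<forall>n. 0 < m n) \<and> star_hom A (tracial_quotient m \<omega>) f \<and>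
     (\<forall>a\<in>carrier A. \<tau> a = quot_trace \<omega> (f a)) \<and> (\<exists>\<psi>. P m \<psi> \<and> lifts_to A m \<omega> f \<psi>)"
  let ?asymp = "\<lambda>P. \<exists>(m :: nat \<Rightarrow> nat) f. (\<forall>n. 0 < m n) \<and> discrete_asymptotic_hom A (tracial_quotient m \<omega>) f \<and>
     (\<forall>a\<in>carrier A. (\<lambda>k. quot_trace \<omega> (f k a)) \<longlonglongrightarrow> \<tau> a) \<and>
     (\<exists>\<psi>. P m \<psi> \<and> lifts_asymptotically_to A m \<omega> f \<psi>)"
  let ?mf = "\<lambda>m. discrete_asymptotic_hom A (prod_mat m)"
  let ?qd = "\<lambda>m. cp_discrete_asymptotic_hom A (prod_mat m)"
  obtain d :: "nat \<Rightarrow> 'a" where d: "\<And>i. d i \<in> carrier A"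
    and dense: "\<And>a \<epsilon>. a \<in> carrier A \<Longrightarrow> 0 < \<epsilon> \<Longrightarrow> \<exists>i. cnorm A (cminus A a (d i)) < \<epsilon>"
    using separable_cstar_dense_sequence[OF A assms(2)] by blast
  have hom_asymp: "?asymp P" if hyp: "?hom P" for P :: "(nat \<Rightarrow> nat) \<Rightarrow> (nat \<Rightarrow> 'a \<Rightarrow> nat \<Rightarrow> complex mat) \<Rightarrow> bool"
    using hyp
  proof (elim exE conjE)
    fix m f \<psi> assume m: "\<forall>n. 0 < m n" and f: "star_hom A (tracial_quotient m \<omega>) f"
      and tr: "\<forall>a\<in>carrier A. \<tau> a = quot_trace \<omega> (f a)" and \<psi>: "P m \<psi>" "lifts_to A m \<omega> f \<psi>"
    show "?asymp P"
    proof (intro exI conjI)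
      show "discrete_asymptotic_hom A (tracial_quotient m \<omega>) (\<lambda>_. f)"
        by (rule cstar_algebra.star_hom_discrete_asymptotic_hom[OF A f])
      show "\<forall>a\<in>carrier A. (\<lambda>k. quot_trace \<omega> (f a)) \<longlonglongrightarrow> \<tau> a" using tr by simp
      show "lifts_asymptotically_to A m \<omega> (\<lambda>_. f) \<psi>"
        by (rule quotient_lift_imp_asymptotic_lift[OF f \<psi>(2)])
    qed (rule m \<psi>(1))+
  qed
  have mf1: "?hom ?mf" if "MF_trace A \<tau>"
  proof -
    obtain m \<phi> where m: "\<forall>n. 0 < m n" and \<phi>: "asymptotic_hom A (\<lambda>n. matrix_algebra (m n)) \<phi>"
      and tr: "\<forall>a\<in>carrier A. (\<lambda>n. cmod (\<tau> a - ntr (\<phi> n a))) \<longlonglongrightarrow> 0"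
      using \<open>MF_trace A \<tau>\<close> unfolding MF_trace_def by blast
    interpret matrix_asymptotic_hom A m \<phi>
      using A \<phi> by (simp add: matrix_asymptotic_hom_def matrix_asymptotic_hom_axioms_def)
    show ?thesis
    proof (intro exI conjI)
      show "star_hom A (tracial_quotient m \<omega>) (\<lambda>a. quot_map m \<omega> (\<lambda>n. \<phi> n a))"
        by (rule star_hom_quotient[OF nontrivial_ultrafilter_le_sequentially[OF \<omega>]])
      show "\<forall>a\<in>carrier A. \<tau> a = quot_trace \<omega> (quot_map m \<omega> (\<lambda>n. \<phi> n a))"
        using tr by (intro ballI quotient_trace[OF \<omega>]) auto
    qed (rule m truncated_discrete_asymptotic_hom truncation_lifts[OF \<omega>])+
  qed
  have mf2: "MF_trace A \<tau>" if "?asymp ?mf"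
  proof -
    obtain m f \<psi> where m: "\<forall>n. 0 < m n" and f: "discrete_asymptotic_hom A (tracial_quotient m \<omega>) f"
      and tr: "\<forall>a\<in>carrier A. (\<lambda>k. quot_trace \<omega> (f k a)) \<longlonglongrightarrow> \<tau> a"
      and \<psi>: "discrete_asymptotic_hom A (prod_mat m) \<psi>" "lifts_asymptotically_to A m \<omega> f \<psi>"
      using \<open>?asymp ?mf\<close> by blast
    obtain n where n: "asymptotic_hom A (\<lambda>k. matrix_algebra (m (n k))) (\<lambda>k a. \<psi> k a (n k))"
      "\<And>a. a \<in> carrier A \<Longrightarrow> (\<lambda>k. ntr (\<psi> k a (n k))) \<longlonglongrightarrow> \<tau> a"
      using slice_traces[OF A \<tau> \<omega> d dense f bspec[OF tr] \<psi>] by blast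
    have "(\<lambda>k. cmod (\<tau> a - ntr (\<psi> k a (n k)))) \<longlonglongrightarrow> 0" if "a \<in> carrier A" for a
      using tendsto_norm_zero[OF tendsto_diff[OF tendsto_const n(2)[OF that], of "\<tau> a", simplified]] .
    then show ?thesis
      unfolding MF_trace_def using \<tau> m n(1)
      by (intro conjI exI[of _ "\<lambda>k. m (n k)"] exI[of _ "\<lambda>k a. \<psi> k a (n k)"]) auto
  qed
  have qd1: "?hom ?qd" if "quasidiagonal_trace A \<tau>"
  proof -
    obtain m \<phi> where m: "\<forall>n. 0 < m n" and ccp: "\<forall>n. ccp_map A (matrix_algebra (m n)) (\<phi> n)"
      and mult: "asymptotically_multiplicative A (\<lambda>n. matrix_algebra (m n)) \<phi>"
      and tr: "\<forall>a\<in>carrier A. (\<lambda>n. cmod (\<tau> a - ntr (\<phi> n a))) \<longlonglongrightarrow> 0"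
      using \<open>quasidiagonal_trace A \<tau>\<close> unfolding quasidiagonal_trace_def by blast
    have "asymptotic_hom A (\<lambda>n. matrix_algebra (m n)) \<phi>"
      using cstar_algebra.ccp_asymptotic_hom[OF A] ccp mult by blast
    then interpret matrix_asymptotic_hom A m \<phi>
      using A by (simp add: matrix_asymptotic_hom_def matrix_asymptotic_hom_axioms_def)
    have lift: "cp_discrete_asymptotic_hom A (prod_mat m) (\<lambda>k a. truncate m k (\<lambda>n. \<phi> n a))"
      using ccp truncated_discrete_asymptotic_hom truncated_cp
      by (simp add: cp_discrete_asymptotic_hom_def ccp_map_def)
    show ?thesis
    proof (intro exI conjI)
      show "star_hom A (tracial_quotient m \<omega>) (\<lambda>a. quot_map m \<omega> (\<lambda>n. \<phi> n a))"
        by (rule star_hom_quotient[OF nontrivial_ultrafilter_le_sequentially[OF \<omega>]])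
      show "\<forall>a\<in>carrier A. \<tau> a = quot_trace \<omega> (quot_map m \<omega> (\<lambda>n. \<phi> n a))"
        using tr by (intro ballI quotient_trace[OF \<omega>]) auto
    qed (rule m lift truncation_lifts[OF \<omega>])+
  qed
  have qd2: "quasidiagonal_trace A \<tau>" if "?asymp ?qd"
  proof -
    obtain m f \<psi> where m: "\<forall>n. 0 < m n" and f: "discrete_asymptotic_hom A (tracial_quotient m \<omega>) f"
      and tr: "\<forall>a\<in>carrier A. (\<lambda>k. quot_trace \<omega> (f k a)) \<longlonglongrightarrow> \<tau> a"
      and cp\<psi>: "cp_discrete_asymptotic_hom A (prod_mat m) \<psi>" and lift: "lifts_asymptotically_to A m \<omega> f \<psi>"
      using \<open>?asymp ?qd\<close> by blast
    have \<psi>: "discrete_asymptotic_hom A (prod_mat m) \<psi>" and cp: "\<And>k. cp_map A (prod_mat m) (\<psi> k)"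
      using cp\<psi> by (auto simp: cp_discrete_asymptotic_hom_def)
    obtain n where n: "asymptotic_hom A (\<lambda>k. matrix_algebra (m (n k))) (\<lambda>k a. \<psi> k a (n k))"
      "\<And>a. a \<in> carrier A \<Longrightarrow> (\<lambda>k. ntr (\<psi> k a (n k))) \<longlonglongrightarrow> \<tau> a"
      using slice_traces[OF A \<tau> \<omega> d dense f bspec[OF tr] \<psi> lift] by blast
    interpret matrix_asymptotic_hom A "\<lambda>k. m (n k)" "\<lambda>k a. \<psi> k a (n k)"
      using A n(1) by (simp add: matrix_asymptotic_hom_def matrix_asymptotic_hom_axioms_def)
    show ?thesis
      using m by (intro quasidiagonal_trace_of_cp[OF cp_map_coordinate[OF cp] d dense _ \<tau> n(2)]) auto
  qed
  show ?thesis
  proof (intro conjI iffI)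
    show "?hom ?mf" "?asymp ?mf" if "MF_trace A \<tau>" using mf1[OF that] hom_asymp[OF mf1[OF that]] .
    show "?hom ?qd" "?asymp ?qd" if "quasidiagonal_trace A \<tau>" using qd1[OF that] hom_asymp[OF qd1[OF that]] .
    show "MF_trace A \<tau>" if "?hom ?mf" by (rule mf2[OF hom_asymp[OF that]])
    show "quasidiagonal_trace A \<tau>" if "?hom ?qd" by (rule qd2[OF hom_asymp[OF that]])
  qed (rule mf2 qd2, assumption)+
qed

end
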